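(* Assume $q>2$ and $1\le r\le n$. Let $\mathcal{B}=\{f'_1,\dots,f'_v\}$ be an SNF basis of $R^{\mathcal{L}_1}$ for $\eta_{1,r}$ whose reduction modulo $pR$ is the monomial basis $\mathcal{M}$ and which contains every element of $\mathcal{M}_R$ having some exponent strictly between $0$ and $q-1$, indexed so that $f'_1$ reduces to the constant function $1$. For $2\le i\le v$ let $(s^{(i)}_0,\dots,s^{(i)}_{t-1})$ be the type of $f'_i$ and let $p^{\beta_i}$ be the invariant of $\eta_{1,r}$ corresponding to $f'_i$. Then $\beta_i=\sum_{j=0}^{t-1}\max\{0,r-s^{(i)}_j\}$.
   Context: $q=p^t$, $V=\mathbb{F}_q^{n+1}$, $\mathcal{L}_k$ the set of $k$-dimensional subspaces, $v=|\mathcal{L}_1|$; $R=\mathbb{Z}_p[\xi_{q-1}]$ (ring of integers of the unramified degree-$t$ extension of $\mathbb{Q}_p$, maximal ideal $pR$, residue field $\mathbb{F}_q$); $T$ the Teichmüller character. $\eta_{1,r}:R^{\mathcal{L}_1}\to R^{\mathcal{L}_r}$, $(\eta_{1,r}f)(Y)=\sum_{Z\subseteq Y}f(Z)$ (injective). $\mathcal{M}$: $\mathbb{F}_q$-valued functions $x_0^{b_0}\cdots x_n^{b_n}$ on $\mathcal{L}_1$ with $0\le b_i\le q-1$, $\sum b_i\equiv0\pmod{q-1}$, $(b_0,\dots,b_n)\ne(q-1,\dots,q-1)$; $\mathcal{M}_R$: lifts $T(x_0^{b_0}\cdots x_n^{b_n}):\langle(a_i)\rangle\mapsto\prod T(a_i)^{b_i}$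 ($T(a)^0=1$). Type of a nonconstant monomial: with $b_i=\sum_{j=0}^{t-1}a_{i,j}p^j$ ($0\le a_{i,j}\le p-1$), $s_j=\frac1{q-1}\sum_{i=0}^n\big(\sum_{\ell=0}^{j-1}p^{\ell+t-j}a_{i,\ell}+\sum_{\ell=j}^{t-1}p^{\ell-j}a_{i,\ell}\big)$; the type of an element of $\mathcal{B}$ is that of its reduction. SNF basis: with $M=R^{\mathcal{L}_1}$, $N=R^{\mathcal{L}_r}$, $M_i=\{x\in M\mid\eta_{1,r}(x)\in p^iN\}$, $\overline M_i$ its image in $M/pM$, $\ell$ minimal with $\overline M_\ell=0$, a basis $\mathcal{B}=\bigcup_{i=0}^{\ell-1}\mathcal{B}_i$ with $\mathcal{B}_i\subseteq M_i$ mapping bijectively onto a basis of $\overline M_i/\overline M_{i+1}$; the invariant corresponding to $e\in\mathcal{B}_i$ is $p^i$. *)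

theory Defs
  imports
    "HOL-Analysis.Cartesian_Space"
    "HOL-Library.Function_Algebras"
    "HOL-Algebra.Algebraic_Closure_Type"
begin

text \<open>The p-adic integers as the inverse limit of the rings Z/p^k: the k-th component is the
  representative in {0..<p^k} of the residue modulo p^k.\<close>

definition padic_int :: "nat \<Rightarrow> (nat \<Rightarrow> int) ring" where
  "padic_int p =
    \<lparr> carrier = {x. \<forall>k. 0 \<le> x k \<and> x k < int p ^ k \<and> x (Suc k) mod int p ^ k = x k},
      monoid.mult = (\<lambda>x y k. (x k * y k) mod int p ^ k),
      one = (\<lambda>k. 1 mod int p ^ k),
      zero = (\<lambda>k. 0),
      add = (\<lambda>x y k. (x k + y k) mod int p ^ k) \<rparr>"

lemma padic_int_cring:
  assumes "p > 0"
  shows "cring (padic_int p)"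
proof -
  have P: "0 < int p ^ k" for k
    using assms by simp
  have red: "(z mod int p ^ Suc k) mod int p ^ k = z mod int p ^ k" for z k
    by (simp add: mod_mod_cancel)
  have closed: "(\<lambda>k. z k mod int p ^ k) \<in> carrier (padic_int p)"
    if "\<And>k. z (Suc k) mod int p ^ k = z k mod int p ^ k" for z
    using that P by (simp add: padic_int_def red del: power_Suc)
  have mods: "x (Suc k) mod int p ^ k = x k mod int p ^ k" "x k mod int p ^ k = x k"
    if "x \<in> carrier (padic_int p)" for x k
    using that by (auto simp: padic_int_def)
  show ?thesis
  proof (rule cringI)
    show "abelian_group (padic_int p)"
    proof (rule abelian_groupI)
      fix x y z
      assume x: "x \<in> carrier (padic_int p)" and y: "y \<in> carrier (padic_int p)"
      show "x \<oplus>\<^bsub>padic_int p\<^esub> y \<in> carrier (padic_int p)"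
        using closed[of "\<lambda>k. x k + y k"] mods[OF x] mods[OF y]
        by (simp add: padic_int_def) (metis mod_add_eq)
      show "x \<oplus>\<^bsub>padic_int p\<^esub> y = y \<oplus>\<^bsub>padic_int p\<^esub> x"
        by (simp add: padic_int_def add.commute)
      show "\<zero>\<^bsub>padic_int p\<^esub> \<oplus>\<^bsub>padic_int p\<^esub> x = x"
        using mods(2)[OF x] by (simp add: padic_int_def)
      have "(\<lambda>k. (- x k) mod int p ^ k) \<in> carrier (padic_int p)"
        using mods[OF x] by (intro closed) (metis mod_minus_eq)
      moreover have "(\<lambda>k. (- x k) mod int p ^ k) \<oplus>\<^bsub>padic_int p\<^esub> x = \<zero>\<^bsub>padic_int p\<^esub>"
        by (simp add: padic_int_def mod_add_left_eq)
      ultimately show "\<exists>y\<in>carrier (padic_int p). y \<oplus>\<^bsub>padic_int p\<^esub> x = \<zero>\<^bsub>padic_int p\<^esub>"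
        by blast
      assume z: "z \<in> carrier (padic_int p)"
      show "x \<oplus>\<^bsub>padic_int p\<^esub> y \<oplus>\<^bsub>padic_int p\<^esub> z = x \<oplus>\<^bsub>padic_int p\<^esub> (y \<oplus>\<^bsub>padic_int p\<^esub> z)"
        by (simp add: padic_int_def mod_add_left_eq mod_add_right_eq add.assoc)
    next
      show "\<zero>\<^bsub>padic_int p\<^esub> \<in> carrier (padic_int p)"
        using P by (simp add: padic_int_def)
    qed
    show "comm_monoid (padic_int p)"
    proof (rule comm_monoidI)
      fix x y z
      assume x: "x \<in> carrier (padic_int p)" and y: "y \<in> carrier (padic_int p)"
      show "x \<otimes>\<^bsub>padic_int p\<^esub> y \<in> carrier (padic_int p)"
        using closed[of "\<lambda>k. x k * y k"] mods[OF x] mods[OF y]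
        by (simp add: padic_int_def) (metis mod_mult_eq)
      show "x \<otimes>\<^bsub>padic_int p\<^esub> y = y \<otimes>\<^bsub>padic_int p\<^esub> x"
        by (simp add: padic_int_def mult.commute)
      show "\<one>\<^bsub>padic_int p\<^esub> \<otimes>\<^bsub>padic_int p\<^esub> x = x"
        using mods(2)[OF x] by (simp add: padic_int_def mod_mult_left_eq)
      assume z: "z \<in> carrier (padic_int p)"
      show "x \<otimes>\<^bsub>padic_int p\<^esub> y \<otimes>\<^bsub>padic_int p\<^esub> z = x \<otimes>\<^bsub>padic_int p\<^esub> (y \<otimes>\<^bsub>padic_int p\<^esub> z)"
        by (simp add: padic_int_def mod_mult_left_eq mod_mult_right_eq mult.assoc)
    next
      show "\<one>\<^bsub>padic_int p\<^esub> \<in> carrier (padic_int p)"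
        using closed[of "\<lambda>k. 1"] by (simp add: padic_int_def)
    qed
    fix x y z
    show "(x \<oplus>\<^bsub>padic_int p\<^esub> y) \<otimes>\<^bsub>padic_int p\<^esub> z
        = x \<otimes>\<^bsub>padic_int p\<^esub> z \<oplus>\<^bsub>padic_int p\<^esub> y \<otimes>\<^bsub>padic_int p\<^esub> z"
      by (simp add: padic_int_def mod_add_eq mod_mult_left_eq distrib_right)
  qed
qed

text \<open>The type 'r is R = Z_p[xi]: an integral domain generated by a copy of Z_p, embedded by
  emb, and a primitive (p^t - 1)-th root of unity xi. The map res is the reduction modulo pR,
  identifying the residue field R/pR with the field 'k of order q = p^t.\<close>

definition unramified_ring ::
    "nat \<Rightarrow> nat \<Rightarrow> ((nat \<Rightarrow> int) \<Rightarrow> 'r::idom) \<Rightarrow> 'r \<Rightarrow> ('r \<Rightarrow> 'k::finite_field) \<Rightarrow> bool" where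
  "unramified_ring p t emb \<xi> res \<longleftrightarrow>
     prime p \<and> 0 < t \<and> CARD('k) = p ^ t \<and>
     emb \<in> ring_hom (padic_int p) ring_of_type_algebra \<and> inj_on emb (carrier (padic_int p)) \<and>
     \<xi> ^ (p ^ t - 1) = 1 \<and> (\<forall>m. 0 < m \<and> m < p ^ t - 1 \<longrightarrow> \<xi> ^ m \<noteq> 1) \<and>
     (\<forall>x. \<exists>c d. (\<forall>i<d. c i \<in> carrier (padic_int p)) \<and> x = (\<Sum>i<d. emb (c i) * \<xi> ^ i)) \<and>
     res \<in> ring_hom ring_of_type_algebra ring_of_type_algebra \<and> surj res \<and>
     (\<forall>x. res x = 0 \<longleftrightarrow> of_nat p dvd x)"

text \<open>The Teichmueller character, extended by T(0) = 0; the library convention 0 ^ 0 = 1 gives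
  T(0)^0 = 1.\<close>

definition teichmueller :: "('r::idom \<Rightarrow> 'k::finite_field) \<Rightarrow> 'k \<Rightarrow> 'r" where
  "teichmueller res a =
     (if a = 0 then 0 else THE x. x ^ (CARD('k) - 1) = 1 \<and> res x = a)"

definition fscale :: "'r::comm_ring_1 \<Rightarrow> ('a \<Rightarrow> 'r) \<Rightarrow> 'a \<Rightarrow> 'r" where
  "fscale c f = (\<lambda>x. c * f x)"

interpretation fun_module: Modules.module "fscale :: 'r::comm_ring_1 \<Rightarrow> ('a \<Rightarrow> 'r) \<Rightarrow> 'a \<Rightarrow> 'r"
  by standard (auto simp: fscale_def fun_eq_iff algebra_simps)

text \<open>The free module of functions on a set A; functions are extended by 0 outside A.\<close>

definition funs_on :: "'a set \<Rightarrow> ('a \<Rightarrow> 'r::zero) set" where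
  "funs_on A = {f. \<forall>x. x \<notin> A \<longrightarrow> f x = 0}"

definition snf_filtration ::
    "nat \<Rightarrow> 'a set \<Rightarrow> 'b set \<Rightarrow> (('a \<Rightarrow> 'r::comm_ring_1) \<Rightarrow> 'b \<Rightarrow> 'r) \<Rightarrow> nat \<Rightarrow> ('a \<Rightarrow> 'r) set" where
  "snf_filtration p A C \<eta> i =
     {x \<in> funs_on A. \<eta> x \<in> fscale (of_nat p ^ i) ` funs_on C}"

text \<open>For res : R -> R/pR, composition with res identifies M/pM, for M the module of functions
  A -> R, with the space of functions A -> R/pR.\<close>

definition snf_filtration_bar ::
    "('r::comm_ring_1 \<Rightarrow> 'k::field) \<Rightarrow> nat \<Rightarrow> 'a set \<Rightarrow> 'b set \<Rightarrow> (('a \<Rightarrow> 'r) \<Rightarrow> 'b \<Rightarrow> 'r)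
      \<Rightarrow> nat \<Rightarrow> ('a \<Rightarrow> 'k) set" where
  "snf_filtration_bar res p A C \<eta> i = (\<lambda>f. res \<circ> f) ` snf_filtration p A C \<eta> i"

definition snf_length ::
    "('r::comm_ring_1 \<Rightarrow> 'k::field) \<Rightarrow> nat \<Rightarrow> 'a set \<Rightarrow> 'b set \<Rightarrow> (('a \<Rightarrow> 'r) \<Rightarrow> 'b \<Rightarrow> 'r) \<Rightarrow> nat" where
  "snf_length res p A C \<eta> = (LEAST l. snf_filtration_bar res p A C \<eta> l = {0})"

text \<open>g maps the finite set S bijectively onto a basis of the quotient space U/W. Linear
  independence of the family of cosets g e + W indexed by S includes injectivity.\<close>

definition maps_onto_quotient_basis ::
    "('e \<Rightarrow> 'a \<Rightarrow> 'k::field) \<Rightarrow> 'e set \<Rightarrow> ('a \<Rightarrow> 'k) set \<Rightarrow> ('a \<Rightarrow> 'k) set \<Rightarrow> bool" where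
  "maps_onto_quotient_basis g S U W \<longleftrightarrow>
     finite S \<and> g ` S \<subseteq> U \<and>
     (\<forall>c. (\<Sum>e\<in>S. fscale (c e) (g e)) \<in> W \<longrightarrow> (\<forall>e\<in>S. c e = 0)) \<and>
     (\<forall>u\<in>U. \<exists>c. u - (\<Sum>e\<in>S. fscale (c e) (g e)) \<in> W)"

definition snf_basis ::
    "('r::comm_ring_1 \<Rightarrow> 'k::field) \<Rightarrow> nat \<Rightarrow> 'a set \<Rightarrow> 'b set \<Rightarrow> (('a \<Rightarrow> 'r) \<Rightarrow> 'b \<Rightarrow> 'r)
      \<Rightarrow> (nat \<Rightarrow> ('a \<Rightarrow> 'r) set) \<Rightarrow> ('a \<Rightarrow> 'r) set \<Rightarrow> bool" where
  "snf_basis res p A C \<eta> Bs B \<longleftrightarrow>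
     fun_module.independent B \<and> fun_module.span B = funs_on A \<and>
     B = (\<Union>i<snf_length res p A C \<eta>. Bs i) \<and>
     (\<forall>i<snf_length res p A C \<eta>.
        Bs i \<subseteq> snf_filtration p A C \<eta> i \<and>
        maps_onto_quotient_basis (\<lambda>f. res \<circ> f) (Bs i)
          (snf_filtration_bar res p A C \<eta> i) (snf_filtration_bar res p A C \<eta> (Suc i)))"

definition snf_invariant ::
    "('r::comm_ring_1 \<Rightarrow> 'k::field) \<Rightarrow> nat \<Rightarrow> 'a set \<Rightarrow> 'b set \<Rightarrow> (('a \<Rightarrow> 'r) \<Rightarrow> 'b \<Rightarrow> 'r)
      \<Rightarrow> (nat \<Rightarrow> ('a \<Rightarrow> 'r) set) \<Rightarrow> ('a \<Rightarrow> 'r) \<Rightarrow> 'r \<Rightarrow> bool" where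
  "snf_invariant res p A C \<eta> Bs e a \<longleftrightarrow>
     (\<exists>i<snf_length res p A C \<eta>. e \<in> Bs i \<and> a = of_nat p ^ i)"

definition subspaces_dim :: "nat \<Rightarrow> ('k::field ^ 'n::finite) set set" where
  "subspaces_dim k = {S. vec.subspace S \<and> vec.dim S = k}"

definition incidence ::
    "nat \<Rightarrow> (('k::field ^ 'n::finite) set \<Rightarrow> 'r::comm_ring_1) \<Rightarrow> ('k ^ 'n) set \<Rightarrow> 'r" where
  "incidence r f = (\<lambda>Y. if Y \<in> subspaces_dim r
     then (\<Sum>Z\<in>{Z \<in> subspaces_dim 1. Z \<subseteq> Y}. f Z) else 0)"

definition exponents :: "nat \<Rightarrow> ('n::finite \<Rightarrow> nat) set" where
  "exponents q = {b. (\<forall>i. b i \<le> q - 1) \<and> (q - 1) dvd (\<Sum>i\<in>UNIV. b i) \<and> b \<noteq> (\<lambda>i. q - 1)}"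

text \<open>The function sending the point spanned by a to the product of the psi(a_i)^(b_i). For
  multiplicative psi and b in exponents q it does not depend on the chosen spanning vector. With
  psi the identity this is the monomial with exponent vector b, with psi the Teichmueller
  character its lift.\<close>

definition point_monomial ::
    "('k \<Rightarrow> 'c::comm_ring_1) \<Rightarrow> ('n::finite \<Rightarrow> nat) \<Rightarrow> ('k::field ^ 'n) set \<Rightarrow> 'c" where
  "point_monomial \<psi> b = (\<lambda>Z. if Z \<in> subspaces_dim 1
     then (let a = (SOME a. a \<in> Z \<and> a \<noteq> 0) in \<Prod>i\<in>UNIV. \<psi> (a $ i) ^ b i) else 0)"

lemma point_monomial_span:
  fixes a :: "'k::finite_field ^ 'n::finite" and \<psi> :: "'k \<Rightarrow> 'c::comm_ring_1"
  assumes a: "a \<noteq> 0" and b: "b \<in> exponents CARD('k)"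
    and one: "\<psi> 1 = 1" and mult: "\<And>x y. \<psi> (x * y) = \<psi> x * \<psi> y"
  shows "point_monomial \<psi> b (vec.span {a}) = (\<Prod>i\<in>UNIV. \<psi> (a $ i) ^ b i)"
proof -
  have point: "vec.span {a} \<in> subspaces_dim 1"
    using a by (auto simp: subspaces_dim_def vec.dim_span vec.dim_singleton)
  define a' where "a' = (SOME x. x \<in> vec.span {a} \<and> x \<noteq> 0)"
  have "a' \<in> vec.span {a} \<and> a' \<noteq> 0"
    unfolding a'_def by (rule someI[of _ a]) (use a in \<open>auto intro: vec.span_base\<close>)
  then obtain c where c: "a' = c *s a" "c \<noteq> 0"
    by (auto simp: vec.span_singleton)
  obtain m where m: "(\<Sum>i\<in>UNIV. b i) = (CARD('k) - 1) * m"
    using b by (auto simp: exponents_def)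
  have pow: "\<psi> c ^ k = \<psi> (c ^ k)" for k
    by (induction k) (simp_all add: one mult)
  have "c * c ^ (CARD('k) - 1) = c ^ CARD('k)"
    by (metis power_minus_mult finite_UNIV_card_ge_0 finite mult.commute)
  then have "c ^ (CARD('k) - 1) = 1"
    using c(2) by (metis finite_field_power_card_eq_same mult_cancel_left2)
  then have "\<psi> c ^ (\<Sum>i\<in>UNIV. b i) = 1"
    by (simp only: m power_mult pow one power_one)
  have "point_monomial \<psi> b (vec.span {a}) = (\<Prod>i\<in>UNIV. \<psi> (a' $ i) ^ b i)"
    using point by (simp add: point_monomial_def a'_def)
  also have "\<dots> = \<psi> c ^ (\<Sum>i\<in>UNIV. b i) * (\<Prod>i\<in>UNIV. \<psi> (a $ i) ^ b i)"
    by (simp add: c mult power_mult_distrib prod.distrib power_sum)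
  also have "\<psi> c ^ (\<Sum>i\<in>UNIV. b i) = 1"
    by fact
  finally show ?thesis
    by simp
qed

definition monomials :: "(('k::finite_field ^ 'n::finite) set \<Rightarrow> 'k) set" where
  "monomials = point_monomial (\<lambda>x. x) ` exponents CARD('k)"

definition p_digit :: "nat \<Rightarrow> nat \<Rightarrow> nat \<Rightarrow> nat" where
  "p_digit p m j = m div p ^ j mod p"

text \<open>Meaningful for j < t only, and a rational number a priori, as s_j is defined by a quotient.\<close>

definition monomial_type :: "nat \<Rightarrow> nat \<Rightarrow> ('n::finite \<Rightarrow> nat) \<Rightarrow> nat \<Rightarrow> rat" where
  "monomial_type p t b j =
     of_nat (\<Sum>i\<in>UNIV. (\<Sum>l<j. p ^ (l + t - j) * p_digit p (b i) l)
                     + (\<Sum>l=j..<t. p ^ (l - j) * p_digit p (b i) l))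
     / of_nat (p ^ t - 1)"

text \<open>The reduction of f is a nonconstant monomial, whose type is (s 0, ..., s (t - 1)).\<close>

definition has_type ::
    "('r::comm_ring_1 \<Rightarrow> 'k::finite_field) \<Rightarrow> nat \<Rightarrow> nat
      \<Rightarrow> (('k ^ 'n::finite) set \<Rightarrow> 'r) \<Rightarrow> (nat \<Rightarrow> rat) \<Rightarrow> bool" where
  "has_type res p t f s \<longleftrightarrow>
     (\<exists>b\<in>exponents CARD('k). b \<noteq> (\<lambda>i. 0) \<and> res \<circ> f = point_monomial (\<lambda>x. x) b \<and>
        (\<forall>j<t. s j = monomial_type p t b j))"

end

theory Submission
  imports Defs "HOL-Number_Theory.Cong"
begin

text \<open>
  Write \<open>M\<^sub>i\<close> for the filtration, \<open>\<lambda>(s) = \<Sum>\<^sub>j max(0, r - s\<^sub>j)\<close>, and \<open>H\<^sub>i\<close> for the set of exponent vectors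
  whose monomial lies in the reduction of \<open>M\<^sub>i\<close>. The invariant of a monomial is \<open>p\<^sup>i\<close> for the
  largest \<open>i\<close> such that \<open>H\<^sub>i\<close> contains its exponent vector.

  \<open>\<beta> \<ge> \<lambda>\<close>: On an r-dimensional subspace the sum of the lifted monomial is a sum over \<open>y\<close> of products
  of powers of \<open>T(\<ell>(y))\<close> for linear forms \<open>\<ell>\<close>. Since \<open>T(\<ell>)\<close> is the p-th power of \<open>T(\<ell>\<^sup>1\<^sup>/\<^sup>p)\<close>, iterating
  p-th powers expands it, modulo any power of \<open>p\<close>, in monomials in the \<open>T(y\<^sub>k)\<close>, and every rise
  of a weight \<open>s\<^sub>j\<close> by one costs a factor \<open>p\<close>. The sum over \<open>y\<close> annihilates every monomial except those
  whose exponents are all divisible by \<open>q - 1\<close>, and these have large weight.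

  \<open>\<beta> \<le> \<lambda>\<close>: Since \<open>M\<^sub>i\<close> is invariant under transvections and its reduction is spanned by
  monomials, \<open>H\<^sub>i\<close> is closed under moving base-p digits between variables; so it only depends on the
  type. Applying a transvection to the lift of a monomial in \<open>M\<^sub>i\<^sub>+\<^sub>1\<close> and extracting a coefficient which is a Jacobi sum
  of valuation exactly one gives an element of \<open>M\<^sub>i\<close> whose type is larger by one at a minimal \<open>s\<^sub>j\<close>.
  After \<open>\<lambda>\<close> such steps all \<open>s\<^sub>j\<close> are at least \<open>r\<close>. Carries in the digit moves then lower the type to
  \<open>(r, ..., r)\<close>, where the monomial is a product of \<open>r\<close> factors \<open>x\<^sub>i\<^sup>q\<^sup>-\<^sup>1\<close> and is visibly not in the
  reduction of \<open>M\<^sub>1\<close>.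
\<close>

section \<open>The Teichmueller character\<close>

locale unram =
  fixes p t q :: nat and emb :: "(nat \<Rightarrow> int) \<Rightarrow> 'r::idom" and \<xi> :: 'r
    and res :: "'r \<Rightarrow> 'k::finite_field"
  assumes unramified: "unramified_ring p t emb \<xi> res" and q_card: "q = CARD('k)"
begin

abbreviation T :: "'k \<Rightarrow> 'r" where "T \<equiv> teichmueller res"

lemma prime_p: "prime p" and t_pos: "0 < t" and q_eq: "q = p ^ t"
  and res_eq_0_iff: "res x = 0 \<longleftrightarrow> of_nat p dvd x"
  and xi_power: "\<xi> ^ (q - 1) = 1"
  and xi_prim: "0 < m \<Longrightarrow> m < q - 1 \<Longrightarrow> \<xi> ^ m \<noteq> 1"
  using unramified by (auto simp: unramified_ring_def q_card)

lemma p_ge_2: "2 \<le> p" using prime_p prime_ge_2_nat by blast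

lemma q_ge_2: "2 \<le> q"
proof -
  have "p ^ 1 \<le> p ^ t" using t_pos p_ge_2 by (intro power_increasing) auto
  thus ?thesis using p_ge_2 q_eq by simp
qed

lemma res_hom: "res \<in> ring_hom ring_of_type_algebra ring_of_type_algebra"
  using unramified by (auto simp: unramified_ring_def)

lemma res_add [simp]: "res (x + y) = res x + res y"
  using ring_hom_add[OF res_hom] by (simp add: ring_of_type_algebra_def)
lemma res_mult [simp]: "res (x * y) = res x * res y"
  using ring_hom_mult[OF res_hom] by (simp add: ring_of_type_algebra_def)
lemma res_1 [simp]: "res 1 = 1"
  using ring_hom_one[OF res_hom] by (simp add: ring_of_type_algebra_def)
lemma res_0 [simp]: "res 0 = 0"
  by (simp add: res_eq_0_iff)
lemma res_minus [simp]: "res (- x) = - res x"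
  by (metis add.right_inverse minus_unique res_0 res_add)
lemma res_diff [simp]: "res (x - y) = res x - res y"
  by (metis diff_conv_add_uminus res_add res_minus)
lemma res_power [simp]: "res (x ^ n) = res x ^ n"
  by (induction n) auto
lemma res_sum: "res (sum f A) = (\<Sum>x\<in>A. res (f x))"
  by (induction A rule: infinite_finite_induct) auto
lemma res_prod: "res (prod f A) = (\<Prod>x\<in>A. res (f x))"
  by (induction A rule: infinite_finite_induct) auto
lemma res_of_nat [simp]: "res (of_nat n) = of_nat n"
  by (induction n) auto

lemma of_nat_p_eq_0: "of_nat p = (0::'k)"
  using res_eq_0_iff[of "of_nat p"] by simp

lemma CHAR_k: "CHAR('k) = p"
  using of_nat_p_eq_0 of_nat_eq_0_iff_char_dvd[of p, where ?'a='k] prime_p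
  by (metis CHAR_not_1' One_nat_def prime_nat_iff)

lemma of_nat_k_eq_0_iff: "of_nat n = (0::'k) \<longleftrightarrow> p dvd n"
  by (simp add: CHAR_k of_nat_eq_0_iff_char_dvd)

text \<open>If p vanished in R, the injective map \<open>emb\<close> would identify the p-adic
  integers p and 0, which already differ modulo p^2.\<close>

lemma p_nz: "of_nat p \<noteq> (0::'r)"
proof
  assume 0: "of_nat p = (0::'r)"
  have hom: "emb \<in> ring_hom (padic_int p) ring_of_type_algebra"
    and inj: "inj_on emb (carrier (padic_int p))"
    using unramified by (auto simp: unramified_ring_def)
  have P: "0 < int p ^ k" for k using p_ge_2 by simp
  define c where "c m = (\<lambda>k. int m mod int p ^ k)" for m :: nat
  have c: "c m \<in> carrier (padic_int p)" for m
    using P by (simp add: c_def padic_int_def mod_mod_cancel)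
  have emb: "emb (c (Suc m)) = of_nat (Suc m)" for m
  proof (induction m)
    case 0
    show ?case using ring_hom_one[OF hom] by (simp add: padic_int_def ring_of_type_algebra_def c_def)
  next
    case (Suc m)
    have "c (Suc (Suc m)) = c (Suc m) \<oplus>\<^bsub>padic_int p\<^esub> c 1"
      by (simp add: c_def padic_int_def mod_add_eq algebra_simps)
    hence "emb (c (Suc (Suc m))) = emb (c (Suc m)) + emb (c 1)"
      using ring_hom_add[OF hom c c] by (simp add: ring_of_type_algebra_def)
    also have "emb (c 1) = 1"
      using ring_hom_one[OF hom] by (simp add: padic_int_def ring_of_type_algebra_def c_def)
    finally show ?case using Suc by simp
  qed
  have "emb (c p) = 0" using emb[of "p - 1"] p_ge_2 0 by simp
  moreover have "emb (c 0) = 0"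
  proof -
    have "c 0 = c 0 \<oplus>\<^bsub>padic_int p\<^esub> c 0" by (simp add: c_def padic_int_def)
    hence "emb (c 0) = emb (c 0) + emb (c 0)"
      using ring_hom_add[OF hom c[of 0] c[of 0]] by (simp add: ring_of_type_algebra_def)
    thus ?thesis by (metis add_cancel_right_right)
  qed
  ultimately have "c p = c 0" using inj c by (metis inj_onD)
  hence "c p 2 = c 0 2" by simp
  moreover have "c p 2 = int p"
    unfolding c_def using p_ge_2 by (intro mod_pos_pos_trivial) (auto simp: power2_eq_square)
  ultimately show False using p_ge_2 by (simp add: c_def)
qed

text \<open>A substitute for invertibility of \<open>u\<close>: residues lie in a field, so p
  divides \<open>u * x\<close> only through \<open>x\<close>, and the factors p are stripped off one
  at a time.\<close>

lemma power_p_dvd_cancel: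
  assumes "res u \<noteq> 0" "of_nat p ^ i dvd u * x"
  shows "of_nat p ^ i dvd x"
  using assms(2)
proof (induction i arbitrary: x)
  case (Suc i)
  have "of_nat p dvd u * x" using Suc.prems by (metis dvd_mult_left power_Suc)
  hence "res (u * x) = 0" by (simp only: res_eq_0_iff)
  hence "of_nat p dvd x" using assms(1) res_eq_0_iff by auto
  then obtain z where z: "x = of_nat p * z" by blast
  have "of_nat p * of_nat p ^ i dvd of_nat p * (u * z)"
    using Suc.prems z by (simp add: ac_simps)
  hence "of_nat p ^ i dvd u * z" unfolding dvd_mult_cancel_left using p_nz by blast
  hence "of_nat p ^ i dvd z" by (rule Suc.IH)
  thus ?case using z by (simp add: mult_dvd_mono)
qed auto

lemma of_nat_q1_k: "of_nat (q - 1) = (-1 :: 'k)"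
proof -
  have "of_nat q = (0::'k)" using t_pos by (simp only: of_nat_k_eq_0_iff q_eq) simp
  thus ?thesis using q_ge_2 by (simp add: of_nat_diff)
qed

lemma root_res_nz: "x ^ (q - 1) = 1 \<Longrightarrow> res x \<noteq> 0"
proof
  assume x: "x ^ (q - 1) = 1" and "res x = 0"
  hence "res (x ^ (q - 1)) = 0" unfolding res_power using q_ge_2 by (simp add: power_0_left)
  thus False unfolding x by simp
qed

text \<open>The cofactor of x - y in x^(q-1) - y^(q-1) reduces to (q - 1) times a power of
  \<open>res y\<close>. As q - 1 is -1 in the residue field, it is nonzero, and R is a
  domain.\<close>

lemma roots_inj:
  assumes "x ^ (q - 1) = 1" "y ^ (q - 1) = 1" "res x = res y"
  shows "x = y"
proof -
  have ry: "res y \<noteq> 0" using root_res_nz assms(2) .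
  have "0 = x ^ (q - 1) - y ^ (q - 1)" using assms by simp
  also have "\<dots> = (x - y) * (\<Sum>i<q-1. y ^ (q - 1 - Suc i) * x ^ i)"
    by (rule power_diff_sumr2)
  finally have "x - y = 0 \<or> (\<Sum>i<q-1. y ^ (q - 1 - Suc i) * x ^ i) = 0" by simp
  moreover have "(\<Sum>i<q-1. y ^ (q - 1 - Suc i) * x ^ i) \<noteq> 0"
  proof
    assume 0: "(\<Sum>i<q-1. y ^ (q - 1 - Suc i) * x ^ i) = 0"
    have "res (\<Sum>i<q-1. y ^ (q - 1 - Suc i) * x ^ i) = (\<Sum>i<q-1. res y ^ (q - 2))"
      unfolding res_sum using assms(3) by (intro sum.cong refl) (auto simp flip: power_add)
    also have "\<dots> = - (res y ^ (q - 2))" using of_nat_q1_k by simp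
    finally show False using 0 ry by simp
  qed
  ultimately show ?thesis by simp
qed

text \<open>Counting replaces Hensel's lemma: the q - 1 distinct powers of \<xi> have distinct
  residues by \<open>roots_inj\<close>, so they exhaust the nonzero elements of the residue
  field.\<close>

lemma teich_ex1:
  assumes "a \<noteq> (0::'k)"
  shows "\<exists>!x. x ^ (q - 1) = 1 \<and> res x = a"
proof -
  have xi_inj: "inj_on (\<lambda>m. \<xi> ^ m) {..<q-1}"
  proof (rule inj_onI)
    fix m n assume mn: "m \<in> {..<q-1}" "n \<in> {..<q-1}" "\<xi> ^ m = \<xi> ^ n"
    show "m = n"
      using mn
    proof (induction m n rule: linorder_wlog)
      case (le a b)
      have "\<xi> ^ a \<noteq> 0" using root_res_nz[OF xi_power] by auto
      moreover have "\<xi> ^ b = \<xi> ^ a * \<xi> ^ (b - a)" using le(1) by (simp flip: power_add)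
      ultimately have "\<xi> ^ (b - a) = 1" using le(4) by (metis mult_cancel_left2)
      hence "\<not> 0 < b - a" using xi_prim[of "b - a"] le(3) by fastforce
      thus ?case using le(1) by simp
    qed auto
  qed
  have roots: "(\<xi> ^ m) ^ (q - 1) = 1" for m
    unfolding power_mult[symmetric] mult.commute[of m] unfolding power_mult xi_power by simp
  have nz: "res (\<xi> ^ m) \<noteq> 0" for m
    using roots root_res_nz by blast
  have "inj_on (\<lambda>m. res (\<xi> ^ m)) {..<q-1}"
  proof (rule inj_onI)
    fix m n assume mn: "m \<in> {..<q-1}" "n \<in> {..<q-1}" "res (\<xi> ^ m) = res (\<xi> ^ n)"
    have "\<xi> ^ m = \<xi> ^ n" using roots_inj[OF roots roots mn(3)] .
    thus "m = n" using inj_onD[OF xi_inj] mn by blast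
  qed
  hence "card ((\<lambda>m. res (\<xi> ^ m)) ` {..<q-1}) = card (UNIV - {0::'k})"
    by (simp add: card_image card_Diff_singleton q_card)
  moreover have "(\<lambda>m. res (\<xi> ^ m)) ` {..<q-1} \<subseteq> UNIV - {0}" using nz by (auto simp del: res_power)
  ultimately have "(\<lambda>m. res (\<xi> ^ m)) ` {..<q-1} = UNIV - {0}"
    by (intro card_subset_eq) auto
  moreover have "a \<in> UNIV - {0}" using assms by simp
  ultimately obtain m where m: "res (\<xi> ^ m) = a" by (metis (no_types, lifting) imageE)
  show ?thesis
  proof
    show "(\<xi> ^ m) ^ (q - 1) = 1 \<and> res (\<xi> ^ m) = a" using m roots by blast
  next
    fix x assume "x ^ (q - 1) = 1 \<and> res x = a"
    hence "x ^ (q - 1) = 1" "res x = res (\<xi> ^ m)" using m by simp_all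
    thus "x = \<xi> ^ m" by (rule roots_inj[OF _ roots])
  qed
qed

lemma teich_0 [simp]: "T 0 = 0" by (simp add: teichmueller_def)

lemma teich_spec: "a \<noteq> 0 \<Longrightarrow> T a ^ (q - 1) = 1 \<and> res (T a) = a"
  using theI'[OF teich_ex1] by (simp add: teichmueller_def flip: q_card)

lemma res_teich [simp]: "res (T a) = a"
  by (cases "a = 0") (use teich_spec in auto)

lemma teich_eqI: "x ^ (q - 1) = 1 \<Longrightarrow> T (res x) = x"
proof -
  assume x: "x ^ (q - 1) = 1"
  have "res x \<noteq> 0" using root_res_nz x .
  thus ?thesis using roots_inj[OF _ x] teich_spec by auto
qed

lemma teich_1 [simp]: "T 1 = 1" using teich_eqI[of 1] by simp

lemma teich_eq_0_iff [simp]: "T a = 0 \<longleftrightarrow> a = 0"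
  by (metis res_0 res_teich teich_0)

lemma teich_mult: "T (a * b) = T a * T b"
proof (cases "a = 0 \<or> b = 0")
  case False
  have "(T a * T b) ^ (q - 1) = 1" using False teich_spec by (simp add: power_mult_distrib)
  from teich_eqI[OF this] show ?thesis by simp
qed auto

lemma teich_power: "T (a ^ n) = T a ^ n"
  by (induction n) (auto simp: teich_mult)

lemma power_q1_mult: "a \<noteq> 0 \<Longrightarrow> T a ^ ((q - 1) * n) = 1"
  using teich_spec by (simp add: power_mult)

text \<open>The condition on positivity is for a = 0, where the congruent exponents 0 and q - 1 give
  the values 1 and 0.\<close>

lemma teich_cong:
  assumes "[m = n] (mod (q - 1))" "m > 0 \<longleftrightarrow> n > 0"
  shows "T a ^ m = T a ^ n"
proof (cases "a = 0")
  case True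
  thus ?thesis using assms(2) by (cases "m = 0") (auto simp: power_0_left)
next
  case False
  have "T a ^ k = T a ^ (k mod (q - 1))" for k
  proof -
    have "T a ^ k = T a ^ ((q - 1) * (k div (q - 1)) + k mod (q - 1))" by simp
    also have "\<dots> = T a ^ (k mod (q - 1))" unfolding power_add power_q1_mult[OF False] by simp
    finally show ?thesis .
  qed
  from this[of m] this[of n] show ?thesis using assms(1) by (simp add: cong_def)
qed

lemma field_cong:
  assumes "[m = n] (mod (q - 1))" "m > 0 \<longleftrightarrow> n > 0"
  shows "a ^ m = (a::'k) ^ n"
  using arg_cong[OF teich_cong[OF assms, of a], of res] by simp

lemma teich_power_eq_1_iff:
  "\<exists>g. g \<noteq> 0 \<and> (\<forall>N. T g ^ N = 1 \<longleftrightarrow> (q - 1) dvd N)"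
proof (intro exI conjI allI)
  have T: "T (res \<xi>) = \<xi>" using teich_eqI[OF xi_power] .
  have "\<xi> \<noteq> 0" using xi_power q_ge_2 by (auto simp: power_0_left split: if_splits)
  thus nz: "res \<xi> \<noteq> 0" using T teich_0 by metis
  fix N
  show "T (res \<xi>) ^ N = 1 \<longleftrightarrow> (q - 1) dvd N"
  proof
    assume "T (res \<xi>) ^ N = 1"
    hence "\<xi> ^ ((q - 1) * (N div (q - 1)) + N mod (q - 1)) = 1" unfolding T by simp
    hence "\<xi> ^ (N mod (q - 1)) = 1" unfolding power_add power_mult xi_power by simp
    moreover have "N mod (q - 1) < q - 1" using q_ge_2 by simp
    ultimately have "N mod (q - 1) = 0" using xi_prim by blast
    thus "(q - 1) dvd N" by (simp add: dvd_eq_mod_eq_0)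
  next
    assume "(q - 1) dvd N"
    then obtain n where "N = (q - 1) * n" ..
    thus "T (res \<xi>) ^ N = 1" using power_q1_mult[OF nz] by simp
  qed
qed

text \<open>Orthogonality: if q - 1 does not divide N, multiplying u by a generator rescales the sum
  by a factor other than 1. For N = 0 the term u = 0 also counts, since 0^0 = 1; the resulting value
  q = p^t is what \<open>sum_gen_dvd\<close> exploits.\<close>

lemma sum_teich_power:
  "(\<Sum>u\<in>UNIV. T u ^ N) = (if N = 0 then of_nat q else if (q - 1) dvd N then of_nat (q - 1) else 0)"
proof (cases "N = 0")
  case False
  show ?thesis
  proof (cases "(q - 1) dvd N")
    case True
    have "(\<Sum>u\<in>UNIV. T u ^ N) = (\<Sum>u\<in>UNIV. if u = (0::'k) then 0 else 1)"
    proof (intro sum.cong refl)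
      fix u :: 'k
      obtain n where n: "N = (q - 1) * n" using True ..
      show "T u ^ N = (if u = 0 then 0 else 1)"
        using power_q1_mult[of u n] False n by (cases "u = 0") (simp_all add: power_0_left)
    qed
    also have "\<dots> = (\<Sum>u\<in>UNIV - {0::'k}. 1)" by (intro sum.mono_neutral_cong_right) auto
    also have "\<dots> = of_nat (q - 1)" by (simp add: card_Diff_singleton q_card)
    finally show ?thesis using True False by simp
  next
    case ndvd: False
    obtain g where g: "g \<noteq> 0" "T g ^ N \<noteq> 1" using teich_power_eq_1_iff ndvd by blast
    have "(\<Sum>u\<in>UNIV. T u ^ N) = (\<Sum>u\<in>UNIV. T (g * u) ^ N)"
      using g by (intro sum.reindex_bij_witness[of _ "\<lambda>u. g * u" "\<lambda>u. u / g"]) auto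
    also have "\<dots> = T g ^ N * (\<Sum>u\<in>UNIV. T u ^ N)"
      by (simp add: teich_mult power_mult_distrib sum_distrib_left)
    finally have "(\<Sum>u\<in>UNIV. T u ^ N) = 0" using g(2) by simp
    thus ?thesis using False ndvd by simp
  qed
qed (simp add: q_card)

lemma sum_field_power:
  "(\<Sum>u\<in>UNIV. u ^ N) = (if N = 0 then 0 else if (q - 1) dvd N then - 1 else (0::'k))"
proof -
  have "(\<Sum>u\<in>UNIV. u ^ N) = res (\<Sum>u\<in>UNIV. T u ^ N)" by (simp add: res_sum)
  moreover have "of_nat q = (0::'k)" using t_pos by (simp only: of_nat_k_eq_0_iff q_eq) simp
  moreover have "res (of_nat (q - 1)) = -1" by (simp only: res_of_nat of_nat_q1_k)
  moreover have "res (of_nat q) = 0" using calculation by simp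
  ultimately show ?thesis by (simp only: sum_teich_power res_0 split: if_split) simp
qed

lemma res_eq_iff: "res x = res y \<longleftrightarrow> of_nat p dvd x - y"
  by (simp flip: res_eq_0_iff)

end

section \<open>Divisibility of sums of lifted monomials\<close>

text \<open>The cofactor of a - b in a^p - b^p has p terms, each congruent to b^(p-1) modulo p, so
  it contributes one more factor p.\<close>

lemma prime_power_diff_lift:
  fixes a b :: "'a::comm_ring_1"
  assumes "prime p" "m > 0" "of_nat p ^ m dvd a - b"
  shows "of_nat p ^ Suc m dvd a ^ p - b ^ p"
proof -
  obtain c where c: "a = b + of_nat p ^ m * c" using assms(3) by (metis add.commute diff_add_cancel dvdE)
  \<comment> \<open>The \<open>SOME\<close> term is the quotient of a^i - b^i by p^m; one factor p
    of p^m is pulled out in front, which is possible because m > 0.\<close>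
  have "(\<Sum>i<p. b ^ (p - Suc i) * a ^ i) = (\<Sum>i<p. b ^ (p - 1)) + of_nat p *
    (\<Sum>i<p. of_nat p ^ (m - 1) * b ^ (p - Suc i) * (SOME d. a ^ i = b ^ i + of_nat p ^ m * d))"
    unfolding sum_distrib_left sum.distrib[symmetric]
  proof (intro sum.cong refl)
    fix i assume i: "i \<in> {..<p}"
    have "\<exists>d. a ^ i = b ^ i + of_nat p ^ m * d"
    proof -
      have "a ^ i - b ^ i = of_nat p ^ m * (c * (\<Sum>j<i. b^(i - Suc j) * a^j))"
        unfolding power_diff_sumr2 by (simp add: c algebra_simps)
      thus ?thesis by (metis add.commute diff_add_cancel)
    qed
    from someI_ex[OF this] have "b ^ (p - Suc i) * a ^ i = b ^ (p
        - Suc i) * (b ^ i + of_nat p ^ m * (SOME d. a ^ i = b ^ i + of_nat p ^ m * d))"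
      by simp
    also have "\<dots> = b ^ (p - 1) + of_nat p * (of_nat p ^ (m - 1) * b ^ (p - Suc i) * (SOME d. a ^ i
        = b ^ i + of_nat p ^ m * d))"
      using i assms(2) by (cases m) (auto simp: algebra_simps simp flip: power_add)
    finally show "b ^ (p - Suc i) * a ^ i = b ^ (p - 1) + of_nat p * (of_nat p ^ (m - 1) * b ^ (p
        - Suc i) * (SOME d. a ^ i = b ^ i + of_nat p ^ m * d))" .
  qed
  hence "of_nat p dvd (\<Sum>i<p. b ^ (p - Suc i) * a ^ i)" by simp
  hence "of_nat p ^ m * of_nat p dvd (a - b) * (\<Sum>i<p. b ^ (p - Suc i) * a ^ i)"
    using assms(3) by (intro mult_dvd_mono)
  thus ?thesis by (simp add: power_diff_sumr2[of a p b] ac_simps)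
qed

section \<open>Cyclic digit positions, their weights, and sums of weighted terms\<close>

context unram
begin

text \<open>Digit positions are cyclic because a p-th power takes T(a)^(p^l) to T(a)^(p^(l+1)),
  while T(a)^q = T(a).\<close>

definition nx :: "nat \<Rightarrow> nat" where "nx l = Suc l mod t"
definition pv :: "nat \<Rightarrow> nat" where "pv l = (l + t - 1) mod t"

text \<open>\<open>wt j l\<close> is the weight of the digit \<open>l\<close> in \<open>(q - 1) s\<^sub>j\<close>.\<close>

definition wt :: "nat \<Rightarrow> nat \<Rightarrow> nat" where "wt j l = p ^ ((l + t - j) mod t)"

lemma nx_less [simp]: "nx l < t" and pv_less [simp]: "pv l < t"
  using t_pos by (auto simp: nx_def pv_def)

lemma pv_nx: "l < t \<Longrightarrow> pv (nx l) = l"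
  by (cases "Suc l = t") (auto simp: pv_def nx_def mod_if)

lemma nx_pv: "l < t \<Longrightarrow> nx (pv l) = l"
  by (cases l) (auto simp: pv_def nx_def mod_if)

lemma sum_nx: "(\<Sum>l<t. f (nx l)) = (\<Sum>l<t. f l)"
  by (rule sum.reindex_bij_witness[of _ pv nx]) (auto simp: pv_nx nx_pv)

lemma wt_self [simp]: "j < t \<Longrightarrow> wt j j = 1" by (simp add: wt_def)

lemma wt_nx_nx:
  assumes "j < t" "l < t" shows "wt (nx j) (nx l) = wt j l"
proof -
  have "(nx l + t - nx j) mod t = (l + t - j) mod t"
    using assms by (cases "Suc l = t"; cases "Suc j = t") (auto simp: nx_def mod_if)
  thus ?thesis by (simp add: wt_def)
qed

text \<open>Only the step into position j wraps around: there the weight p^(t-1) becomes q = 1 + (q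
  - 1).\<close>

lemma p_wt:
  assumes "j < t" "l < t" shows "p * wt j l = wt j (nx l) + (if j = nx l then q - 1 else 0)"
proof (cases "j = nx l")
  case True
  have "(l + t - j) mod t = t - 1"
    using assms True by (cases "Suc l = t") (auto simp: nx_def mod_if)
  hence "p * wt j l = q" using t_pos q_eq by (simp add: wt_def flip: power_Suc)
  thus ?thesis using True assms q_ge_2 by simp
next
  case False
  have "(nx l + t - j) mod t = Suc ((l + t - j) mod t)"
    using assms False by (cases "Suc l = t") (auto simp: nx_def mod_if split: if_splits)
  thus ?thesis using False by (simp add: wt_def)
qed

lemma p_power_cong: "[p ^ m = p ^ (m mod t)] (mod (q - 1))"
proof -
  have "[q = 1] (mod (q - 1))" using q_ge_2 by (simp add: cong_def mod_if)
  hence "[q ^ (m div t) * p ^ (m mod t) = 1 ^ (m div t) * p ^ (m mod t)] (mod (q - 1))"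
    by (intro cong_mult cong_pow cong_refl)
  moreover have "q ^ (m div t) * p ^ (m mod t) = p ^ m"
    unfolding q_eq power_mult[symmetric] power_add[symmetric] by simp
  ultimately show ?thesis by simp
qed

lemma wt_cong: "j < t \<Longrightarrow> l < t \<Longrightarrow> [p ^ j * wt j l = p ^ l] (mod (q - 1))"
proof -
  assume jl: "j < t" "l < t"
  have "[p ^ (j + (l + t - j) mod t) = p ^ ((j + (l + t - j) mod t) mod t)] (mod (q - 1))"
    by (rule p_power_cong)
  moreover have "(j + (l + t - j) mod t) mod t = l" using jl by (simp add: mod_add_right_eq)
  ultimately show ?thesis by (simp add: wt_def power_add)
qed

lemma coprime_p_q1: "coprime (p ^ j) (q - 1)"
proof -
  have "coprime q (q - 1)" using q_ge_2 by (metis coprime_diff_one_right_nat pos2 order_less_le_trans)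
  hence "coprime p (q - 1)" using t_pos q_eq by (metis coprime_power_left_iff less_nat_zero_code)
  thus ?thesis by simp
qed

text \<open>Modulo q - 1 the weights \<open>wt j l\<close> are p^l up to the common factor p^j,
  which is coprime to q - 1.\<close>

lemma dvd_wt_sum:
  assumes "j < t" "(q - 1) dvd (\<Sum>l<t. N l * p ^ l)"
  shows "(q - 1) dvd (\<Sum>l<t. N l * wt j l)"
proof -
  have "[(\<Sum>l<t. N l * (p ^ j * wt j l)) = (\<Sum>l<t. N l * p ^ l)] (mod (q - 1))"
    using assms(1) by (intro cong_sum cong_mult cong_refl wt_cong) auto
  hence "(q - 1) dvd (\<Sum>l<t. N l * (p ^ j * wt j l))" using assms(2) by (simp add: cong_dvd_iff)
  hence "(q - 1) dvd p ^ j * (\<Sum>l<t. N l * wt j l)" by (simp add: sum_distrib_left ac_simps)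
  thus ?thesis using coprime_p_q1 by (simp add: coprime_commute coprime_dvd_mult_right_iff)
qed

text \<open>The exponent of \<open>T (y k)\<close> is kept as a formal sum of powers of \<open>p\<close> with unrestricted
  multiplicities \<open>N k l\<close>, so that weights are additive under multiplication. The number \<open>v j\<close> counts
  the factors \<open>p\<close> that pay for an excess \<open>(q - 1) * v j\<close> of the weight \<open>j\<close>.\<close>

definition gen :: "'v set \<Rightarrow> 'r \<Rightarrow> (nat \<Rightarrow> nat) \<Rightarrow> ('v \<Rightarrow> nat \<Rightarrow> nat) \<Rightarrow> ('v \<Rightarrow> 'k) \<Rightarrow> 'r" where
  "gen K c v N y = c * of_nat p ^ (\<Sum>j<t. v j) * (\<Prod>k\<in>K. T (y k) ^ (\<Sum>l<t. N k l * p ^ l))"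

definition admissible :: "'v set \<Rightarrow> (nat \<Rightarrow> nat) \<Rightarrow> (nat \<Rightarrow> nat) \<Rightarrow> ('v \<Rightarrow> nat \<Rightarrow> nat) \<Rightarrow> bool" where
  "admissible K \<sigma> v N \<longleftrightarrow> (\<forall>j<t. (\<Sum>k\<in>K. \<Sum>l<t. N k l * wt j l) \<le> \<sigma> j + (q - 1) * v j)"

text \<open>Sums are built one term at a time so that \<open>E_frobenius\<close> only has to expand
  the p-th power of a sum of two summands.\<close>

inductive_set E :: "'v set \<Rightarrow> (nat \<Rightarrow> nat) \<Rightarrow> (('v \<Rightarrow> 'k) \<Rightarrow> 'r) set" for K \<sigma> where
  E_0: "(\<lambda>y. 0) \<in> E K \<sigma>"
| E_gen_add: "admissible K \<sigma> v N \<Longrightarrow> h \<in> E K \<sigma> \<Longrightarrow> (\<lambda>y. gen K c v N y + h y) \<in> E K \<sigma>"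

lemma E_gen: "admissible K \<sigma> v N \<Longrightarrow> gen K c v N \<in> E K \<sigma>"
  using E_gen_add[OF _ E_0, of K \<sigma> v N c] by simp

lemma E_add: "g \<in> E K \<sigma> \<Longrightarrow> h \<in> E K \<sigma> \<Longrightarrow> (\<lambda>y. g y + h y) \<in> E K \<sigma>"
proof (induction rule: E.induct)
  case (E_gen_add v N g c)
  from E_gen_add(1) E_gen_add(3)[OF E_gen_add(4)]
  have "(\<lambda>y. gen K c v N y + (g y + h y)) \<in> E K \<sigma>" by (rule E.E_gen_add)
  thus ?case by (simp add: add.assoc)
qed simp

lemma E_sum: "(\<And>i. i \<in> I \<Longrightarrow> g i \<in> E K \<sigma>) \<Longrightarrow> (\<lambda>y. \<Sum>i\<in>I. g i y) \<in> E K \<sigma>"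
  by (induction I rule: infinite_finite_induct) (auto intro: E_0 E_add)

lemma gen_mult: "gen K c v N y * gen K c' v' N' y
    = gen K (c * c') (\<lambda>j. v j + v' j) (\<lambda>k l. N k l + N' k l) y"
  by (simp add: gen_def sum.distrib power_add prod.distrib algebra_simps)

lemma admissible_add: "admissible K \<sigma> v N \<Longrightarrow> admissible K \<tau> v' N' \<Longrightarrow>
    admissible K (\<lambda>j. \<sigma> j + \<tau> j) (\<lambda>j. v j + v' j) (\<lambda>k l. N k l + N' k l)"
  unfolding admissible_def
proof (intro allI impI)
  fix j assume "j < t" and *: "\<forall>j<t. (\<Sum>k\<in>K. \<Sum>l<t. N k l * wt j l) \<le> \<sigma> j + (q - 1) * v j"
    "\<forall>j<t. (\<Sum>k\<in>K. \<Sum>l<t. N' k l * wt j l) \<le> \<tau> j + (q - 1) * v' j"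
  have "(\<Sum>k\<in>K. \<Sum>l<t. (N k l + N' k l) * wt j l) =
    (\<Sum>k\<in>K. \<Sum>l<t. N k l * wt j l) + (\<Sum>k\<in>K. \<Sum>l<t. N' k l * wt j l)"
    by (simp add: sum.distrib distrib_right)
  also have "\<dots> \<le> (\<sigma> j + (q - 1) * v j) + (\<tau> j + (q - 1) * v' j)"
    using * \<open>j < t\<close> by (intro add_mono) auto
  finally show "(\<Sum>k\<in>K. \<Sum>l<t. (N k l + N' k l) * wt j l) \<le> \<sigma> j + \<tau> j + (q - 1) * (v j + v' j)"
    by (simp add: distrib_left)
qed

lemma E_gen_mult: "h \<in> E K \<tau> \<Longrightarrow> admissible K \<sigma> v N \<Longrightarrow> (\<lambda>y. gen K c v N y * h y) \<in> E K (\<lambda>j. \<sigma> j + \<tau> j)"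
proof (induction rule: E.induct)
  case (E_gen_add v' N' h c')
  show ?case using E.E_gen_add[OF admissible_add[OF E_gen_add(4) E_gen_add(1)] E_gen_add(3)[OF
      E_gen_add(4)], of "c * c'"]
    by (simp add: distrib_left gen_mult)
qed (simp add: E_0)

lemma E_mult: "g \<in> E K \<sigma> \<Longrightarrow> h \<in> E K \<tau> \<Longrightarrow> (\<lambda>y. g y * h y) \<in> E K (\<lambda>j. \<sigma> j + \<tau> j)"
proof (induction rule: E.induct)
  case (E_gen_add v N g c)
  show ?case using E_add[OF E_gen_mult[OF E_gen_add(4,1), of c] E_gen_add(3)[OF E_gen_add(4)]]
    by (simp add: distrib_right)
qed (simp add: E_0)

lemma E_const: "(\<lambda>y. a) \<in> E K \<sigma>"
proof -
  have "admissible K \<sigma> (\<lambda>_. 0) (\<lambda>_ _. 0)" by (simp add: admissible_def)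
  from E_gen[OF this, of a] show ?thesis unfolding gen_def by simp
qed

lemma E_scale: "g \<in> E K \<sigma> \<Longrightarrow> (\<lambda>y. a * g y) \<in> E K \<sigma>"
  using E_mult[OF E_const[of a K "\<lambda>_. 0"], of g \<sigma>] by simp

lemma E_pow: "g \<in> E K \<sigma> \<Longrightarrow> (\<lambda>y. g y ^ n) \<in> E K (\<lambda>j. n * \<sigma> j)"
  by (induction n) (auto intro: E_const dest: E_mult)

text \<open>The extra factor p is booked as one more unit of \<open>v j0\<close>, which pays for an
  excess q - 1 of the weight \<open>j0\<close>.\<close>

lemma E_p:
  assumes "g \<in> E K \<sigma>'" "j0 < t" "\<And>j. j < t \<Longrightarrow> \<sigma>' j \<le> \<sigma> j + (if j = j0 then q - 1 else 0)"
  shows "(\<lambda>y. of_nat p * g y) \<in> E K \<sigma>"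
  using assms(1)
proof (induction rule: E.induct)
  case (E_gen_add v N h c)
  define v' where "v' = (\<lambda>j. v j + (if j = j0 then 1 else 0))"
  have "of_nat p * gen K c v N y = gen K c v' N y" for y
    using assms(2) by (simp add: gen_def v'_def sum.distrib algebra_simps)
  moreover have "admissible K \<sigma> v' N"
    unfolding admissible_def
  proof (intro allI impI)
    fix j assume j: "j < t"
    have "(\<Sum>k\<in>K. \<Sum>l<t. N k l * wt j l) \<le> \<sigma>' j + (q - 1) * v j"
      using E_gen_add(1) j by (simp add: admissible_def)
    also have "\<dots> \<le> \<sigma> j + (q - 1) * v' j"
      using assms(3)[OF j] by (auto simp: v'_def algebra_simps split: if_splits)
    finally show "(\<Sum>k\<in>K. \<Sum>l<t. N k l * wt j l) \<le> \<sigma> j + (q - 1) * v' j" .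
  qed
  ultimately show ?case using E.E_gen_add[OF _ E_gen_add(3), of v' N c] by (simp add: distrib_left)
qed (simp add: E_0)

lemma binomial_prime:
  fixes a b :: 'r
  shows "(a + b) ^ p = a ^ p + b ^ p + of_nat p * (\<Sum>i\<in>{1..<p}. of_nat ((p choose i) div p) * (a ^ i
      * b ^ (p - i)))"
proof -
  have split: "{..p} = insert 0 (insert p {1..<p})" using p_ge_2 by auto
  have "of_nat p * (\<Sum>i\<in>{1..<p}. of_nat ((p choose i) div p) * (a ^ i * b ^ (p - i)))
      = (\<Sum>i\<in>{1..<p}. of_nat (p choose i) * a ^ i * b ^ (p - i))"
    unfolding sum_distrib_left
  proof (intro sum.cong refl)
    fix i assume i: "i \<in> {1..<p}"
    have "p dvd (p choose i)" using i p_ge_2 by (intro dvd_choose_prime prime_p) auto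
    hence "of_nat (p choose i) = (of_nat p * of_nat ((p choose i) div p) :: 'r)"
      by (simp flip: of_nat_mult)
    thus "of_nat p * (of_nat ((p choose i) div p) * (a ^ i * b ^ (p - i)))
        = of_nat (p choose i) * a ^ i * b ^ (p - i)"
      by (simp add: ac_simps)
  qed
  thus ?thesis unfolding binomial_ring split using p_ge_2 by simp
qed

lemma teich_q: "T a ^ q = T a"
  using teich_cong[of q 1 a] q_ge_2 by (simp add: cong_def mod_if)

lemma teich_p_power_nx: "l < t \<Longrightarrow> T a ^ (p * p ^ l) = T a ^ (p ^ nx l)"
  using teich_q[of a] t_pos by (cases "Suc l = t") (auto simp: nx_def simp flip: q_eq power_Suc)

text \<open>The p-th power of a single term rotates its digits by one place, and weights are
  unchanged when j is rotated along. The power of p is multiplied by p; one copy stays in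
  \<open>v'\<close> and the surplus goes into the coefficient.\<close>

lemma gen_frobenius:
  assumes "admissible K (\<lambda>j. wt j l) v N" "l < t"
  shows "(\<lambda>y. gen K c v N y ^ p) \<in> E K (\<lambda>j. wt j (nx l))"
proof -
  define v' where "v' j = v (pv j)" for j
  define N' where "N' k l = N k (pv l)" for k l
  have sv: "(\<Sum>j<t. v' j) = (\<Sum>j<t. v j)"
    unfolding v'_def by (subst sum_nx[symmetric]) (simp add: pv_nx)
  have T: "(T a ^ (\<Sum>l<t. N k l * p ^ l)) ^ p = T a ^ (\<Sum>l<t. N' k l * p ^ l)" for a k
  proof -
    have "(T a ^ (\<Sum>l<t. N k l * p ^ l)) ^ p = (\<Prod>l<t. (T a ^ (p * p ^ l)) ^ N k l)"
      by (simp add: power_sum prod_power_distrib ac_simps flip: power_mult)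
    also have "\<dots> = (\<Prod>l<t. (T a ^ (p ^ nx l)) ^ N k l)"
      by (intro prod.cong refl) (simp add: teich_p_power_nx)
    also have "\<dots> = T a ^ (\<Sum>l<t. N' k (nx l) * p ^ nx l)"
      by (simp add: power_sum N'_def pv_nx ac_simps flip: power_mult)
    also have "(\<Sum>l<t. N' k (nx l) * p ^ nx l) = (\<Sum>l<t. N' k l * p ^ l)"
      by (rule sum_nx)
    finally show ?thesis .
  qed
  have "gen K c v N y ^ p = gen K (c ^ p * of_nat p ^ ((p - 1) * (\<Sum>j<t. v j))) v' N' y" for y
  proof -
    have "of_nat p ^ ((\<Sum>j<t. v j) * p) = (of_nat p ^ ((p
        - 1) * (\<Sum>j<t. v j)) * of_nat p ^ (\<Sum>j<t. v j) :: 'r)"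
      using p_ge_2 by (cases p) (auto simp: algebra_simps simp flip: power_add)
    thus ?thesis unfolding gen_def power_mult_distrib prod_power_distrib T sv
      by (simp add: ac_simps flip: power_mult)
  qed
  moreover have "admissible K (\<lambda>j. wt j (nx l)) v' N'"
    unfolding admissible_def
  proof (intro allI impI)
    fix j assume "j < t"
    define i where "i = pv j"
    have i: "i < t" "j = nx i" using \<open>j < t\<close> by (auto simp: i_def nx_pv)
    have "(\<Sum>k\<in>K. \<Sum>l<t. N' k l * wt j l) = (\<Sum>k\<in>K. \<Sum>l<t. N k l * wt i l)"
      by (subst sum_nx[symmetric]) (simp add: N'_def pv_nx i wt_nx_nx)
    also have "\<dots> \<le> wt i l + (q - 1) * v i" using assms i by (simp add: admissible_def)
    also have "\<dots> = wt j (nx l) + (q - 1) * v' j" using assms i by (simp add: wt_nx_nx v'_def pv_nx)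
    finally show "(\<Sum>k\<in>K. \<Sum>l<t. N' k l * wt j l) \<le> wt j (nx l) + (q - 1) * v' j" .
  qed
  ultimately show ?thesis using E_gen by simp
qed

text \<open>The mixed terms of the p-th power have weight \<open>p * wt j l\<close>. By \<open>p_wt\<close> this is too large only for
  \<open>j = nx l\<close>, by \<open>q - 1\<close>, which is what their binomial coefficient pays for.\<close>

lemma E_frobenius:
  assumes "l < t" "g \<in> E K (\<lambda>j. wt j l)"
  shows "(\<lambda>y. g y ^ p) \<in> E K (\<lambda>j. wt j (nx l))"
  using assms(2)
proof (induction rule: E.induct)
  case E_0
  show ?case using p_ge_2 E.E_0 by (simp add: power_0_left)
next
  case (E_gen_add v N h c)
  have "(\<lambda>y. \<Sum>i\<in>{1..<p}. of_nat ((p choose i) div p) * (gen K c v N y ^ i * h y ^ (p - i)))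
      \<in> E K (\<lambda>j. p * wt j l)"
  proof (intro E_sum E_scale)
    fix i assume i: "i \<in> {1..<p}"
    have "(\<lambda>y. gen K c v N y ^ i * h y ^ (p - i)) \<in> E K (\<lambda>j. i * wt j l + (p - i) * wt j l)"
      by (intro E_mult E_pow E_gen E_gen_add)
    thus "(\<lambda>y. gen K c v N y ^ i * h y ^ (p - i)) \<in> E K (\<lambda>j. p * wt j l)"
      using i by (simp flip: distrib_right)
  qed
  hence "(\<lambda>y. of_nat p * (\<Sum>i\<in>{1..<p}. of_nat ((p choose i) div p) * (gen K c v N y ^ i * h y ^ (p
      - i))))
     \<in> E K (\<lambda>j. wt j (nx l))"
    by (rule E_p[of _ _ _ "nx l"]) (use p_wt assms(1) in auto)
  thus ?case unfolding binomial_prime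
    by (intro E_add gen_frobenius E_gen_add assms(1))
qed

section \<open>Expansion of powers of lifted linear forms, and the resulting divisibility\<close>

definition E_mod :: "'v set \<Rightarrow> nat \<Rightarrow> (nat \<Rightarrow> nat) \<Rightarrow> (('v \<Rightarrow> 'k) \<Rightarrow> 'r) \<Rightarrow> bool" where
  "E_mod K m \<sigma> G \<longleftrightarrow> (\<exists>g\<in>E K \<sigma>. \<forall>y. of_nat p ^ m dvd G y - g y)"

lemma E_mod_mult:
  assumes "E_mod K m \<sigma> G" "E_mod K m \<tau> H"
  shows "E_mod K m (\<lambda>j. \<sigma> j + \<tau> j) (\<lambda>y. G y * H y)"
proof -
  obtain g h where gh: "g \<in> E K \<sigma>" "\<And>y. of_nat p ^ m dvd G y - g y"
     "h \<in> E K \<tau>" "\<And>y. of_nat p ^ m dvd H y - h y"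
    using assms unfolding E_mod_def by blast
  have "of_nat p ^ m dvd G y * H y - g y * h y" for y
  proof -
    have "G y * H y - g y * h y = (G y - g y) * H y + g y * (H y - h y)" by (simp add: algebra_simps)
    thus ?thesis using gh by simp
  qed
  thus ?thesis unfolding E_mod_def by (intro bexI[OF _ E_mult[OF gh(1,3)]] allI)
qed

lemma E_mod_one: "E_mod K m (\<lambda>_. 0) (\<lambda>_. 1)"
  unfolding E_mod_def by (rule bexI[of _ "\<lambda>_. 1"]) (auto intro: E_const)

lemma E_mod_pow: "E_mod K m \<sigma> G \<Longrightarrow> E_mod K m (\<lambda>j. n * \<sigma> j) (\<lambda>y. G y ^ n)"
  by (induction n) (auto intro: E_mod_one dest: E_mod_mult)

lemma E_mod_prod:
  "finite I \<Longrightarrow> (\<And>i. i \<in> I \<Longrightarrow> E_mod K m (\<sigma> i) (G i)) \<Longrightarrow> E_mod K m (\<lambda>j. \<Sum>i\<in>I. \<sigma> i j) (\<lambda>y. \<Prod>i\<in>I. G i y)"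
  by (induction I rule: finite_induct) (auto intro: E_mod_one dest: E_mod_mult)

lemma field_frobenius_sum: "(\<Sum>k\<in>K. f k :: 'k) ^ (p ^ l) = (\<Sum>k\<in>K. f k ^ (p ^ l))"
  using freshmans_dream_sum'[of "p ^ l" l f K] CHAR_k prime_p p_ge_2 by simp

text \<open>Induction on the precision m. Modulo p, the lift of a linear form is the sum of the
  lifts, and Frobenius is additive on the residue field. For the step, T(a)^(p^l) is the p-th power
  of T(a)^(p^\<open>pv l\<close>): by \<open>prime_power_diff_lift\<close> the p-th power gains one
  factor p of precision, and by \<open>E_frobenius\<close> it moves the weight from
  \<open>pv l\<close> to \<open>l\<close>.\<close>

lemma E_mod_linear:
  assumes "finite K" "0 < m" "l < t"
  shows "E_mod K m (\<lambda>j. wt j l) (\<lambda>y. T (\<Sum>k\<in>K. y k * c k) ^ (p ^ l))"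
  using assms(2,3)
proof (induction m arbitrary: l)
  case (Suc m)
  show ?case
  proof (cases "m = 0")
    case True
    define g where "g y = (\<Sum>k\<in>K. T (c k) ^ (p ^ l) * T (y k) ^ (p ^ l))" for y
    have "g \<in> E K (\<lambda>j. wt j l)"
      unfolding g_def
    proof (intro E_sum E_scale)
      fix k assume k: "k \<in> K"
      define N where "N k' l' = (if k' = k \<and> l' = l then 1 else 0::nat)" for k' l'
      have N: "(\<Sum>l'<t. N k' l' * f l') = (if k' = k then f l else 0)" for k' f
        using \<open>l < t\<close> by (simp add: N_def if_distribR if_distrib[of "\<lambda>x. x * _"] sum.delta cong: if_cong)
      have "admissible K (\<lambda>j. wt j l) (\<lambda>_. 0) N"
        using k assms(1) by (simp add: admissible_def N)
      moreover have "gen K 1 (\<lambda>_. 0) N = (\<lambda>y. T (y k) ^ p ^ l)"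
      proof
        fix y
        have "gen K 1 (\<lambda>_. 0) N y = (\<Prod>k'\<in>K. if k' = k then T (y k') ^ p ^ l else 1)"
          unfolding gen_def N by (simp add: if_distrib[of "\<lambda>x. _ ^ x"] cong: if_cong)
        also have "\<dots> = T (y k) ^ p ^ l" using k assms(1) by simp
        finally show "gen K 1 (\<lambda>_. 0) N y = T (y k) ^ p ^ l" .
      qed
      ultimately show "(\<lambda>y. T (y k) ^ p ^ l) \<in> E K (\<lambda>j. wt j l)" using E_gen by metis
    qed
    moreover have "of_nat p ^ Suc m dvd T (\<Sum>k\<in>K. y k * c k) ^ (p ^ l) - g y" for y
      unfolding True power_one_right One_nat_def[symmetric] res_eq_iff[symmetric]
      by (simp add: g_def res_sum field_frobenius_sum power_mult_distrib mult.commute)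
    ultimately show ?thesis unfolding E_mod_def by blast
  next
    case False
    from Suc.IH[of "pv l"] False obtain g where g: "g \<in> E K (\<lambda>j. wt j (pv l))"
      "\<And>y. of_nat p ^ m dvd T (\<Sum>k\<in>K. y k * c k) ^ (p ^ pv l) - g y"
      unfolding E_mod_def by auto
    have "of_nat p ^ Suc m dvd (T (\<Sum>k\<in>K. y k * c k) ^ (p ^ pv l)) ^ p - g y ^ p" for y
      using False by (intro prime_power_diff_lift prime_p g) auto
    moreover have "(T a ^ (p ^ pv l)) ^ p = T a ^ (p ^ l)" for a
      using teich_p_power_nx[of "pv l" a] Suc.prems by (simp add: nx_pv mult.commute flip: power_mult)
    ultimately show ?thesis
      unfolding E_mod_def using E_frobenius[OF pv_less g(1)] Suc.prems
      by (intro bexI[of _ "\<lambda>y. g y ^ p"]) (auto simp: nx_pv)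
  qed
qed simp

text \<open>The sum factors over k into power sums of T, so it vanishes unless q - 1 divides every
  exponent. A zero exponent then contributes q = p^t, and a nonzero one consumes at least q - 1 of
  every weight. Hence for each j the number of nonzero exponents is at most
  \<open>s j + v j\<close>; summing over j shows that enough powers of p are present.\<close>

lemma sum_gen_dvd:
  assumes "finite K" "admissible K \<sigma> v N" "\<And>j. j < t \<Longrightarrow> \<sigma> j = (q - 1) * s j"
  shows "of_nat p ^ (\<Sum>j<t. card K - s j) dvd (\<Sum>y\<in>PiE K (\<lambda>_. UNIV). gen K c v N y)"
proof -
  define e where "e k = (\<Sum>l<t. N k l * p ^ l)" for k
  have eq: "(\<Sum>y\<in>PiE K (\<lambda>_. UNIV). gen K c v N y)
      = c * of_nat p ^ (\<Sum>j<t. v j) * (\<Prod>k\<in>K. \<Sum>u\<in>UNIV. T u ^ e k)"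
    using assms(1) by (simp add: gen_def prod_sum_PiE e_def flip: sum_distrib_left)
  show ?thesis
  proof (cases "\<exists>k\<in>K. \<not> (q - 1) dvd e k")
    case True
    hence "(\<Prod>k\<in>K. \<Sum>u\<in>UNIV. T u ^ e k) = 0"
      using assms(1) by (intro prod_zero) (auto simp: sum_teich_power)
    thus ?thesis using eq by simp
  next
    case False
    define K0 where "K0 = {k\<in>K. e k = 0}"
    have K0: "finite K0" "K0 \<subseteq> K" using assms(1) by (auto simp: K0_def)
    have "(\<Prod>k\<in>K0. \<Sum>u\<in>UNIV. T u ^ e k) = (\<Prod>k\<in>K0. of_nat q)"
      by (intro prod.cong refl) (simp only: K0_def sum_teich_power, simp)
    also have "\<dots> = of_nat p ^ (t * card K0)" by (simp add: q_eq power_mult)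
    finally have "(\<Prod>k\<in>K0. \<Sum>u\<in>UNIV. T u ^ e k) = of_nat p ^ (t * card K0)" .
    hence "of_nat p ^ (t * card K0) dvd (\<Prod>k\<in>K. \<Sum>u\<in>UNIV. T u ^ e k)"
      using prod_dvd_prod_subset[OF assms(1) K0(2), of "\<lambda>k. \<Sum>u\<in>UNIV. T u ^ e k"] by simp
    hence "of_nat p ^ (\<Sum>j<t. v j) * of_nat p ^ (t * card K0) dvd (\<Sum>y\<in>PiE K (\<lambda>_. UNIV). gen K c v N y)"
      unfolding eq by (intro mult_dvd_mono dvd_triv_right)
    moreover have "(\<Sum>j<t. card K - s j) \<le> (\<Sum>j<t. v j + card K0)"
    proof (intro sum_mono)
      fix j assume "j \<in> {..<t}"
      hence j: "j < t" by simp
      have "(\<Sum>k\<in>K - K0. q - 1) \<le> (\<Sum>k\<in>K - K0. \<Sum>l<t. N k l * wt j l)"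
      proof (intro sum_mono)
        fix k assume k: "k \<in> K - K0"
        hence "(q - 1) dvd (\<Sum>l<t. N k l * p ^ l)" using False by (auto simp: e_def)
        hence "(q - 1) dvd (\<Sum>l<t. N k l * wt j l)" using dvd_wt_sum j by blast
        moreover have "(\<Sum>l<t. N k l * wt j l) > 0"
        proof -
          have "\<exists>l<t. N k l * wt j l \<noteq> 0" using k p_ge_2 by (auto simp: K0_def e_def wt_def)
          thus ?thesis by (intro sum_pos2[of _ "SOME l. l < t \<and> N k l * wt j l \<noteq> 0"])
            (use someI_ex[of "\<lambda>l. l < t \<and> N k l * wt j l \<noteq> 0"] in auto)
        qed
        ultimately show "q - 1 \<le> (\<Sum>l<t. N k l * wt j l)" by (rule dvd_imp_le)
      qed
      also have "\<dots> \<le> (\<Sum>k\<in>K. \<Sum>l<t. N k l * wt j l)" using assms(1) by (intro sum_mono2) auto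
      also have "\<dots> \<le> (q - 1) * (s j + v j)" using assms(2,3) j
          by (simp add: admissible_def algebra_simps)
      finally have "(q - 1) * (card K - card K0) \<le> (q - 1) * (s j + v j)"
        using K0 by (simp add: card_Diff_subset mult.commute)
      hence "card K - card K0 \<le> s j + v j" using q_ge_2 by simp
      thus "card K - s j \<le> v j + card K0" by simp
    qed
    hence "(\<Sum>j<t. card K - s j) \<le> (\<Sum>j<t. v j) + t * card K0" by (simp add: sum.distrib)
    ultimately show ?thesis by (metis power_add power_le_dvd)
  qed
qed

lemma sum_E_dvd:
  assumes "finite K" "\<And>j. j < t \<Longrightarrow> \<sigma> j = (q - 1) * s j" "g \<in> E K \<sigma>"
  shows "of_nat p ^ (\<Sum>j<t. card K - s j) dvd (\<Sum>y\<in>PiE K (\<lambda>_. UNIV). g y)"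
  using assms(3)
proof (induction rule: E.induct)
  case (E_gen_add v N h c)
  show ?case unfolding sum.distrib
    by (intro dvd_add sum_gen_dvd[OF assms(1) E_gen_add(1) assms(2)] E_gen_add(3))
qed simp

text \<open>In the application \<open>w\<close> lists a basis of a subspace and \<open>y\<close>
  runs through the coordinates of its vectors.\<close>

theorem sum_monomial_dvd:
  fixes D :: "'n::finite \<Rightarrow> nat \<Rightarrow> nat" and w :: "'v \<Rightarrow> 'n \<Rightarrow> 'k"
  assumes "finite K" and s: "\<And>j. j < t \<Longrightarrow> (\<Sum>i\<in>UNIV. \<Sum>l<t. D i l * wt j l) = (q - 1) * s j"
  shows "of_nat p ^ (\<Sum>j<t. card K - s j) dvd
    (\<Sum>y\<in>PiE K (\<lambda>_. UNIV). \<Prod>i\<in>UNIV. T (\<Sum>k\<in>K. y k * w k i) ^ (\<Sum>l<t. D i l * p ^ l))"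
proof -
  define L where "L = (\<Sum>j<t. card K - s j)"
  \<comment> \<open>The precision is \<open>Suc L\<close> rather than \<open>L\<close> because
    \<open>E_mod_linear\<close> needs a positive precision and \<open>L\<close> may be 0.\<close>
  have "E_mod K (Suc L) (\<lambda>j. \<Sum>i\<in>UNIV. \<Sum>l<t. D i l * wt j l)
     (\<lambda>y. \<Prod>i\<in>UNIV. \<Prod>l<t. (T (\<Sum>k\<in>K. y k * w k i) ^ (p ^ l)) ^ D i l)"
    using assms(1) by (intro E_mod_prod E_mod_pow E_mod_linear) auto
  hence "E_mod K (Suc L) (\<lambda>j. \<Sum>i\<in>UNIV. \<Sum>l<t. D i l * wt j l)
     (\<lambda>y. \<Prod>i\<in>UNIV. T (\<Sum>k\<in>K. y k * w k i) ^ (\<Sum>l<t. D i l * p ^ l))"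
    by (simp add: power_sum mult.commute flip: power_mult)
  then obtain g where g: "g \<in> E K (\<lambda>j. \<Sum>i\<in>UNIV. \<Sum>l<t. D i l * wt j l)"
    "\<And>y. of_nat p ^ Suc L dvd (\<Prod>i\<in>UNIV. T (\<Sum>k\<in>K. y k * w k i) ^ (\<Sum>l<t. D i l * p ^ l)) - g y"
    unfolding E_mod_def by blast
  let ?G = "\<lambda>y. \<Prod>i\<in>UNIV. T (\<Sum>k\<in>K. y k * w k i) ^ (\<Sum>l<t. D i l * p ^ l)"
  have "of_nat p ^ L dvd (\<Sum>y\<in>PiE K (\<lambda>_. UNIV). ?G y - g y)"
    by (intro dvd_sum dvd_trans[OF le_imp_power_dvd g(2)]) simp
  moreover have "of_nat p ^ L dvd (\<Sum>y\<in>PiE K (\<lambda>_. UNIV). g y)"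
    unfolding L_def by (rule sum_E_dvd[OF assms(1) s g(1)])
  ultimately have "of_nat p ^ L dvd (\<Sum>y\<in>PiE K (\<lambda>_. UNIV). ?G y - g y) + (\<Sum>y\<in>PiE K (\<lambda>_. UNIV). g y)"
    by (rule dvd_add)
  thus ?thesis by (simp add: sum_subtractf L_def)
qed

end

section \<open>Points and subspaces\<close>

declare One_nat_def [simp del]

abbreviation "points \<equiv> subspaces_dim 1"
abbreviation "points_in Y \<equiv> {Z \<in> points. Z \<subseteq> Y}"

lemma point_obtain:
  assumes "Z \<in> points"
  obtains z where "z \<noteq> 0" "Z = vec.span {z}"
proof -
  have Z: "vec.subspace Z" "vec.dim Z = 1" using assms by (auto simp: subspaces_dim_def)
  obtain B where B: "B \<subseteq> Z" "vec.independent B" "Z \<subseteq> vec.span B" "card B = vec.dim Z"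
    by (rule vec.basis_exists)
  from B(4) Z(2) obtain z where z: "B = {z}" using card_1_singletonE by metis
  have "z \<noteq> 0" using B(2) z vec.dependent_zero by auto
  moreover have "Z = vec.span {z}"
    using B z Z(1) vec.span_minimal[of B Z] by auto
  ultimately show ?thesis using that by blast
qed

lemma span_singleton_point: "a \<noteq> 0 \<Longrightarrow> vec.span {a} \<in> points"
  by (auto simp: subspaces_dim_def vec.dim_span vec.dim_singleton)

lemma point_eq_span:
  assumes "Z \<in> points" "a \<in> Z" "a \<noteq> 0"
  shows "vec.span {a} = Z"
proof -
  obtain z where z: "z \<noteq> 0" "Z = vec.span {z}" using point_obtain[OF assms(1)] .
  obtain c where c: "a = c *s z" using assms(2) z by (auto simp: vec.span_singleton)
  have "c \<noteq> 0" using c assms(3) by auto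
  hence "z = (1 / c) *s a" using c by simp
  hence "z \<in> vec.span {a}" by (auto simp: vec.span_singleton)
  thus ?thesis using assms z vec.span_minimal[of "{z}" "vec.span {a}"] vec.span_minimal[of "{a}" Z]
    by (auto simp: vec.subspace_span)
qed

lemma card_point:
  fixes Z :: "('k::finite_field ^ 'n::finite) set"
  assumes "Z \<in> points"
  shows "card Z = CARD('k)"
proof -
  obtain z where z: "z \<noteq> 0" "Z = vec.span {z}" using point_obtain[OF assms] .
  have "inj (\<lambda>c. c *s z)" using z(1) by (auto intro!: injI)
  thus ?thesis using z by (simp add: vec.span_singleton card_image)
qed

text \<open>Each point contains q - 1 nonzero vectors, on which \<open>f\<close> is constant. The
  factor q - 1 does no harm later, being -1 in the residue field.\<close>

lemma sum_over_points:
  fixes Y :: "('k::finite_field ^ 'n::finite) set" and f :: "'k ^ 'n \<Rightarrow> 'c::comm_ring_1"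
  assumes Y: "vec.subspace Y" and f: "\<And>a. a \<noteq> 0 \<Longrightarrow> f a = G (vec.span {a})"
  shows "(\<Sum>a\<in>Y - {0}. f a) = of_nat (CARD('k) - 1) * (\<Sum>Z\<in>points_in Y. G Z)"
proof -
  have "(\<Sum>a\<in>Y - {0}. f a) = (\<Sum>Z\<in>points_in Y. \<Sum>a\<in>{a\<in>Y - {0}. vec.span {a} = Z}. f a)"
  proof (intro sum.group[symmetric])
    show "(\<lambda>a. vec.span {a}) ` (Y - {0}) \<subseteq> points_in Y"
      using Y span_singleton_point vec.span_minimal[OF _ Y] by blast
  qed auto
  also have "\<dots> = (\<Sum>Z\<in>points_in Y. of_nat (CARD('k) - 1) * G Z)"
  proof (intro sum.cong refl)
    fix Z assume Z: "Z \<in> points_in Y"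
    have "{a\<in>Y - {0}. vec.span {a} = Z} = Z - {0}"
      using Z point_eq_span[of Z] by (auto intro: vec.span_base)
    hence "(\<Sum>a\<in>{a\<in>Y - {0}. vec.span {a} = Z}. f a) = (\<Sum>a\<in>Z - {0}. G Z)"
      using f Z by (intro sum.cong) (auto simp: point_eq_span)
    also have "\<dots> = of_nat (card (Z - {0})) * G Z" by simp
    also have "card (Z - {0}) = CARD('k) - 1"
      using Z card_point[of Z] by (auto simp: card_Diff_singleton subspaces_dim_def vec.subspace_0)
    finally show "(\<Sum>a\<in>{a\<in>Y - {0}. vec.span {a} = Z}. f a) = of_nat (CARD('k) - 1) * G Z" .
  qed
  finally show ?thesis by (simp add: sum_distrib_left)
qed

text \<open>A basis serves as its own index set \<open>K\<close>; \<open>PiE\<close> makes the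
  coefficient function of a vector unique.\<close>

lemma subspace_coordinates:
  fixes Y :: "('k::finite_field ^ 'n::finite) set"
  assumes "Y \<in> subspaces_dim r"
  obtains K where "finite K" "card K = r" "bij_betw (\<lambda>y. \<Sum>k\<in>K. y k *s k) (PiE K (\<lambda>_. UNIV)) Y"
proof -
  have Y: "vec.subspace Y" "vec.dim Y = r" using assms by (auto simp: subspaces_dim_def)
  obtain B where B: "B \<subseteq> Y" "vec.independent B" "Y \<subseteq> vec.span B" "card B = vec.dim Y"
    by (rule vec.basis_exists)
  have fin: "finite B" by simp
  have span: "vec.span B = Y" using B Y(1) vec.span_minimal[of B Y] by auto
  have "inj_on (\<lambda>y. \<Sum>k\<in>B. y k *s k) (PiE B (\<lambda>_. UNIV))"
  proof (rule inj_onI)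
    fix x y assume xy: "x \<in> PiE B (\<lambda>_. UNIV)" "y \<in> PiE B (\<lambda>_. UNIV)" "(\<Sum>k\<in>B. x k *s k)
        = (\<Sum>k\<in>B. y k *s k)"
    have "(\<Sum>k\<in>B. (x k - y k) *s k) = 0" using xy(3)
        by (simp add: vec.scale_left_diff_distrib sum_subtractf)
    hence "x k - y k = 0" if "k \<in> B" for k using vec.independentD[OF B(2) fin subset_refl _ that, of
        "\<lambda>k. x k - y k"] by blast
    thus "x = y" using xy by (intro PiE_ext[OF xy(1,2)]) auto
  qed
  moreover have "(\<lambda>y. \<Sum>k\<in>B. y k *s k) ` (PiE B (\<lambda>_. UNIV)) = Y"
  proof -
    have "(\<Sum>k\<in>B. u k *s k) = (\<Sum>k\<in>B. restrict u B k *s k)" for u by (intro sum.cong) auto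
    moreover have "restrict u B \<in> PiE B (\<lambda>_. UNIV)" for u :: "_ \<Rightarrow> 'k" by simp
    ultimately have "(\<Sum>k\<in>B. u k *s k) \<in> (\<lambda>y. \<Sum>k\<in>B. y k *s k) ` (PiE B (\<lambda>_. UNIV))" for u
      by (intro image_eqI[of _ _ "restrict u B"])
    hence "range (\<lambda>u. \<Sum>k\<in>B. u k *s k) = (\<lambda>y. \<Sum>k\<in>B. y k *s k) ` (PiE B (\<lambda>_. UNIV))"
      by blast
    thus ?thesis using span vec.span_finite[OF fin] by simp
  qed
  ultimately show ?thesis using that[OF fin] B(4) Y(2) by (auto simp: bij_betw_def)
qed

lemma sum_fun_apply: "(\<Sum>e\<in>S. g e) x = (\<Sum>e\<in>S. g e x)"
  for g :: "'e \<Rightarrow> 'a \<Rightarrow> 'c::comm_monoid_add"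
  by (induction S rule: infinite_finite_induct) (auto simp: zero_fun_def plus_fun_def)

section \<open>The filtration, its reduction modulo p, and monomials as functions on points\<close>

context unram
begin

definition Mfil :: "nat \<Rightarrow> nat \<Rightarrow> (('k ^ 'n::finite) set \<Rightarrow> 'r) set" where
  "Mfil r i = {x \<in> funs_on points. \<forall>Y\<in>subspaces_dim r. of_nat p ^ i dvd (\<Sum>Z\<in>points_in Y. x Z)}"

definition Mbar :: "nat \<Rightarrow> nat \<Rightarrow> (('k ^ 'n::finite) set \<Rightarrow> 'k) set" where
  "Mbar r i = (\<lambda>x. res \<circ> x) ` Mfil r i"

lemma snf_filtration_eq: "snf_filtration p points (subspaces_dim r) (incidence r) i = Mfil r i"
proof -
  have "incidence r x \<in> fscale (of_nat p ^ i) ` funs_on (subspaces_dim r) \<longleftrightarrow>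
     (\<forall>Y\<in>subspaces_dim r. of_nat p ^ i dvd (\<Sum>Z\<in>points_in Y. x Z))"
     for x :: "('k ^ 'n::finite) set \<Rightarrow> 'r"
  proof
    assume "incidence r x \<in> fscale (of_nat p ^ i) ` funs_on (subspaces_dim r)"
    then obtain h where "incidence r x = fscale (of_nat p ^ i) h" by blast
    hence eq: "incidence r x Y = of_nat p ^ i * h Y" for Y by (simp add: fscale_def)
    have "(\<Sum>Z\<in>points_in Y. x Z) = of_nat p ^ i * h Y" if "Y \<in> subspaces_dim r" for Y
      using that eq[of Y] by (simp add: incidence_def)
    thus "\<forall>Y\<in>subspaces_dim r. of_nat p ^ i dvd (\<Sum>Z\<in>points_in Y. x Z)" by simp
  next
    assume *: "\<forall>Y\<in>subspaces_dim r. of_nat p ^ i dvd (\<Sum>Z\<in>points_in Y. x Z)"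
    define h where "h Y = (if Y \<in> subspaces_dim r then SOME c. (\<Sum>Z\<in>points_in Y. x Z)
        = of_nat p ^ i * c else 0)" for Y
    have "h \<in> funs_on (subspaces_dim r)" by (auto simp: funs_on_def h_def)
    moreover have "incidence r x = fscale (of_nat p ^ i) h"
    proof
      fix Y
      show "incidence r x Y = fscale (of_nat p ^ i) h Y"
        using * someI_ex[of "\<lambda>c. (\<Sum>Z\<in>points_in Y. x Z) = of_nat p ^ i * c"]
        by (auto simp: incidence_def fscale_def h_def dvd_def)
    qed
    ultimately show "incidence r x \<in> fscale (of_nat p ^ i) ` funs_on (subspaces_dim r)"
      by blast
  qed
  thus ?thesis by (auto simp: snf_filtration_def Mfil_def)
qed

lemma snf_filtration_bar_eq: "snf_filtration_bar res p points (subspaces_dim r) (incidence r) i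
    = Mbar r i"
  by (simp add: snf_filtration_bar_def snf_filtration_eq Mbar_def)

lemma Mfil_zero: "(\<lambda>Z. 0) \<in> Mfil r i" by (auto simp: Mfil_def funs_on_def)
lemma Mfil_add: "x \<in> Mfil r i \<Longrightarrow> y \<in> Mfil r i \<Longrightarrow> (\<lambda>Z. x Z + y Z) \<in> Mfil r i"
  by (auto simp: Mfil_def funs_on_def sum.distrib)
lemma Mfil_scale: "x \<in> Mfil r i \<Longrightarrow> (\<lambda>Z. c * x Z) \<in> Mfil r i"
  by (auto simp: Mfil_def funs_on_def simp flip: sum_distrib_left)
lemma Mfil_diff: "x \<in> Mfil r i \<Longrightarrow> y \<in> Mfil r i \<Longrightarrow> (\<lambda>Z. x Z - y Z) \<in> Mfil r i"
  by (auto simp: Mfil_def funs_on_def sum_subtractf)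
lemma Mfil_sum: "(\<And>e. e \<in> I \<Longrightarrow> x e \<in> Mfil r i) \<Longrightarrow> (\<lambda>Z. \<Sum>e\<in>I. x e Z) \<in> Mfil r i"
  by (induction I rule: infinite_finite_induct) (auto intro: Mfil_zero Mfil_add)
lemma Mfil_mono: "i \<le> j \<Longrightarrow> Mfil r j \<subseteq> Mfil r i"
  unfolding Mfil_def using le_imp_power_dvd dvd_trans by blast
text \<open>Serves to divide by a Jacobi sum: its power of p lowers the level, and its cofactor of
  nonzero residue is removed by \<open>power_p_dvd_cancel\<close>.\<close>

lemma Mfil_cancel:
  assumes "res u \<noteq> 0" "(\<lambda>Z. of_nat p ^ j * u * x Z) \<in> Mfil r (j + i)"
  shows "x \<in> Mfil r i"
proof -
  have nz: "of_nat p ^ j * u \<noteq> 0" using assms(1) p_nz by auto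
  have "x Z = 0" if "Z \<notin> points" for Z
    using assms(2) nz that by (auto simp: Mfil_def funs_on_def)
  moreover have "of_nat p ^ i dvd (\<Sum>Z\<in>points_in Y. x Z)" if Y: "Y \<in> subspaces_dim r" for Y
  proof -
    have "of_nat p ^ (j + i) dvd (\<Sum>Z\<in>points_in Y. of_nat p ^ j * u * x Z)"
      using assms(2) Y by (auto simp: Mfil_def)
    hence "of_nat p ^ j * of_nat p ^ i dvd of_nat p ^ j * (u * (\<Sum>Z\<in>points_in Y. x Z))"
      by (simp add: power_add mult.assoc flip: sum_distrib_left)
    hence "of_nat p ^ i dvd u * (\<Sum>Z\<in>points_in Y. x Z)"
      using p_nz unfolding dvd_mult_cancel_left by simp
    thus ?thesis using power_p_dvd_cancel assms(1) by blast
  qed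
  ultimately show ?thesis by (auto simp: Mfil_def funs_on_def)
qed

lemma Mbar_mono: "i \<le> j \<Longrightarrow> Mbar r j \<subseteq> Mbar r i"
  unfolding Mbar_def using Mfil_mono by blast
lemma Mbar_add: "x \<in> Mbar r i \<Longrightarrow> y \<in> Mbar r i \<Longrightarrow> (\<lambda>Z. x Z + y Z) \<in> Mbar r i"
proof -
  assume "x \<in> Mbar r i" "y \<in> Mbar r i"
  then obtain x' y' where "x' \<in> Mfil r i" "y' \<in> Mfil r i" "x = res \<circ> x'" "y = res \<circ> y'"
      by (auto simp: Mbar_def)
  thus ?thesis unfolding Mbar_def by (intro image_eqI[OF _ Mfil_add[of x' r i y']]) auto
qed
lemma Mbar_scale: "x \<in> Mbar r i \<Longrightarrow> (\<lambda>Z. c * x Z) \<in> Mbar r i"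
proof -
  assume "x \<in> Mbar r i"
  then obtain x' where "x' \<in> Mfil r i" "x = res \<circ> x'" by (auto simp: Mbar_def)
  thus ?thesis unfolding Mbar_def by (intro image_eqI[OF _ Mfil_scale[of x' r i "T c"]]) auto
qed
lemma Mbar_zero: "(\<lambda>Z. 0) \<in> Mbar r i"
  unfolding Mbar_def by (rule image_eqI[OF _ Mfil_zero]) auto
lemma Mbar_sum: "(\<And>e. e \<in> I \<Longrightarrow> x e \<in> Mbar r i) \<Longrightarrow> (\<lambda>Z. \<Sum>e\<in>I. x e Z) \<in> Mbar r i"
  by (induction I rule: infinite_finite_induct) (auto intro: Mbar_zero Mbar_add)
lemma Mbar_diff: "x \<in> Mbar r i \<Longrightarrow> y \<in> Mbar r i \<Longrightarrow> (\<lambda>Z. x Z - y Z) \<in> Mbar r i"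
  using Mbar_add[OF _ Mbar_scale[of y r i "-1"], of x] by simp

abbreviation mon :: "('n::finite \<Rightarrow> nat) \<Rightarrow> ('k ^ 'n) set \<Rightarrow> 'k" where
  "mon \<equiv> point_monomial (\<lambda>x. x)"
abbreviation Tmon :: "('n::finite \<Rightarrow> nat) \<Rightarrow> ('k ^ 'n) set \<Rightarrow> 'r" where
  "Tmon \<equiv> point_monomial T"

lemma res_Tmon: "res \<circ> Tmon b = mon b"
  by (auto simp: point_monomial_def Let_def res_prod)

lemma Tmon_span: "a \<noteq> 0 \<Longrightarrow> b \<in> exponents q \<Longrightarrow> Tmon b (vec.span {a}) = (\<Prod>i\<in>UNIV. T (a $ i) ^ b i)"
  by (intro point_monomial_span) (auto simp: teich_mult q_card)

lemma mon_span: "a \<noteq> 0 \<Longrightarrow> b \<in> exponents q \<Longrightarrow> mon b (vec.span {a}) = (\<Prod>i\<in>UNIV. (a $ i) ^ b i)"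
  by (intro point_monomial_span) (auto simp: q_card)

lemma Tmon_funs_on: "Tmon b \<in> funs_on points" by (auto simp: funs_on_def point_monomial_def)

text \<open>Evaluate at the vector with one coordinate x and all others 1; a second coordinate keeps
  it nonzero even for x = 0. The value at x = 0 detects a zero exponent, and a generator x
  determines the exponent modulo q - 1.\<close>

lemma mon_inj:
  assumes card: "CARD('n::finite) \<ge> 2"
  shows "inj_on (mon :: ('n \<Rightarrow> nat) \<Rightarrow> _) (exponents q)"
proof (rule inj_onI, rule ext)
  fix b b' :: "'n \<Rightarrow> nat" and i0
  assume b: "b \<in> exponents q" "b' \<in> exponents q" and eq: "mon b = mon b'"
  have ev: "(\<Prod>i\<in>UNIV. (if i = i0 then x else 1) ^ b i) = (x::'k) ^ b i0" for x and b :: "'n \<Rightarrow> nat"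
    by (simp add: if_distrib[of "\<lambda>x. x ^ _"] prod.delta cong: if_cong)
  have same: "x ^ b i0 = x ^ b' i0" for x :: 'k
  proof -
    define a :: "'k ^ 'n" where "a = (\<chi> i. if i = i0 then x else 1)"
    obtain i1 where "i1 \<noteq> i0"
    proof (rule ccontr)
      assume "\<not> thesis"
      hence "(UNIV :: 'n set) \<subseteq> {i0}" using that by blast
      from card_mono[OF _ this] card show False by simp
    qed
    hence "a $ i1 = 1" by (simp add: a_def)
    hence "a \<noteq> 0" by auto
    from arg_cong[OF eq, of "\<lambda>f. f (vec.span {a})"] show ?thesis
      unfolding mon_span[OF \<open>a \<noteq> 0\<close> b(1)] mon_span[OF \<open>a \<noteq> 0\<close> b(2)] by (simp add: a_def ev)
  qed
  have le: "b i0 \<le> q - 1" "b' i0 \<le> q - 1" using b by (auto simp: exponents_def)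
  show "b i0 = b' i0"
  proof (cases "b i0 = 0 \<or> b' i0 = 0")
    case True
    thus ?thesis using same[of 0] by (auto simp: power_0_left split: if_splits)
  next
    case False
    obtain g where g: "g \<noteq> 0" "\<And>N. T g ^ N = 1 \<longleftrightarrow> (q - 1) dvd N" using teich_power_eq_1_iff by blast
    have "T g ^ b i0 = T g ^ b' i0" using same[of g] by (metis teich_power)
    hence *: "T g ^ (max (b i0) (b' i0) - min (b i0) (b' i0)) * T g ^ min (b i0) (b' i0)
        = T g ^ min (b i0) (b' i0)"
      by (auto simp: max_def min_def simp flip: power_add)
    have "(q - 1) dvd (max (b i0) (b' i0) - min (b i0) (b' i0))" using * g by simp
    moreover have "max (b i0) (b' i0) - min (b i0) (b' i0) < q - 1" using le False by auto
    ultimately have "max (b i0) (b' i0) - min (b i0) (b' i0) = 0" using nat_dvd_not_less by blast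
    thus ?thesis by (auto simp: max_def min_def split: if_splits)
  qed
qed

end

section \<open>Transvections and Smith normal form bases\<close>

lemma sum_indicator_mult:
  "finite B \<Longrightarrow> e \<in> B \<Longrightarrow> (\<Sum>f\<in>B. (if f = e then 1 else 0) * g f) = (g e :: 'a::semiring_1)"
  by (simp add: if_distrib[of "\<lambda>x. x * _"] cong: if_cong)

context unram
begin

text \<open>Coordinates on \<open>Y\<close> reduce this to \<open>sum_monomial_dvd\<close>. Because
  the monomial is not constant it vanishes at the zero vector, so the sum over all coordinates is q
  - 1 times the sum over points.\<close>

lemma Tmon_lower:
  fixes D :: "'n::finite \<Rightarrow> nat \<Rightarrow> nat"
  assumes b: "b \<in> exponents q" "b = (\<lambda>i. \<Sum>l<t. D i l * p ^ l)" "b \<noteq> (\<lambda>i. 0)"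
    and s: "\<And>j. j < t \<Longrightarrow> (\<Sum>i\<in>UNIV. \<Sum>l<t. D i l * wt j l) = (q - 1) * s j"
  shows "Tmon b \<in> Mfil r (\<Sum>j<t. r - s j)"
proof -
  have "of_nat p ^ (\<Sum>j<t. r - s j) dvd (\<Sum>Z\<in>points_in Y. Tmon b Z)" if Y: "Y \<in> subspaces_dim r" for Y
  proof -
    define F where "F a = (\<Prod>i\<in>UNIV. T (a $ i) ^ b i)" for a :: "'k ^ 'n"
    obtain i0 where "b i0 \<noteq> 0" using b(3) by auto
    hence F0: "F 0 = 0" unfolding F_def by (intro prod_zero) auto
    obtain K where K: "finite K" "card K = r" "bij_betw (\<lambda>y. \<Sum>k\<in>K. y k *s k) (PiE K (\<lambda>_. UNIV)) Y"
      using subspace_coordinates[OF Y] .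
    have "of_nat p ^ (\<Sum>j<t. r - s j) dvd (\<Sum>y\<in>PiE K (\<lambda>_. UNIV). F (\<Sum>k\<in>K. y k *s k))"
      using sum_monomial_dvd[OF K(1) s, of vec_nth] K(2) by (simp add: F_def b(2))
    also have "(\<Sum>y\<in>PiE K (\<lambda>_. UNIV). F (\<Sum>k\<in>K. y k *s k)) = (\<Sum>a\<in>Y. F a)"
      using K(3) by (rule sum.reindex_bij_betw)
    also have "\<dots> = (\<Sum>a\<in>Y - {0}. F a)" using F0 by (intro sum.mono_neutral_right) auto
    also have "\<dots> = of_nat (q - 1) * (\<Sum>Z\<in>points_in Y. Tmon b Z)"
      unfolding q_card using Y by (intro sum_over_points) (auto simp: F_def Tmon_span b(1)
          subspaces_dim_def simp flip: q_card)
    finally have "of_nat p ^ (\<Sum>j<t. r - s j) dvd of_nat (q - 1) * (\<Sum>Z\<in>points_in Y. Tmon b Z)" .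
    moreover have "res (of_nat (q - 1)) \<noteq> 0" unfolding res_of_nat of_nat_q1_k by simp
    ultimately show ?thesis by (rule power_p_dvd_cancel[rotated])
  qed
  thus ?thesis using Tmon_funs_on by (auto simp: Mfil_def)
qed

text \<open>An elementary transvection when a and c differ. Such maps permute the points and the
  r-dimensional subspaces, hence preserve the filtration.\<close>

definition shear :: "'n \<Rightarrow> 'n \<Rightarrow> 'k \<Rightarrow> 'k ^ 'n \<Rightarrow> 'k ^ 'n::finite" where
  "shear a c u v = (\<chi> i. if i = a then v $ a + u * v $ c else v $ i)"

lemma shear_nth: "shear a c u v $ i = (if i = a then v $ a + u * v $ c else v $ i)"
  by (simp add: shear_def)

lemma linear_shear: "Vector_Spaces.linear (*s) (*s) (shear a c u)"
  by unfold_locales (auto simp: vec_eq_iff shear_nth algebra_simps)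

lemma shear_inverse: "a \<noteq> c \<Longrightarrow> shear a c (- u) (shear a c u v) = v"
  by (auto simp: vec_eq_iff shear_nth)

lemma inj_shear: "a \<noteq> c \<Longrightarrow> inj (shear a c u)"
  by (metis injI shear_inverse)

lemma shear_subspaces_dim: "a \<noteq> c \<Longrightarrow> Y \<in> subspaces_dim k \<Longrightarrow> shear a c u ` Y \<in> subspaces_dim k"
  by (auto simp: subspaces_dim_def intro!: vec.linear_subspace_image linear_shear)
    (simp add: vec.dim_image_eq linear_shear inj_on_subset[OF inj_shear])

lemma shear_image_inverse: "a \<noteq> c \<Longrightarrow> shear a c (- u) ` shear a c u ` Y = Y"
  by (simp add: image_image shear_inverse)

lemma shear_nz: "a \<noteq> c \<Longrightarrow> v \<noteq> 0 \<Longrightarrow> shear a c u v \<noteq> 0"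
  by (metis shear_inverse vec.linear_0 linear_shear)

lemma shear_span: "shear a c u ` vec.span {v} = vec.span {shear a c u v}"
  using vec.linear_span_image[OF linear_shear, of a c u "{v}"] by simp

text \<open>The points of \<open>Y\<close> are carried bijectively to those of its image, which is
  again an r-dimensional subspace.\<close>

lemma Mfil_shear:
  assumes ac: "a \<noteq> c" and x: "x \<in> Mfil r i"
  shows "(\<lambda>Z. if Z \<in> points then x (shear a c u ` Z) else 0) \<in> Mfil r i"
proof -
  have "of_nat p ^ i dvd (\<Sum>Z\<in>points_in Y. x (shear a c u ` Z))" if Y: "Y \<in> subspaces_dim r" for Y
  proof -
    have "(\<Sum>Z\<in>points_in Y. x (shear a c u ` Z)) = (\<Sum>Z\<in>points_in (shear a c u ` Y). x Z)"
    proof (rule sum.reindex_bij_witness[of _ "\<lambda>Z. shear a c (- u) ` Z" "\<lambda>Z. shear a c u ` Z"])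
      fix Z assume Z: "Z \<in> points_in (shear a c u ` Y)"
      show "shear a c u ` shear a c (- u) ` Z = Z" using shear_image_inverse[OF ac, of "-u"] by simp
      have "shear a c (- u) ` Z \<subseteq> shear a c (- u) ` shear a c u ` Y" using Z by blast
      thus "shear a c (- u) ` Z \<in> points_in Y"
          using Z shear_subspaces_dim[OF ac] shear_image_inverse[OF ac] by auto
    qed (use shear_image_inverse[OF ac] shear_subspaces_dim[OF ac] in auto)
    moreover have "shear a c u ` Y \<in> subspaces_dim r" using shear_subspaces_dim[OF ac Y] .
    ultimately show ?thesis using x by (auto simp: Mfil_def)
  qed
  thus ?thesis by (auto simp: Mfil_def funs_on_def)
qed

lemma Mbar_shear:
  assumes ac: "a \<noteq> c" and x: "x \<in> Mbar r i"
  shows "(\<lambda>Z. if Z \<in> points then x (shear a c u ` Z) else 0) \<in> Mbar r i"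
proof -
  obtain x' where "x' \<in> Mfil r i" "x = res \<circ> x'" using x by (auto simp: Mbar_def)
  thus ?thesis unfolding Mbar_def by (intro image_eqI[OF _ Mfil_shear[OF ac, of x' r i u]]) auto
qed

end

section \<open>Levels of basis elements and of monomials\<close>

locale incidence_snf = unram p t q emb \<xi> res
  for p t q :: nat and emb :: "(nat \<Rightarrow> int) \<Rightarrow> 'r::idom" and \<xi> :: 'r
    and res :: "'r \<Rightarrow> 'k::finite_field" +
  fixes r n :: nat and Bs :: "nat \<Rightarrow> (('k ^ 'n::finite) set \<Rightarrow> 'r) set" and B :: "(('k ^ 'n) set \<Rightarrow> 'r) set"
  assumes q_gt_2: "q > 2"
    and card_n: "CARD('n) = n + 1" and r_ge: "1 \<le> r" and r_le: "r \<le> n"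
    and snf: "snf_basis res p (subspaces_dim 1) (subspaces_dim r) (incidence r) Bs B"
    and reduction: "(\<lambda>f. res \<circ> f) ` B = monomials"
    and lifts: "b \<in> exponents q \<Longrightarrow> \<exists>i. 0 < b i \<and> b i < q - 1 \<Longrightarrow> point_monomial (teichmueller res) b \<in> B"
begin

definition L :: nat where
  "L = snf_length res p (subspaces_dim 1 :: ('k ^ 'n) set set) (subspaces_dim r) (incidence r)"

lemma B_eq: "B = (\<Union>i<L. Bs i)"
  and Bs_Mfil: "i < L \<Longrightarrow> Bs i \<subseteq> Mfil r i"
  and Bs_finite: "i < L \<Longrightarrow> finite (Bs i)"
  and Bs_Mbar: "i < L \<Longrightarrow> e \<in> Bs i \<Longrightarrow> res \<circ> e \<in> Mbar r i"
  and Bs_indep: "i < L \<Longrightarrow> (\<lambda>Z. \<Sum>e\<in>Bs i. c e * res (e Z)) \<in> Mbar r (Suc i) \<Longrightarrow> e \<in> Bs i \<Longrightarrow> c e = 0"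
proof -
  show "B = (\<Union>i<L. Bs i)"
    using snf by (auto simp: snf_basis_def L_def)
  { assume i: "i < L"
    have *: "Bs i \<subseteq> Mfil r i" "maps_onto_quotient_basis (\<lambda>f. res \<circ> f) (Bs i) (Mbar r i) (Mbar r (Suc i))"
      using snf i by (auto simp: snf_basis_def snf_filtration_eq snf_filtration_bar_eq L_def)
    thus "Bs i \<subseteq> Mfil r i" by blast
    from * show "finite (Bs i)" by (simp add: maps_onto_quotient_basis_def)
    from * show "res \<circ> e \<in> Mbar r i" if "e \<in> Bs i" using that
        by (auto simp: maps_onto_quotient_basis_def)
    assume c: "(\<lambda>Z. \<Sum>e\<in>Bs i. c e * res (e Z)) \<in> Mbar r (Suc i)" and e: "e \<in> Bs i"
    have "(\<Sum>e\<in>Bs i. fscale (c e) (res \<circ> e)) = (\<lambda>Z. \<Sum>e\<in>Bs i. c e * res (e Z))"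
      by (rule ext) (simp add: sum_fun_apply fscale_def)
    moreover have "(\<Sum>e\<in>Bs i. fscale (c e) (res \<circ> e)) \<in> Mbar r (Suc i) \<longrightarrow> (\<forall>e\<in>Bs i. c e = 0)"
      using *(2) unfolding maps_onto_quotient_basis_def by blast
    ultimately show "c e = 0" using c e by simp }
qed

lemma B_finite: "finite B" unfolding B_eq using Bs_finite by auto

text \<open>Induction on i. Below level i the coefficients vanish by hypothesis, and above it the
  terms lie in \<open>Mbar r (Suc i)\<close> anyway. So the part of level i lies in
  \<open>Mbar r (Suc i)\<close>, and independence modulo that space kills its coefficients.\<close>

lemma B_coeff_zero:
  assumes "i \<le> L" "(\<lambda>Z. \<Sum>e\<in>B. c e * res (e Z)) \<in> Mbar r i" "j < i" "e \<in> Bs j"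
  shows "c e = 0"
  using assms
proof (induction i arbitrary: e j)
  case (Suc i)
  have IH: "c e = 0" if "e \<in> Bs j" "j < i" for e j
    using Suc.IH[OF _ _ that(2,1)] Suc.prems(1,2) Mbar_mono[of i "Suc i" r] by auto
  have i: "i < L" using Suc.prems by simp
  have sub: "Bs i \<subseteq> B" using i B_eq by auto
  have "(\<lambda>Z. \<Sum>e\<in>B - Bs i. c e * res (e Z)) \<in> Mbar r (Suc i)"
  proof (rule Mbar_sum)
    fix e assume e: "e \<in> B - Bs i"
    then obtain j where j: "j < L" "e \<in> Bs j" "j \<noteq> i" using B_eq by auto
    show "(\<lambda>Z. c e * res (e Z)) \<in> Mbar r (Suc i)"
    proof (cases "j < i")
      case True
      thus ?thesis using IH[OF j(2)] Mbar_zero by simp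
    next
      case False
      hence "res \<circ> e \<in> Mbar r (Suc i)" using Bs_Mbar[OF j(1,2)] Mbar_mono[of "Suc i" j r] j(3) by auto
      from Mbar_scale[OF this] show ?thesis by simp
    qed
  qed
  from Mbar_diff[OF Suc.prems(2) this]
  have "(\<lambda>Z. \<Sum>e\<in>Bs i. c e * res (e Z)) \<in> Mbar r (Suc i)"
    using sub B_finite by (simp add: sum_diff finite_subset)
  from Bs_indep[OF i this] IH Suc.prems(3,4) show ?case by (cases "j = i") auto
qed simp

lemma B_coeff:
  assumes "(\<lambda>Z. \<Sum>e\<in>B. c e * res (e Z)) \<in> Mbar r i" "c e \<noteq> 0" "e \<in> Bs j" "j < L"
  shows "i \<le> j"
proof (rule ccontr)
  assume "\<not> i \<le> j"
  show False
  proof (cases "i \<le> L")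
    case True
    thus False using B_coeff_zero[OF True assms(1) _ assms(3)] assms(2) \<open>\<not> i \<le> j\<close> by auto
  next
    case False
    hence "(\<lambda>Z. \<Sum>e\<in>B. c e * res (e Z)) \<in> Mbar r L" using assms(1) Mbar_mono[of L i r] by auto
    thus False using B_coeff_zero[OF order_refl _ assms(4,3)] assms(2) by blast
  qed
qed

text \<open>Together with \<open>Bs_Mbar\<close> this identifies the level of a basis element with
  the largest i such that \<open>Mbar r i\<close> contains its reduction; the level depends on the
  reduction alone.\<close>

lemma Bs_level:
  assumes "e \<in> Bs j" "j < L" "res \<circ> e \<in> Mbar r i"
  shows "i \<le> j"
proof -
  have "e \<in> B" using assms B_eq by auto
  hence "res \<circ> e = (\<lambda>Z. \<Sum>e'\<in>B. (if e' = e then 1 else 0) * res (e' Z))"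
    using B_finite by (intro ext) (simp add: sum_indicator_mult)
  thus ?thesis using B_coeff[of "\<lambda>e'. if e' = e then 1 else 0" i e j] assms by simp
qed

lemma res_inj_B: "inj_on (\<lambda>e. res \<circ> e) B"
proof (rule inj_onI, rule ccontr)
  fix e e' assume ee: "e \<in> B" "e' \<in> B" "res \<circ> e = res \<circ> e'" "e \<noteq> e'"
  obtain j where j: "e \<in> Bs j" "j < L" using ee B_eq by auto
  define c where "c = (\<lambda>f. (if f = e then 1 else 0) - (if f = e' then 1 else (0::'k)))"
  have "(\<Sum>f\<in>B. c f * res (f Z)) = 0" for Z
  proof -
    have "(\<Sum>f\<in>B. c f * res (f Z)) = res (e Z) - res (e' Z)"
      using ee B_finite by (simp add: c_def left_diff_distrib sum_subtractf sum_indicator_mult)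
    thus ?thesis using fun_cong[OF ee(3), of Z] by simp
  qed
  \<comment> \<open>Zero lies in every \<open>Mbar\<close>, so the nonzero coefficient at level j
    would give j + 1 \<le> j.\<close>
  hence "(\<lambda>Z. \<Sum>f\<in>B. c f * res (f Z)) \<in> Mbar r (Suc j)" using Mbar_zero by simp
  moreover have "c e \<noteq> 0" using ee by (simp add: c_def)
  ultimately show False using B_coeff j by fastforce
qed

lemma mon_inj_n: "inj_on (mon :: ('n \<Rightarrow> nat) \<Rightarrow> _) (exponents q)"
  by (rule mon_inj) (use card_n r_ge r_le in auto)

definition basis_elem :: "('n \<Rightarrow> nat) \<Rightarrow> ('k ^ 'n) set \<Rightarrow> 'r" where
  "basis_elem b = (THE e. e \<in> B \<and> res \<circ> e = mon b)"

lemma basis_elem: "b \<in> exponents q \<Longrightarrow> basis_elem b \<in> B \<and> res \<circ> basis_elem b = mon b"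
proof -
  assume "b \<in> exponents q"
  hence "mon b \<in> (\<lambda>f. res \<circ> f) ` B" unfolding reduction monomials_def q_card by blast
  then obtain e where "e \<in> B" "res \<circ> e = mon b" by auto
  hence "\<exists>!e. e \<in> B \<and> res \<circ> e = mon b" using res_inj_B by (auto simp: inj_on_def)
  thus ?thesis unfolding basis_elem_def by (rule theI')
qed

lemma basis_elem_eqI: "b \<in> exponents q \<Longrightarrow> e \<in> B \<Longrightarrow> res \<circ> e = mon b \<Longrightarrow> basis_elem b = e"
  using basis_elem[of b] res_inj_B by (auto simp: inj_on_def)

lemma bij_basis_elem: "bij_betw basis_elem (exponents q) B"
proof (rule bij_betwI')
  fix b b' :: "'n \<Rightarrow> nat" assume "b \<in> exponents q" "b' \<in> exponents q"
  thus "basis_elem b = basis_elem b' \<longleftrightarrow> b = b'" using basis_elem mon_inj_n by (metis inj_onD)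
next
  fix e assume e: "e \<in> B"
  hence "res \<circ> e \<in> monomials" using reduction by blast
  then obtain b where "b \<in> exponents q" "res \<circ> e = mon b" unfolding monomials_def q_card by blast
  thus "\<exists>b\<in>exponents q. e = basis_elem b" using basis_elem_eqI e by metis
qed (use basis_elem in auto)

lemma finite_exponents: "finite (exponents q :: ('n \<Rightarrow> nat) set)"
  using bij_basis_elem B_finite bij_betw_finite by blast

definition H :: "nat \<Rightarrow> ('n \<Rightarrow> nat) set" where
  "H i = {b \<in> exponents q. mon b \<in> Mbar r i}"

text \<open>Since \<open>B\<close> reduces to the monomials, \<open>B_coeff\<close> says that each
  monomial occurring in an element of \<open>Mbar r i\<close> lies there itself. This turns
  invariance under transvections into combinatorics of exponents.\<close>

lemma Mbar_coeff_H:
  assumes "(\<lambda>Z. \<Sum>b\<in>exponents q. c b * mon b Z) \<in> Mbar r i" "b \<in> exponents q" "c b \<noteq> 0"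
  shows "b \<in> H i"
proof -
  have "(\<Sum>b\<in>exponents q. c b * mon b Z) = (\<Sum>b\<in>exponents q. c b * res (basis_elem b Z))" for Z
    by (intro sum.cong refl arg_cong2[of _ _ _ _ "(*)"]) (metis comp_apply basis_elem)
  also have "\<dots> Z = (\<Sum>b\<in>exponents q. c (inv_into (exponents q) basis_elem (basis_elem b)) * res
      (basis_elem b Z))" for Z
    using bij_basis_elem by (intro sum.cong refl) (simp add: bij_betw_def)
  also have "\<dots> Z = (\<Sum>e\<in>B. c (inv_into (exponents q) basis_elem e) * res (e Z))" for Z
    using bij_basis_elem by (rule sum.reindex_bij_betw)
  finally have *: "(\<lambda>Z. \<Sum>e\<in>B. c (inv_into (exponents q) basis_elem e) * res (e Z)) \<in> Mbar r i"
    using assms(1) by simp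
  obtain j where j: "j < L" "basis_elem b \<in> Bs j" using basis_elem[OF assms(2)] B_eq by auto
  have "i \<le> j"
    using bij_basis_elem assms(2,3) by (intro B_coeff[OF * _ j(2,1)]) (simp add: bij_betw_def)
  hence "mon b \<in> Mbar r i" using Bs_Mbar[OF j] basis_elem[OF assms(2)] Mbar_mono[of i j r] by auto
  thus ?thesis using assms(2) by (simp add: H_def)
qed

text \<open>Membership of \<open>mon b\<close> in \<open>Mbar r i\<close> only says that some lift
  lies in \<open>Mfil r i\<close>. Here the Teichmueller lift belongs to \<open>B\<close>, and its
  level shows that this particular lift does.\<close>

lemma H_lift:
  assumes "b \<in> H i" "\<exists>i. 0 < b i \<and> b i < q - 1"
  shows "Tmon b \<in> Mfil r i"
proof -
  have b: "b \<in> exponents q" "mon b \<in> Mbar r i" using assms(1) by (auto simp: H_def)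
  have "Tmon b \<in> B" using lifts[OF b(1) assms(2)] .
  then obtain j where j: "j < L" "Tmon b \<in> Bs j" using B_eq by auto
  have "i \<le> j" using Bs_level[OF j(2,1)] b(2) by (simp add: res_Tmon)
  thus ?thesis using Bs_Mfil[OF j(1)] j(2) Mfil_mono[of i j r] by blast
qed

lemma H_mono: "i \<le> j \<Longrightarrow> H j \<subseteq> H i" using Mbar_mono by (auto simp: H_def)

end

section \<open>Binomial coefficients and digits\<close>

lemma prime_dvd_choose_power:
  assumes "prime p" "0 < k" "k < p ^ l"
  shows "p dvd (p ^ l choose k)"
proof (rule ccontr)
  assume n: "\<not> p dvd (p ^ l choose k)"
  have "k * (p ^ l choose k) = p ^ l * (p ^ l - 1 choose (k - 1))"
    using assms times_binomial_minus1_eq[of k "p ^ l"] by simp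
  hence "p ^ l dvd k * (p ^ l choose k)" by simp
  moreover have "coprime (p ^ l) (p ^ l choose k)"
    using n assms(1) by (simp add: prime_imp_coprime)
  ultimately have "p ^ l dvd k" by (simp add: coprime_dvd_mult_left_iff)
  thus False using assms by (meson dvd_imp_le not_less)
qed

lemma prime_dvd_choose_mult:
  assumes "prime p" "0 < k" "k < p"
  shows "p dvd (p * m choose k)"
proof -
  have "k * (p * m choose k) = p * m * (p * m - 1 choose (k - 1))"
    using assms times_binomial_minus1_eq[of k "p * m"] by simp
  hence "p dvd k * (p * m choose k)" by simp
  thus ?thesis using assms by (meson dvd_imp_le leD prime_dvd_mult_iff)
qed

lemma choose_prime_power_add:
  assumes "prime p"
  shows "[N + p ^ l choose p ^ l = (N choose p ^ l) + 1] (mod p)"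
proof -
  have P: "p ^ l > 0" using assms prime_gt_0_nat by auto
  have "(N + p ^ l choose p ^ l) = (\<Sum>k\<le>p ^ l. (p ^ l choose k) * (N choose (p ^ l - k)))"
    using vandermonde[of "p ^ l" N "p ^ l"] by (simp add: add.commute)
  also have "{..p ^ l} = insert 0 (insert (p ^ l) {0<..<p ^ l})" using P by auto
  also have "(\<Sum>k\<in>insert 0 (insert (p ^ l) {0<..<p ^ l}). (p ^ l choose k) * (N choose (p ^ l - k)))
     = (N choose p ^ l) + (1 + (\<Sum>k\<in>{0<..<p ^ l}. (p ^ l choose k) * (N choose (p ^ l - k))))"
    using P by simp
  finally have eq: "(N + p ^ l choose p ^ l) = (N choose p ^ l) + (1 + (\<Sum>k\<in>{0<..<p ^ l}. (p ^ l
      choose k) * (N choose (p ^ l - k))))" .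
  have "p dvd (\<Sum>k\<in>{0<..<p ^ l}. (p ^ l choose k) * (N choose (p ^ l - k)))"
    using prime_dvd_choose_power[OF assms] by (intro dvd_sum dvd_mult2) auto
  thus ?thesis unfolding eq cong_def by (auto elim!: dvdE simp flip: add.assoc)
qed

text \<open>A case of Lucas's theorem: modulo p this is the digit l of N. Adding p^l to N raises
  both sides by one.\<close>

lemma choose_prime_power:
  assumes "prime p"
  shows "[N choose p ^ l = N div p ^ l] (mod p)"
proof (induction N rule: less_induct)
  case (less N)
  have P: "p ^ l > 0" using assms prime_gt_0_nat by auto
  show ?case
  proof (cases "N < p ^ l")
    case False
    define M where "M = N - p ^ l"
    have M: "N = M + p ^ l" using False by (simp add: M_def)
    have "[N choose p ^ l = (M choose p ^ l) + 1] (mod p)"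
      unfolding M by (rule choose_prime_power_add[OF assms])
    also have "[(M choose p ^ l) + 1 = M div p ^ l + 1] (mod p)"
      using less.IH[of M] M P by (intro cong_add cong_refl) auto
    also have "M div p ^ l + 1 = N div p ^ l" using P by (simp add: M)
    finally show ?thesis .
  qed (simp add: binomial_eq_0)
qed

text \<open>Another case of Lucas's theorem: in Vandermonde's convolution all terms but one are
  divisible by p.\<close>

lemma choose_less_prime:
  assumes "prime p" "k < p"
  shows "[p * m + s choose k = s choose k] (mod p)"
proof -
  have "(p * m + s choose k) = (\<Sum>i\<le>k. (p * m choose i) * (s choose (k - i)))"
    by (simp add: vandermonde)
  also have "{..k} = insert 0 {0<..k}" by auto
  finally have eq: "(p * m + s choose k) = (s choose k) + (\<Sum>i\<in>{0<..k}. (p * m choose i) * (s choose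
      (k - i)))"
    by simp
  have "p dvd (\<Sum>i\<in>{0<..k}. (p * m choose i) * (s choose (k - i)))"
    using prime_dvd_choose_mult[OF assms(1)] assms(2) by (intro dvd_sum dvd_mult2) auto
  thus ?thesis unfolding eq cong_def by (auto elim!: dvdE)
qed

text \<open>The absorption identity expresses (p - 1) times the coefficient as p * m times the
  binomial coefficient of p * m - 1 over p - 2, which is p - 1 modulo p. So p divides exactly once;
  this is the source of the valuation one of the Jacobi sum.\<close>

lemma choose_p_minus_1:
  assumes "prime p" "\<not> p dvd m"
  obtains c where "(p * m choose (p - 1)) = p * c" "\<not> p dvd c"
proof -
  have p2: "p \<ge> 2" and m: "m > 0" using assms prime_ge_2_nat by (auto intro: gr0I)
  have "(p - 1) * (p * m choose (p - 1)) = p * m * (p * m - 1 choose (p - 1 - 1))"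
    using p2 m by (intro times_binomial_minus1_eq) auto
  hence eq: "(p - 1) * (p * m choose (p - 1)) = p * (m * (p * m - 1 choose (p - 2)))"
    by (simp add: numeral_2_eq_2)
  have np: "\<not> p dvd p - 1" using p2 by (auto dest: dvd_imp_le)
  have "p dvd (p - 1) * (p * m choose (p - 1))" using eq by simp
  hence "p dvd (p * m choose (p - 1))" using np assms(1) prime_dvd_mult_iff by blast
  then obtain c where c: "(p * m choose (p - 1)) = p * c" ..
  have "p * ((p - 1) * c) = p * (m * (p * m - 1 choose (p - 2)))" using eq c by (simp add: ac_simps)
  hence c2: "(p - 1) * c = m * (p * m - 1 choose (p - 2))" using p2 by simp
  have "p * m - 1 = p * (m - 1) + (p - 1)" using m p2 by (cases m) auto
  hence "[p * m - 1 choose (p - 2) = p - 1 choose (p - 2)] (mod p)"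
    using choose_less_prime[OF assms(1), of "p - 2" "m - 1" "p - 1"] p2 by simp
  moreover have "p - 1 choose (p - 2) = p - 1"
  proof -
    have "p - 1 choose 1 = p - 1 choose (p - 1 - 1)" using p2 by (intro binomial_symmetric) simp
    moreover have "p - 1 - 1 = p - 2" using p2 by simp
    ultimately show ?thesis by (metis choose_one)
  qed
  ultimately have "\<not> p dvd (p * m - 1 choose (p - 2))" using np cong_dvd_iff by metis
  hence "\<not> p dvd (p - 1) * c" unfolding c2 using assms prime_dvd_mult_iff by blast
  hence "\<not> p dvd c" by auto
  thus ?thesis using that c by blast
qed

lemma sum_digits_upper:
  fixes f :: "nat \<Rightarrow> nat"
  assumes "\<forall>l<t. f l \<le> p - 1" "0 < p"
  shows "(\<Sum>l<t. f l * p ^ l) < p ^ t"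
  using assms(1)
proof (induction t)
  case (Suc t)
  have "(\<Sum>l<Suc t. f l * p ^ l) < p ^ t + (p - 1) * p ^ t"
    using Suc by (auto intro!: add_less_le_mono)
  also have "\<dots> = p ^ Suc t" using assms(2) by (cases p) auto
  finally show ?case .
qed simp

lemma sum_digits_div_mod:
  fixes f :: "nat \<Rightarrow> nat"
  assumes "\<forall>l<t. f l \<le> p - 1" "0 < p" "m < t"
  shows "(\<Sum>l<t. f l * p ^ l) div p ^ m mod p = f m"
proof -
  have "{..<t} = {..<m} \<union> ({m} \<union> {Suc m..<t})" using assms by auto
  hence "(\<Sum>l<t. f l * p ^ l) = (\<Sum>l\<in>{..<m} \<union> ({m} \<union> {Suc m..<t}). f l * p ^ l)" by simp
  also have "\<dots> = (\<Sum>l<m. f l * p ^ l) + (\<Sum>l\<in>{m} \<union> {Suc m..<t}. f l * p ^ l)"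
    by (rule sum.union_disjoint) auto
  also have "(\<Sum>l\<in>{m} \<union> {Suc m..<t}. f l * p ^ l) = f m * p ^ m + (\<Sum>l\<in>{Suc m..<t}. f l * p ^ l)"
    by simp
  also have "(\<Sum>l\<in>{Suc m..<t}. f l * p ^ l) = p ^ m * (p * (\<Sum>l\<in>{Suc m..<t}. f l * p ^ (l - Suc m)))"
    unfolding sum_distrib_left
    by (intro sum.cong refl) (simp flip: power_add power_Suc add: ac_simps)
  finally have "(\<Sum>l<t. f l * p ^ l) = (\<Sum>l<m. f l * p ^ l) + p ^ m * (f m + p * (\<Sum>l\<in>{Suc m..<t}. f l
      * p ^ (l - Suc m)))"
    by (simp add: algebra_simps)
  moreover have "(\<Sum>l<m. f l * p ^ l) < p ^ m" using assms by (intro sum_digits_upper) auto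
  ultimately have "(\<Sum>l<t. f l * p ^ l) div p ^ m = f m + p * (\<Sum>l\<in>{Suc m..<t}. f l * p ^ (l - Suc m))"
    using assms(2) by (simp add: div_mult_self2)
  moreover have "f m < p"
  proof -
    have "f m \<le> p - 1" using assms by blast
    thus ?thesis using assms(2) by linarith
  qed
  ultimately show ?thesis by simp
qed

lemma sum_p_digits:
  assumes "0 < p" "m < p ^ t"
  shows "(\<Sum>l<t. p_digit p m l * p ^ l) = m"
proof -
  have "(\<Sum>l<t. p_digit p m l * p ^ l) = m mod p ^ t"
  proof (induction t)
    case (Suc t)
    have "m mod p ^ Suc t = p ^ t * (m div p ^ t mod p) + m mod p ^ t"
      using mod_mult2_eq[of m "p ^ t" p] by (simp add: mult.commute)
    thus ?case using Suc by (simp add: p_digit_def mult.commute)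
  qed simp
  thus ?thesis using assms by simp
qed

text \<open>Greedy filling. It serves to redistribute a column of digits over prescribed
  variables.\<close>

lemma bounded_sum_exists:
  assumes "finite A" "N \<le> m * card A"
  shows "\<exists>f. (\<forall>i. f i \<le> m) \<and> (\<forall>i. i \<notin> A \<longrightarrow> f i = 0) \<and> (\<Sum>i\<in>A. f i) = (N::nat)"
  using assms
proof (induction A arbitrary: N rule: finite_induct)
  case empty
  thus ?case by (intro exI[of _ "\<lambda>_. 0"]) auto
next
  case (insert x A)
  have "N - min m N \<le> m * card A" using insert.prems insert.hyps by auto
  from insert.IH[OF this] obtain f where f: "\<forall>i. f i \<le> m" "\<forall>i. i \<notin> A \<longrightarrow> f i = 0" "(\<Sum>i\<in>A. f i) = N
      - min m N" by blast
  have "(\<Sum>i\<in>insert x A. (f(x := min m N)) i) = min m N + (\<Sum>i\<in>A. f i)"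
  proof -
    have "(\<Sum>i\<in>A. (f(x := min m N)) i) = (\<Sum>i\<in>A. f i)" using insert.hyps by (intro sum.cong) auto
    thus ?thesis using insert.hyps by simp
  qed
  thus ?case using f by (intro exI[of _ "f(x := min m N)"]) auto
qed

section \<open>Digit matrices and their types\<close>

context unram
begin

lemma wt_0: "l < t \<Longrightarrow> wt 0 l = p ^ l" by (simp add: wt_def)

lemma wt_pos: "wt j l > 0" using p_ge_2 by (simp add: wt_def)

text \<open>Passing from j to \<open>nx j\<close> divides every weight by p, except that of digit j,
  which jumps from 1 to p^(t-1) and accounts for the term with q - 1. This links neighbouring
  entries of a type.\<close>

lemma sum_weighted_relation:
  assumes "j < t"
  shows "p * (\<Sum>l<t. x l * wt (nx j) l) = (\<Sum>l<t. x l * wt j l) + (q - 1) * x j"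
proof -
  have inj: "nx j = nx l \<longleftrightarrow> l = j" if "l < t" for l using that assms by (metis pv_nx)
  have "p * (\<Sum>l<t. x l * wt (nx j) l) = (\<Sum>l<t. x l * (p * wt (nx j) l))"
    by (simp add: sum_distrib_left ac_simps)
  also have "\<dots> = (\<Sum>l<t. x l * wt j l + (if l = j then (q - 1) * x l else 0))"
    using inj assms by (intro sum.cong refl) (simp add: p_wt wt_nx_nx algebra_simps)
  also have "\<dots> = (\<Sum>l<t. x l * wt j l) + (q - 1) * x j"
    using assms by (simp add: sum.distrib)
  finally show ?thesis .
qed

lemma sum_wt:
  assumes "j < t" shows "(\<Sum>l<t. (p - 1) * wt j l) = q - 1"
proof -
  have "p * (\<Sum>l<t. wt j l) = (\<Sum>l<t. p * wt j l)" by (simp add: sum_distrib_left)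
  also have "\<dots> = (\<Sum>l<t. (\<lambda>l. wt j l + (if j = l then q - 1 else 0)) (nx l))"
    using assms by (intro sum.cong refl) (simp add: p_wt)
  also have "\<dots> = (\<Sum>l<t. wt j l + (if j = l then q - 1 else 0))" by (rule sum_nx)
  also have "\<dots> = (\<Sum>l<t. wt j l) + (q - 1)" using assms by (simp add: sum.distrib)
  finally have "(p - 1) * (\<Sum>l<t. wt j l) = q - 1" using p_ge_2 by (simp add: diff_mult_distrib)
  thus ?thesis by (simp add: sum_distrib_left)
qed

definition val :: "('n \<Rightarrow> nat \<Rightarrow> nat) \<Rightarrow> 'n \<Rightarrow> nat" where
  "val D i = (\<Sum>l<t. D i l * p ^ l)"

text \<open>\<open>D i l\<close> is the digit \<open>l\<close> of the exponent of the variable \<open>i\<close>. The second condition is the inverse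
  of the formula \<open>(q - 1) s\<^sub>j = \<Sum>\<^sub>i \<Sum>\<^sub>l D i l * wt j l\<close>.\<close>

definition dtype :: "(nat \<Rightarrow> nat) \<Rightarrow> ('n::finite \<Rightarrow> nat \<Rightarrow> nat) \<Rightarrow> bool" where
  "dtype s D \<longleftrightarrow> (\<forall>i. \<forall>l<t. D i l \<le> p - 1) \<and> (\<forall>l<t. (\<Sum>i\<in>UNIV. D i l) + s l = p * s (nx l))"

text \<open>Weighting the relations in \<open>dtype\<close> by \<open>wt j l\<close> and summing
  around the cycle cancels everything but the wrap-around term at j.\<close>

lemma dtype_weight:
  assumes "dtype s D" "j < t"
  shows "(\<Sum>i\<in>UNIV. \<Sum>l<t. D i l * wt j l) = (q - 1) * s j"
proof -
  have "(\<Sum>l<t. (\<Sum>i\<in>UNIV. D i l) * wt j l) + (\<Sum>l<t. s l * wt j l) = (\<Sum>l<t. p * s (nx l) * wt j l)"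
    using assms unfolding sum.distrib[symmetric]
        by (intro sum.cong refl) (auto simp: dtype_def simp flip: distrib_right)
  also have "\<dots> = (\<Sum>l<t. (\<lambda>l. s l * wt j l + (if l = j then (q - 1) * s l else 0)) (nx l))"
    using assms(2) by (intro sum.cong refl) (simp add: p_wt mult.assoc mult.left_commute[of p]
        distrib_left)
  also have "\<dots> = (\<Sum>l<t. s l * wt j l + (if l = j then (q - 1) * s l else 0))" by (rule sum_nx)
  also have "\<dots> = (\<Sum>l<t. s l * wt j l) + (q - 1) * s j" using assms(2) by (simp add: sum.distrib)
  finally have "(\<Sum>l<t. (\<Sum>i\<in>UNIV. D i l) * wt j l) = (q - 1) * s j" by simp
  moreover have "(\<Sum>i\<in>UNIV. \<Sum>l<t. D i l * wt j l) = (\<Sum>l<t. (\<Sum>i\<in>UNIV. D i l) * wt j l)"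
    by (subst sum.swap) (simp add: sum_distrib_right)
  ultimately show ?thesis by simp
qed

lemma val_le:
  assumes "\<forall>l<t. D i l \<le> p - 1" shows "val D i \<le> q - 1"
proof -
  have "val D i < p ^ t" unfolding val_def using assms p_ge_2 by (intro sum_digits_upper) auto
  thus ?thesis by (simp add: q_eq)
qed

lemma val_div_mod: "\<forall>l<t. D i l \<le> p - 1 \<Longrightarrow> m < t \<Longrightarrow> val D i div p ^ m mod p = D i m"
  unfolding val_def using p_ge_2 by (intro sum_digits_div_mod) auto

text \<open>The bound on \<open>s 0\<close> excludes the vector with all entries q - 1, for which
  \<open>s 0\<close> would be the number of variables.\<close>

lemma dtype_exponents:
  fixes D :: "'n::finite \<Rightarrow> nat \<Rightarrow> nat"
  assumes "dtype s D" "s 0 < CARD('n)"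
  shows "val D \<in> exponents q"
proof -
  have sum: "(\<Sum>i\<in>UNIV. val D i) = (q - 1) * s 0"
    using dtype_weight[OF assms(1) t_pos] by (simp add: val_def wt_0)
  moreover have "val D i \<le> q - 1" for i using assms(1) by (intro val_le) (auto simp: dtype_def)
  moreover have "val D \<noteq> (\<lambda>i. q - 1)"
  proof
    assume "val D = (\<lambda>i. q - 1)"
    hence "(\<Sum>i\<in>UNIV. val D i) = CARD('n) * (q - 1)" by simp
    hence "(q - 1) * s 0 = (q - 1) * CARD('n)" unfolding sum by (simp only: mult.commute)
    moreover have "q - 1 \<noteq> 0" using q_ge_2 by simp
    ultimately show False using assms(2) by (metis mult_cancel1 less_irrefl)
  qed
  ultimately show ?thesis by (auto simp: exponents_def)
qed

text \<open>Integrality of \<open>s j\<close> comes from \<open>dvd_wt_sum\<close>. The lower bound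
  holds because some digit is positive, the strict upper bound because some digit is below p -
  1.\<close>

lemma exponents_dtype:
  fixes b :: "'n::finite \<Rightarrow> nat"
  assumes b: "b \<in> exponents q" "b \<noteq> (\<lambda>i. 0)" and D_def: "D = (\<lambda>i. p_digit p (b i))"
  obtains s where "dtype s D" "val D = b" "\<And>j. j < t \<Longrightarrow> 1 \<le> s j" "\<And>j. j < t \<Longrightarrow> s j < CARD('n)"
    "\<And>j. j < t \<Longrightarrow> of_nat (s j) = monomial_type p t b j"
proof -
  have bq: "b i < p ^ t" for i
  proof -
    have "b i \<le> q - 1" using b(1) by (simp add: exponents_def)
    thus ?thesis using q_ge_2 unfolding q_eq by linarith
  qed
  have val: "val D = b" using sum_p_digits[OF _ bq] p_ge_2 by (auto simp: val_def D_def)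
  have D: "D i l \<le> p - 1" for i l
  proof -
    have "D i l < p" using p_ge_2 by (simp add: D_def p_digit_def)
    thus ?thesis by linarith
  qed
  define W where "W j = (\<Sum>i\<in>UNIV. \<Sum>l<t. D i l * wt j l)" for j
  have W_eq: "W j = (\<Sum>l<t. (\<Sum>i\<in>UNIV. D i l) * wt j l)" for j
    unfolding W_def by (subst sum.swap) (simp add: sum_distrib_right)
  define s where "s j = W j div (q - 1)" for j
  have W: "W j = (q - 1) * s j" if "j < t" for j
  proof -
    have "(q - 1) dvd (\<Sum>i\<in>UNIV. val D i)" using b(1) val by (simp add: exponents_def)
    also have "(\<Sum>i\<in>UNIV. val D i) = (\<Sum>l<t. (\<Sum>i\<in>UNIV. D i l) * p ^ l)"
      unfolding val_def by (subst sum.swap) (simp add: sum_distrib_right)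
    finally have "(q - 1) dvd W j" unfolding W_eq by (rule dvd_wt_sum[OF that])
    thus ?thesis unfolding s_def by (rule dvd_mult_div_cancel[symmetric])
  qed
  have "(\<Sum>i\<in>UNIV. D i l) + s l = p * s (nx l)" if l: "l < t" for l
  proof -
    have "(q - 1) * (p * s (nx l)) = p * W (nx l)" by (simp add: W)
    also have "\<dots> = W l + (q - 1) * (\<Sum>i\<in>UNIV. D i l)" unfolding W_eq by (rule sum_weighted_relation[OF l])
    also have "\<dots> = (q - 1) * ((\<Sum>i\<in>UNIV. D i l) + s l)" unfolding W[OF l]
        by (simp only: distrib_left add.commute)
    finally have "(q - 1) * (p * s (nx l)) = (q - 1) * ((\<Sum>i\<in>UNIV. D i l) + s l)" .
    moreover have "q - 1 \<noteq> 0" using q_ge_2 by simp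
    ultimately show ?thesis by (metis mult_cancel1)
  qed
  hence "dtype s D" using D by (auto simp: dtype_def)
  moreover have "1 \<le> s j" if j: "j < t" for j
  proof -
    obtain i where "b i \<noteq> 0" using b(2) by auto
    hence "val D i \<noteq> 0" using val by simp
    then obtain l where l: "l < t" "D i l \<noteq> 0" by (auto simp: val_def)
    have "0 < D i l * wt j l" using l wt_pos by simp
    also have "\<dots> \<le> (\<Sum>l<t. D i l * wt j l)" using l by (intro member_le_sum) auto
    also have "\<dots> \<le> W j" unfolding W_def by (intro member_le_sum) auto
    finally show ?thesis using W[OF j] by (cases "s j") auto
  qed
  moreover have "s j < CARD('n)" if j: "j < t" for j
  proof -
    have "\<exists>i l. l < t \<and> D i l < p - 1"
    proof (rule ccontr)
      assume "\<not> ?thesis"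
      hence "D i l = p - 1" if "l < t" for i l using that D[of i l] by (meson le_antisym not_less)
      hence "val D i = q - 1" for i using sum_wt[OF t_pos] by (simp add: val_def wt_0)
      thus False using val b(1) by (auto simp: exponents_def)
    qed
    then obtain i0 l0 where il: "l0 < t" "D i0 l0 < p - 1" by blast
    have le: "(\<Sum>l<t. D i l * wt j l) \<le> (\<Sum>l<t. (p - 1) * wt j l)" for i
      using D by (intro sum_mono mult_right_mono) auto
    have "(\<Sum>l<t. D i0 l * wt j l) < (\<Sum>l<t. (p - 1) * wt j l)"
      using D il wt_pos by (intro sum_strict_mono_ex1) (auto intro: mult_right_mono)
    hence "W j < (\<Sum>i\<in>(UNIV :: 'n set). \<Sum>l<t. (p - 1) * wt j l)"
      unfolding W_def using le by (intro sum_strict_mono_ex1) auto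
    also have "\<dots> = (q - 1) * CARD('n)" using sum_wt[OF j] by simp
    finally show ?thesis using W[OF j] by simp
  qed
  moreover have "of_nat (s j) = monomial_type p t b j" if j: "j < t" for j
  proof -
    have "(\<Sum>l<j. p ^ (l + t - j) * p_digit p (b i) l) + (\<Sum>l=j..<t. p ^ (l - j) * p_digit p (b i) l)
       = (\<Sum>l<t. D i l * wt j l)" for i
    proof -
      have "{..<t} = {..<j} \<union> {j..<t}" using j by auto
      hence "(\<Sum>l<t. D i l * wt j l) = (\<Sum>l\<in>{..<j} \<union> {j..<t}. D i l * wt j l)" by simp
      also have "\<dots> = (\<Sum>l<j. D i l * wt j l) + (\<Sum>l=j..<t. D i l * wt j l)"
        by (intro sum.union_disjoint) auto
      also have "(\<Sum>l<j. D i l * wt j l) = (\<Sum>l<j. p ^ (l + t - j) * p_digit p (b i) l)"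
        using j by (intro sum.cong refl) (simp add: D_def wt_def)
      also have "(\<Sum>l=j..<t. D i l * wt j l) = (\<Sum>l=j..<t. p ^ (l - j) * p_digit p (b i) l)"
      proof (intro sum.cong refl)
        fix l assume l: "l \<in> {j..<t}"
        hence "l + t - j = t + (l - j)" by auto
        hence "(l + t - j) mod t = (l - j) mod t" by (simp only: mod_add_self1)
        also have "\<dots> = l - j" using l by auto
        finally have "(l + t - j) mod t = l - j" .
        thus "D i l * wt j l = p ^ (l - j) * p_digit p (b i) l" by (simp add: D_def wt_def)
      qed
      finally show ?thesis by simp
    qed
    hence "monomial_type p t b j = of_nat (W j) / of_nat (q - 1)"
      unfolding monomial_type_def W_def q_eq by simp
    thus ?thesis using W[OF j] q_ge_2 by simp
  qed
  ultimately show ?thesis using that val by blast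
qed

end

section \<open>Digit moves inside the sets \<open>H i\<close>\<close>

context incidence_snf
begin

lemma H_coeff:
  assumes I: "finite I" "inj_on g I" "g ` I \<subseteq> exponents q"
    and "(\<lambda>Z. \<Sum>d\<in>I. c d * mon (g d) Z) \<in> Mbar r i" and d: "d \<in> I" "c d \<noteq> 0"
  shows "g d \<in> H i"
proof -
  define c' where "c' b = (if b \<in> g ` I then c (inv_into I g b) else 0)" for b
  have "(\<Sum>d\<in>I. c d * mon (g d) Z) = (\<Sum>b\<in>exponents q. c' b * mon b Z)" for Z
  proof -
    have "(\<Sum>d\<in>I. c d * mon (g d) Z) = (\<Sum>d\<in>I. c' (g d) * mon (g d) Z)"
      using I by (intro sum.cong refl) (simp add: c'_def)
    also have "\<dots> = (\<Sum>b\<in>g ` I. c' b * mon b Z)" using I(2) by (simp add: sum.reindex)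
    also have "\<dots> = (\<Sum>b\<in>exponents q. c' b * mon b Z)"
      using I finite_exponents by (intro sum.mono_neutral_left) (auto simp: c'_def)
    finally show ?thesis .
  qed
  hence "(\<lambda>Z. \<Sum>b\<in>exponents q. c' b * mon b Z) \<in> Mbar r i" using assms(4) by simp
  moreover have "g d \<in> exponents q" "c' (g d) \<noteq> 0" using d I by (auto simp: c'_def)
  ultimately show ?thesis by (rule Mbar_coeff_H)
qed

text \<open>Reduction of exponents with respect to \<open>x\<^sup>q = x\<close>, for exponents up to \<open>2 * (q - 1)\<close>.\<close>

definition redq :: "nat \<Rightarrow> nat" where "redq m = (if q \<le> m then m - (q - 1) else m)"

lemma redq_cong: "[redq m = m] (mod (q - 1))"
  using q_ge_2 by (auto simp: redq_def cong_def mod_if[of "m"] le_mod_geq)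

lemma redq_power: "(a :: 'k) ^ redq m = a ^ m"
  using q_ge_2 by (intro field_cong redq_cong) (auto simp: redq_def)

text \<open>Extracts a coefficient of the substitution \<open>x\<^sub>a \<mapsto> x\<^sub>a + x\<^sub>c\<close>.\<close>

lemma H_move:
  assumes b: "b \<in> H i" and ac: "a \<noteq> c" and d: "d \<le> b a" "\<not> p dvd (b a choose d)"
  shows "b(a := b a - d, c := redq (b c + d)) \<in> H i"
proof -
  define g where "g e = b(a := b a - e, c := redq (b c + e))" for e
  have be: "b \<in> exponents q" "mon b \<in> Mbar r i" using b by (auto simp: H_def)
  have g: "g e \<in> exponents q" if e: "e \<le> b a" for e
  proof -
    have rest: "(\<Sum>j\<in>UNIV. f j) = f a + (f c + (\<Sum>j\<in>UNIV - {a} - {c}. f j))" for f :: "'n \<Rightarrow> nat"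
      using ac by (simp add: sum.remove[of UNIV a] sum.remove[of "UNIV - {a}" c])
    have "(\<Sum>j\<in>UNIV. g e j) = (b a - e) + (redq (b c + e) + (\<Sum>j\<in>UNIV - {a} - {c}. b j))"
      unfolding rest g_def using ac by simp
    moreover have "[(b a - e) + (redq (b c + e) + (\<Sum>j\<in>UNIV - {a} - {c}. b j)) = (b a
        - e) + ((b c + e) + (\<Sum>j\<in>UNIV - {a} - {c}. b j))] (mod (q - 1))"
      by (intro cong_add cong_refl redq_cong)
    moreover have "(b a - e) + ((b c + e) + (\<Sum>j\<in>UNIV - {a} - {c}. b j)) = (\<Sum>j\<in>UNIV. b j)"
      unfolding rest using e by simp
    ultimately have "[(\<Sum>j\<in>UNIV. g e j) = (\<Sum>j\<in>UNIV. b j)] (mod (q - 1))" by simp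
    hence "(q - 1) dvd (\<Sum>j\<in>UNIV. g e j)" using be(1) by (simp add: exponents_def cong_dvd_iff)
    moreover have bq: "b j \<le> q - 1" for j using be(1) by (simp add: exponents_def)
    hence "g e j \<le> q - 1" for j
    proof -
      have "b a - e \<le> q - 1" "redq (b c + e) \<le> q - 1"
        using bq[of a] bq[of c] e q_ge_2 unfolding redq_def by (linarith, simp split: if_split, linarith)
      thus ?thesis using bq[of j] by (auto simp: g_def)
    qed
    moreover have "g e \<noteq> (\<lambda>j. q - 1)"
    proof
      assume eq: "g e = (\<lambda>j. q - 1)"
      have "b a - e = q - 1" using fun_cong[OF eq, of a] ac by (simp add: g_def)
      hence e0: "e = 0" "b a = q - 1" using bq[of a] e q_ge_2 by linarith+
      have "redq (b c) = b c" using bq[of c] q_ge_2 by (auto simp: redq_def)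
      hence "g e = b" using e0 by (auto simp: g_def)
      thus False using eq be(1) by (simp add: exponents_def)
    qed
    ultimately show ?thesis by (auto simp: exponents_def)
  qed
  have "(\<lambda>Z. if Z \<in> points then mon b (shear a c 1 ` Z) else 0)
      = (\<lambda>Z. \<Sum>e\<in>{..b a}. of_nat (b a choose e) * mon (g e) Z)"
  proof
    fix Z :: "('k ^ 'n) set"
    show "(if Z \<in> points then mon b (shear a c 1 ` Z) else 0)
        = (\<Sum>e\<in>{..b a}. of_nat (b a choose e) * mon (g e) Z)"
    proof (cases "Z \<in> points")
      case True
      then obtain z where z: "z \<noteq> 0" "Z = vec.span {z}" by (rule point_obtain)
      have rest: "(\<Prod>j\<in>UNIV. f j) = f a * (f c * (\<Prod>j\<in>UNIV - {a} - {c}. f j))" for f :: "'n \<Rightarrow> 'k"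
        using ac by (simp add: prod.remove[of UNIV a] prod.remove[of "UNIV - {a}" c])
      define P where "P = (\<Prod>j\<in>UNIV - {a} - {c}. z $ j ^ b j)"
      have "mon b (shear a c 1 ` Z) = (\<Prod>j\<in>UNIV. shear a c 1 z $ j ^ b j)"
        unfolding z(2) shear_span by (rule mon_span[OF shear_nz[OF ac z(1)] be(1)])
      also have "\<dots> = (z $ a + z $ c) ^ b a * (z $ c ^ b c * P)"
        unfolding rest P_def using ac by (simp add: shear_nth)
      also have "(z $ a + z $ c) ^ b a = (z $ c + z $ a) ^ b a" by (simp add: add.commute)
      also have "\<dots> * (z $ c ^ b c * P) = (\<Sum>e\<le>b a. of_nat (b a choose e) * (z $ a ^ (b a
          - e) * (z $ c ^ redq (b c + e) * P)))"
        unfolding binomial_ring sum_distrib_right redq_power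
        by (intro sum.cong refl) (simp add: power_add ac_simps)
      also have "\<dots> = (\<Sum>e\<le>b a. of_nat (b a choose e) * mon (g e) Z)"
      proof (intro sum.cong refl arg_cong2[of _ _ _ _ "(*)"])
        fix e assume "e \<in> {..b a}"
        hence "mon (g e) Z = (\<Prod>j\<in>UNIV. z $ j ^ g e j)" using z(1) g unfolding z(2)
            by (intro mon_span) auto
        also have "\<dots> = z $ a ^ (b a - e) * (z $ c ^ redq (b c + e) * P)"
          unfolding rest P_def g_def using ac by simp
        finally show "z $ a ^ (b a - e) * (z $ c ^ redq (b c + e) * P) = mon (g e) Z" by simp
      qed
      finally show ?thesis using True by simp
    qed (simp add: point_monomial_def)
  qed
  hence "(\<lambda>Z. \<Sum>e\<in>{..b a}. of_nat (b a choose e) * mon (g e) Z) \<in> Mbar r i"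
    using Mbar_shear[OF ac be(2), of 1] by simp
  \<comment> \<open>The terms are distinct monomials, told apart by the exponent of
    \<open>a\<close>, so no cancellation can occur.\<close>
  moreover have "inj_on g {..b a}"
  proof (rule inj_onI)
    fix x y assume "x \<in> {..b a}" "y \<in> {..b a}" and eq: "g x = g y"
    moreover from fun_cong[OF eq, of a] have "b a - x = b a - y" using ac by (simp add: g_def)
    ultimately show "x = y" by auto
  qed
  moreover have "of_nat (b a choose d) \<noteq> (0::'k)" using d(2) of_nat_k_eq_0_iff by blast
  ultimately have "g d \<in> H i" using g d(1) by (intro H_coeff[of "{..b a}"]) auto
  thus ?thesis by (simp add: g_def)
qed

text \<open>By Lucas, the binomial coefficient required by \<open>H_move\<close> for d = p^l is the
  digit \<open>D a l\<close> modulo p, which is nonzero. Carries in the variable \<open>c\<close>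
  are allowed.\<close>

lemma H_digit_move:
  assumes "val D \<in> H i" "a \<noteq> c" "l < t" and D: "\<And>i l. l < t \<Longrightarrow> D i l \<le> p - 1" and "D a l > 0"
  shows "(val D)(a := val D a - p ^ l, c := redq (val D c + p ^ l)) \<in> H i"
proof (rule H_move[OF assms(1,2)])
  have "D a l * p ^ l \<le> val D a" unfolding val_def using assms(3) by (intro member_le_sum) auto
  moreover have "1 * p ^ l \<le> D a l * p ^ l" using assms(5) by (intro mult_right_mono) auto
  ultimately show "p ^ l \<le> val D a" by linarith
  have "[val D a choose p ^ l = val D a div p ^ l] (mod p)" using choose_prime_power[OF prime_p] .
  moreover have "val D a div p ^ l mod p = D a l" using D assms(3) by (intro val_div_mod) auto
  ultimately have "(val D a choose p ^ l) mod p = D a l" by (simp add: cong_def)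
  thus "\<not> p dvd (val D a choose p ^ l)" using assms(5) by auto
qed

lemma val_upd:
  assumes "l < t"
  shows "val (D(i := (D i)(l := x))) i + D i l * p ^ l = val D i + x * p ^ l"
proof -
  have "val (D(i := (D i)(l := x))) i = x * p ^ l + (\<Sum>m\<in>{..<t} - {l}. D i m * p ^ m)"
    unfolding val_def using assms by (simp add: sum.remove[of "{..<t}" l])
  moreover have "val D i = D i l * p ^ l + (\<Sum>m\<in>{..<t} - {l}. D i m * p ^ m)"
    unfolding val_def using assms by (simp add: sum.remove[of "{..<t}" l])
  ultimately show ?thesis by simp
qed

lemma val_upd_other: "i \<noteq> k \<Longrightarrow> val (D(k := f)) i = val D i" by (simp add: val_def)

lemma val_cong: "(\<And>l. l < t \<Longrightarrow> D i l = D' i l) \<Longrightarrow> val D i = val D' i"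
  by (simp add: val_def)

text \<open>Induction on the total excess of \<open>D\<close> over \<open>D'\<close>. Equal types
  have equal column sums, so an excess at \<open>a\<close> comes with a deficit at some
  \<open>c\<close> in the same column; moving one unit there causes no carry because
  \<open>D c l\<close> is below \<open>D' c l\<close>, hence below p - 1.\<close>

lemma H_same_type:
  assumes "dtype s D" "dtype s D'" "val D \<in> H i"
  shows "val D' \<in> H i"
  using assms(1,3)
proof (induction "\<Sum>i\<in>UNIV. \<Sum>l<t. D i l - D' i l" arbitrary: D rule: less_induct)
  case less
  have D: "D k l \<le> p - 1" and D': "D' k l \<le> p - 1" and col: "(\<Sum>k\<in>UNIV. D k l) = (\<Sum>k\<in>UNIV. D' k l)"
      if "l < t" for k l
    using less.prems(1) assms(2) that unfolding dtype_def by (blast, blast, metis add_right_cancel)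
  show ?case
  proof (cases "\<exists>l<t. \<exists>a. D' a l < D a l")
    case True
    then obtain l a where la: "l < t" "D' a l < D a l" by blast
    have "\<exists>c. D c l < D' c l"
    proof (rule ccontr)
      assume "\<not> ?thesis"
      hence "(\<Sum>k\<in>UNIV. D' k l) < (\<Sum>k\<in>UNIV. D k l)" using la
          by (intro sum_strict_mono_ex1) (auto simp: not_less)
      thus False using col[OF la(1)] by simp
    qed
    then obtain c where c: "D c l < D' c l" ..
    have ac: "a \<noteq> c" using c la by auto
    define D1 where "D1 = D(a := (D a)(l := D a l - 1))"
    define D2 where "D2 = D1(c := (D1 c)(l := D1 c l + 1))"
    have D1c: "D1 c = D c" using ac by (simp add: D1_def)
    have v1: "val D1 a + p ^ l = val D a"
    proof -
      have "val D1 a + D a l * p ^ l = val D a + (D a l - 1) * p ^ l" unfolding D1_def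
          by (rule val_upd[OF la(1)])
      moreover have "D a l * p ^ l = (D a l - 1) * p ^ l + p ^ l" using la(2) by (cases "D a l") auto
      ultimately show ?thesis by simp
    qed
    have v2: "val D2 c = val D c + p ^ l"
    proof -
      have "val D2 c + D1 c l * p ^ l = val D1 c + (D1 c l + 1) * p ^ l" unfolding D2_def
          by (rule val_upd[OF la(1)])
      moreover have "val D1 c = val D c" using ac by (simp add: D1_def val_upd_other)
      moreover have "(D1 c l + 1) * p ^ l = D1 c l * p ^ l + p ^ l"
        by (simp only: distrib_right mult_1_left)
      ultimately show ?thesis by linarith
    qed
    have D2: "D2 k m \<le> p - 1" if "m < t" for k m
      using D[OF that, of k] D'[OF that, of k] c ac by (auto simp: D2_def D1_def)
    have vc: "redq (val D c + p ^ l) = val D2 c"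
      using v2 val_le[of D2 c] D2 q_ge_2 by (auto simp: redq_def)
    have "(val D)(a := val D a - p ^ l, c := redq (val D c + p ^ l)) \<in> H i"
      using less.prems(2) ac la D by (intro H_digit_move) auto
    also have "(val D)(a := val D a - p ^ l, c := redq (val D c + p ^ l)) = val D2"
    proof
      fix k
      show "((val D)(a := val D a - p ^ l, c := redq (val D c + p ^ l))) k = val D2 k"
        using vc v1 ac by (auto simp: D2_def D1_def val_upd_other)
    qed
    finally have "val D2 \<in> H i" .
    moreover have "(\<Sum>k\<in>UNIV. D2 k m) = (\<Sum>k\<in>UNIV. D k m)" for m
    proof (cases "m = l")
      case True
      have "(\<Sum>k\<in>UNIV. D2 k l) = D2 a l + (D2 c l + (\<Sum>k\<in>UNIV - {a} - {c}. D2 k l))"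
        using ac by (simp add: sum.remove[of UNIV a] sum.remove[of "UNIV - {a}" c])
      also have "(\<Sum>k\<in>UNIV - {a} - {c}. D2 k l) = (\<Sum>k\<in>UNIV - {a} - {c}. D k l)"
        by (intro sum.cong) (auto simp: D2_def D1_def)
      also have "D2 a l + (D2 c l + (\<Sum>k\<in>UNIV - {a} - {c}. D k l)) = D a l + (D c l + (\<Sum>k\<in>UNIV - {a}
          - {c}. D k l))"
        using ac la by (auto simp: D2_def D1_def)
      also have "\<dots> = (\<Sum>k\<in>UNIV. D k l)"
        using ac by (simp add: sum.remove[of UNIV a] sum.remove[of "UNIV - {a}" c])
      finally show ?thesis using True by simp
    next
      case False
      thus ?thesis by (intro sum.cong) (auto simp: D2_def D1_def)
    qed
    hence "dtype s D2" using less.prems(1) D2 by (auto simp: dtype_def)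
    moreover have "(\<Sum>k\<in>UNIV. \<Sum>m<t. D2 k m - D' k m) < (\<Sum>k\<in>UNIV. \<Sum>m<t. D k m - D' k m)"
    proof (rule sum_strict_mono_ex1)
      have le: "D2 k m - D' k m \<le> D k m - D' k m" for k m using ac c by (auto simp: D2_def D1_def)
      thus "\<forall>k\<in>UNIV. (\<Sum>m<t. D2 k m - D' k m) \<le> (\<Sum>m<t. D k m - D' k m)" by (auto intro: sum_mono)
      have "D2 a l - D' a l < D a l - D' a l" using la ac by (auto simp: D2_def D1_def)
      hence "(\<Sum>m<t. D2 a m - D' a m) < (\<Sum>m<t. D a m - D' a m)"
        using la(1) le by (intro sum_strict_mono_ex1) auto
      thus "\<exists>k\<in>UNIV. (\<Sum>m<t. D2 k m - D' k m) < (\<Sum>m<t. D k m - D' k m)" by blast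
    qed simp
    ultimately show ?thesis using less.hyps by blast
  next
    case False
    have "D k l = D' k l" if l: "l < t" for k l
    proof (rule ccontr)
      assume "D k l \<noteq> D' k l"
      hence "D k l < D' k l" using False l by (meson linorder_neqE_nat)
      moreover have "\<forall>x. D x l \<le> D' x l" using False l by (meson not_le_imp_less)
      ultimately have "(\<Sum>k\<in>UNIV. D k l) < (\<Sum>k\<in>UNIV. D' k l)"
        by (intro sum_strict_mono_ex1) auto
      thus False using col[OF l] by simp
    qed
    hence "val D = val D'" by (intro ext val_cong)
    thus ?thesis using less.prems(2) by simp
  qed
qed

text \<open>By \<open>H_same_type\<close> the monomial may be taken to be the product of x_i^(q-1)
  over r variables. Over the corresponding coordinate subspace its values sum to (-1)^r, which rules
  out \<open>Mbar r 1\<close>.\<close>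

lemma H_type_base:
  assumes "dtype s D" "\<And>j. j < t \<Longrightarrow> s j = r" "val D \<in> H i"
  shows "i = 0"
proof (rule ccontr)
  assume "i \<noteq> 0"
  hence H1: "val D \<in> H 1" using assms(3) H_mono[of 1 i] by auto
  obtain A :: "'n set" where A: "card A = r"
    using obtain_subset_with_card_n[of r "UNIV :: 'n set"] card_n r_le by (metis le_SucI Suc_eq_plus1)
  define D' where "D' i l = (if i \<in> A then p - 1 else 0)" for i :: 'n and l :: nat
  have "dtype s D'"
    unfolding dtype_def
  proof (intro conjI allI impI)
    fix l assume l: "l < t"
    have "(\<Sum>i\<in>UNIV. D' i l) = (p - 1) * r" by (simp add: D'_def sum.If_cases A)
    thus "(\<Sum>i\<in>UNIV. D' i l) + s l = p * s (nx l)" using l p_ge_2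
        by (simp add: assms(2) diff_mult_distrib)
  qed (simp add: D'_def)
  from H_same_type[OF assms(1) this H1] have "val D' \<in> H 1" .
  moreover have v: "val D' = (\<lambda>i. if i \<in> A then q - 1 else 0)"
    using sum_wt[OF t_pos] by (auto simp: val_def D'_def wt_0)
  ultimately obtain x where x: "x \<in> Mfil r 1" "mon (val D') = res \<circ> x" and b: "val D' \<in> exponents q"
    by (auto simp: H_def Mbar_def)
  define Y :: "('k ^ 'n) set" where "Y = {x. \<forall>i. i \<notin> A \<longrightarrow> x $ i = 0}"
  have Ysub: "vec.subspace Y" by (auto simp: Y_def vec.subspace_def)
  have "Y \<in> subspaces_dim r" using Ysub dim_substandard_cart[of A] A
      by (simp add: subspaces_dim_def Y_def)
  hence "of_nat p dvd (\<Sum>Z\<in>points_in Y. x Z)" using x(1) by (simp add: Mfil_def)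
  hence "res (\<Sum>Z\<in>points_in Y. x Z) = 0" by (simp only: res_eq_0_iff)
  hence "(\<Sum>Z\<in>points_in Y. mon (val D') Z) = 0" unfolding x(2) by (simp add: res_sum)
  hence sum0: "(\<Sum>a\<in>Y - {0}. \<Prod>i\<in>UNIV. (a $ i) ^ val D' i) = 0"
    using sum_over_points[OF Ysub, of "\<lambda>a. \<Prod>i\<in>UNIV. (a $ i) ^ val D' i"
        "mon (val D')"] mon_span[OF _ b] by simp
  \<comment> \<open>Since r \<ge> 1 the monomial vanishes at the zero vector, so that vector may be
    included in the sum.\<close>
  have A0: "A \<noteq> {}" using A r_ge by auto
  have prod: "(\<Prod>i\<in>UNIV. (a $ i) ^ val D' i) = (\<Prod>i\<in>A. a $ i ^ (q - 1))" for a :: "'k ^ 'n"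
    unfolding v by (intro prod.mono_neutral_cong_right) auto
  have "(\<Prod>i\<in>A. (0::'k ^ 'n) $ i ^ (q - 1)) = 0"
    using A0 q_ge_2 by (auto simp: power_0_left card_eq_0_iff)
  hence "(\<Sum>a\<in>Y - {0}. \<Prod>i\<in>UNIV. (a $ i) ^ val D' i) = (\<Sum>a\<in>Y. \<Prod>i\<in>UNIV. (a $ i) ^ val D' i)"
    unfolding prod by (intro sum.mono_neutral_left) auto
  also have "\<dots> = (\<Sum>y\<in>PiE A (\<lambda>_. UNIV). \<Prod>i\<in>A. y i ^ (q - 1))"
    unfolding prod
    by (rule sum.reindex_bij_witness[of _ "\<lambda>y. \<chi> i. if i \<in> A then y i else 0"
        "\<lambda>a. restrict (vec_nth a) A"])
       (auto simp: Y_def vec_eq_iff fun_eq_iff PiE_def extensional_def)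
  also have "\<dots> = (\<Prod>i\<in>A. \<Sum>u\<in>UNIV. u ^ (q - 1))" by (subst prod_sum_PiE) simp_all
  also have "\<dots> = (-1) ^ r" using q_ge_2 A by (simp add: sum_field_power)
  finally show False using sum0 by simp
qed

end

section \<open>Raising the type\<close>

context unram
begin

text \<open>By Frobenius, T(1 + u)^(p^l) is 1 + T(u)^(p^l) modulo p, and a p-th power improves this
  to p^2. The congruence for \<open>b\<close> presents T(1 + u)^b as a further b0-th power.\<close>

lemma teich_add_power_cong:
  assumes "l < t" "[b = p ^ nx l * b0] (mod (q - 1))" "b > 0 \<longleftrightarrow> b0 > 0"
  shows "of_nat p ^ 2 dvd T (1 + u) ^ b - (1 + T u ^ p ^ l) ^ (p * b0)"
proof -
  have "T (1 + u) ^ p ^ l = T (1 + u ^ p ^ l)"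
    using freshmans_dream'[of "p ^ l" l 1 u] prime_p CHAR_k by (simp flip: teich_power)
  hence "of_nat p ^ 1 dvd T (1 + u) ^ p ^ l - (1 + T u ^ p ^ l)"
    by (simp flip: res_eq_iff)
  hence "of_nat p ^ Suc 1 dvd (T (1 + u) ^ p ^ l) ^ p - (1 + T u ^ p ^ l) ^ p"
    by (intro prime_power_diff_lift prime_p) auto
  moreover have "(T (1 + u) ^ p ^ l) ^ p = T (1 + u) ^ (p ^ nx l)"
    using teich_p_power_nx[OF assms(1), of "1 + u"] by (simp add: mult.commute flip: power_mult)
  ultimately have "of_nat p ^ 2 dvd T (1 + u) ^ (p ^ nx l) - (1 + T u ^ p ^ l) ^ p"
    by (simp add: numeral_2_eq_2 One_nat_def)
  hence "of_nat p ^ 2 dvd (T (1 + u) ^ (p ^ nx l)) ^ b0 - ((1 + T u ^ p ^ l) ^ p) ^ b0"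
    unfolding power_diff_sumr2[of _ b0] by (rule dvd_mult2)
  moreover have "T (1 + u) ^ b = (T (1 + u) ^ (p ^ nx l)) ^ b0"
    unfolding power_mult[symmetric] using assms p_ge_2 by (intro teich_cong) auto
  ultimately show ?thesis by (simp flip: power_mult)
qed

text \<open>Modulo \<open>p\<^sup>2\<close> the Jacobi sum is \<open>q - 1\<close> times the binomial coefficient \<open>p * b0\<close> over \<open>p - 1\<close>.
  Subtracting 1 only matters for \<open>d = q - 1\<close>, where it separates the exponents \<open>0\<close> and \<open>q - 1\<close>.\<close>

lemma jacobi_coefficient:
  assumes q: "q > 2" and l: "l < t" and b: "[b = p ^ nx l * b0] (mod (q - 1))" "b > 0"
    and b0: "\<not> p dvd b0" "p * b0 \<le> q" "p * b0 < q + p - 2"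
    and d: "d = (p - 1) * p ^ l"
  obtains z where "(\<Sum>u\<in>UNIV. T u ^ (q - 1 - d) * (T (1 + u) ^ b - 1)) = of_nat p * z" "res z \<noteq> 0"
proof -
  have b0pos: "b0 > 0" using b0(1) by (auto intro: gr0I)
  have dq: "d \<le> q - 1"
  proof -
    have "p * p ^ l \<le> p ^ t" using l p_ge_2 by (simp flip: power_Suc)
    hence "d + p ^ l \<le> q" using p_ge_2 by (cases p) (auto simp: d q_eq)
    moreover have "p ^ l \<ge> 1" using p_ge_2 by simp
    ultimately show ?thesis by linarith
  qed
  obtain c where c: "(p * b0 choose (p - 1)) = p * c" "\<not> p dvd c"
    using choose_p_minus_1[OF prime_p b0(1)] .
  define S where "S = (\<Sum>u\<in>UNIV. T u ^ (q - 1 - d) * ((1 + T u ^ p ^ l) ^ (p * b0) - 1))"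
  have "S = of_nat (q - 1) * of_nat (p * c)"
  proof -
    have exp: "(1 + x) ^ (p * b0) - 1 = (\<Sum>k\<in>{1..p * b0}. of_nat (p * b0 choose k) * x ^ k)" for x :: 'r
    proof -
      have "(1 + x) ^ (p * b0) = (x + 1) ^ (p * b0)" by (simp add: add.commute)
      also have "\<dots> = (\<Sum>k\<le>p * b0. of_nat (p * b0 choose k) * x ^ k)" by (simp add: binomial_ring)
      also have "{..p * b0} = insert 0 {1..p * b0}" by auto
      finally show ?thesis by simp
    qed
    have "S = (\<Sum>u\<in>UNIV. \<Sum>k\<in>{1..p * b0}. of_nat (p * b0 choose k) * T u ^ (q - 1 - d + p ^ l * k))"
      unfolding S_def exp sum_distrib_left by (intro sum.cong refl) (simp add: power_add power_mult
          mult.left_commute)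
    also have "\<dots> = (\<Sum>k\<in>{1..p * b0}. of_nat (p * b0 choose k) * (\<Sum>u\<in>UNIV. T u ^ (q - 1 - d + p ^ l * k)))"
      by (subst sum.swap) (simp add: sum_distrib_left)
    also have "\<dots> = (\<Sum>k\<in>{1..p * b0}. if k = p - 1 then of_nat (p * b0 choose k) * of_nat (q - 1) else 0)"
    proof (intro sum.cong refl)
      fix k assume k: "k \<in> {1..p * b0}"
      \<comment> \<open>Cancelling p^l leaves k congruent to p - 1 modulo q - 1. Within 1 \<le> k
        \<le> p * b0 the bound p * b0 < q + p - 2 leaves k = p - 1 as the only solution.\<close>
      have iff: "(q - 1) dvd (q - 1 - d + p ^ l * k) \<longleftrightarrow> k = p - 1"
      proof
        assume "(q - 1) dvd (q - 1 - d + p ^ l * k)"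
        hence "[q - 1 - d + p ^ l * k + d = 0 + d] (mod (q - 1))"
          by (intro cong_add cong_refl) (simp add: cong_0_iff)
        moreover have "q - 1 - d + p ^ l * k + d = (q - 1) + p ^ l * k" using dq by simp
        moreover have "0 + d = p ^ l * (p - 1)" by (simp add: d)
        ultimately have "[(q - 1) + p ^ l * k = p ^ l * (p - 1)] (mod (q - 1))" by (simp only:)
        hence "[p ^ l * k = p ^ l * (p - 1)] (mod (q - 1))" by (simp add: cong_def)
        hence *: "[k = p - 1] (mod (q - 1))" using coprime_p_q1 cong_mult_lcancel_nat by blast
        show "k = p - 1"
        proof (cases "k \<le> p - 1")
          case True
          have "p ^ 1 \<le> p ^ t" using t_pos p_ge_2 by (intro power_increasing) auto
          hence "p - 1 - k < q - 1" using k p_ge_2 q_eq by auto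
          moreover have "(q - 1) dvd (p - 1 - k)" using * True by (meson cong_altdef_nat cong_sym)
          ultimately show ?thesis using True nat_dvd_not_less[of "p - 1 - k" "q - 1"] by auto
        next
          case False
          hence "(q - 1) dvd (k - (p - 1))" using * by (meson cong_altdef_nat nat_le_linear)
          moreover have "k - (p - 1) < q - 1" using k b0(3) p_ge_2 q by auto
          ultimately show ?thesis using False nat_dvd_not_less[of "k - (p - 1)" "q - 1"] by auto
        qed
      next
        assume "k = p - 1"
        hence "q - 1 - d + p ^ l * k = q - 1" using dq by (simp add: d mult.commute)
        thus "(q - 1) dvd (q - 1 - d + p ^ l * k)" by simp
      qed
      have nz: "q - 1 - d + p ^ l * k \<noteq> 0" using k p_ge_2 by auto
      show "of_nat (p * b0 choose k) * (\<Sum>u\<in>UNIV. T u ^ (q - 1 - d + p ^ l * k))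
        = (if k = p - 1 then of_nat (p * b0 choose k) * of_nat (q - 1) else 0)"
        unfolding sum_teich_power if_not_P[OF nz] iff
            by (auto simp only: mult_zero_right split: if_split)
    qed
    also have "\<dots> = of_nat (p * b0 choose (p - 1)) * of_nat (q - 1)"
    proof -
      have "1 * p \<le> b0 * p" using b0pos by (intro mult_right_mono) auto
      hence "1 \<le> p - 1 \<and> p - 1 \<le> p * b0" using p_ge_2 unfolding mult.commute[of b0] by linarith
      hence "p - 1 \<in> {1..p * b0}" by simp
      thus ?thesis by simp
    qed
    finally show ?thesis unfolding c(1) by (simp only: mult.commute)
  qed
  moreover have "of_nat p ^ 2 dvd (\<Sum>u\<in>UNIV. T u ^ (q - 1 - d) * (T (1 + u) ^ b - 1)) - S"
    unfolding S_def sum_subtractf[symmetric]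
  proof (rule dvd_sum)
    fix u :: 'k
    have "of_nat p ^ 2 dvd T (1 + u) ^ b - (1 + T u ^ p ^ l) ^ (p * b0)"
      using b b0pos by (intro teich_add_power_cong l) auto
    hence "of_nat p ^ 2 dvd T u ^ (q - 1 - d) * (T (1 + u) ^ b - (1 + T u ^ p ^ l) ^ (p * b0))"
      by (rule dvd_mult)
    thus "of_nat p ^ 2 dvd T u ^ (q - 1 - d) * (T (1 + u) ^ b - 1) - T u ^ (q - 1
        - d) * ((1 + T u ^ p ^ l) ^ (p * b0) - 1)"
      by (simp add: algebra_simps)
  qed
  ultimately obtain w where w: "(\<Sum>u\<in>UNIV. T u ^ (q - 1 - d) * (T (1 + u) ^ b - 1)) - of_nat (q
      - 1) * of_nat (p * c) = of_nat p ^ 2 * w"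
    by (auto elim: dvdE)
  have "(\<Sum>u\<in>UNIV. T u ^ (q - 1 - d) * (T (1 + u) ^ b - 1)) = of_nat p * (of_nat (q
      - 1) * of_nat c + of_nat p * w)"
    using w by (simp only: of_nat_mult) (simp add: algebra_simps power2_eq_square)
  moreover have "res (of_nat (q - 1) * of_nat c + of_nat p * w) \<noteq> 0"
    using c(2) by (simp only: res_add res_mult res_of_nat of_nat_q1_k of_nat_p_eq_0) (simp add:
        of_nat_k_eq_0_iff)
  ultimately show ?thesis using that by blast
qed

text \<open>For nonzero x and y the substitution of u * (x / y) for u pulls out the monomial by
  homogeneity. For y = 0 both sides vanish. For x = 0 the left side is a power sum of T, which is
  zero because \<open>b\<close> and \<open>d\<close> are incongruent, and the right side vanishes
  because e > 0.\<close>

lemma jacobi_expansion: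
  fixes x y :: 'k
  assumes q: "q > 2" and d: "0 < d" "d \<le> q - 1" and e: "e > 0" "[e + d = b] (mod (q - 1))"
    and b: "b > 0" "\<not> [b = d] (mod (q - 1))"
  shows "(\<Sum>u\<in>UNIV. T u ^ (q - 1 - d) * (T (x + u * y) ^ b - T x ^ b)) =
    (\<Sum>u\<in>UNIV. T u ^ (q - 1 - d) * (T (1 + u) ^ b - 1)) * (T x ^ e * T y ^ d)"
proof (cases "y = 0")
  case True
  thus ?thesis using d by (simp add: power_0_left)
next
  case y: False
  show ?thesis
  proof (cases "x = 0")
    case True
    have "\<not> (q - 1) dvd (q - 1 - d + b)"
    proof
      assume "(q - 1) dvd (q - 1 - d + b)"
      hence "[q - 1 - d + b + d = 0 + d] (mod (q - 1))"
          by (intro cong_add cong_refl) (simp add: cong_0_iff)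
      hence "[(q - 1) + b = d] (mod (q - 1))" using d by (simp add: ac_simps)
      thus False using b(2) by (simp add: cong_def)
    qed
    hence "(\<Sum>u\<in>UNIV. T u ^ (q - 1 - d + b)) = 0" using b(1) by (simp add: sum_teich_power)
    hence "(\<Sum>u\<in>UNIV. T u ^ (q - 1 - d + b)) * T y ^ b = 0" by simp
    moreover have "(\<Sum>u\<in>UNIV. T u ^ (q - 1 - d) * (T (x + u * y) ^ b - T x ^ b)) = (\<Sum>u\<in>UNIV. T u ^ (q
        - 1 - d + b)) * T y ^ b"
      unfolding sum_distrib_right using True b(1)
      by (intro sum.cong refl) (simp add: teich_mult power_mult_distrib power_add ac_simps power_0_left)
    ultimately show ?thesis using True e(1) by (simp add: power_0_left)
  next
    case x: False
    have "T x ^ (q - 1 - d) * T x ^ b = T x ^ e * T y ^ (q - 1 - d) * T y ^ d"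
    proof -
      have "T x ^ (q - 1 - d + b) = T x ^ e"
      proof (rule teich_cong)
        have "[q - 1 - d + b = q - 1 - d + (e + d)] (mod (q - 1))" using e(2)
            by (intro cong_add cong_refl) (rule cong_sym)
        also have "q - 1 - d + (e + d) = (q - 1) + e" using d by simp
        also have "[(q - 1) + e = e] (mod (q - 1))" by (simp add: cong_def)
        finally show "[q - 1 - d + b = e] (mod (q - 1))" .
      qed (use b e in auto)
      moreover have "T y ^ (q - 1 - d) * T y ^ d = 1"
        using power_q1_mult[OF y, of 1] d by (simp flip: power_add)
      ultimately show ?thesis by (simp add: power_add mult.assoc)
    qed
    hence key: "T (x / y) ^ (q - 1 - d) * T x ^ b = T x ^ e * T y ^ d" if "T x ^ (q-1-d)
        = T (x / y) ^ (q - 1 - d) * T y ^ (q - 1 - d)"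
      using that y by (simp add: ac_simps)
    have xy: "T x = T (x / y) * T y" using y by (simp flip: teich_mult)
    have key: "T (x / y) ^ (q - 1 - d) * T x ^ b = T x ^ e * T y ^ d"
      by (rule key) (metis xy power_mult_distrib)
    have "(\<Sum>u\<in>UNIV. T u ^ (q - 1 - d) * (T (x + u * y) ^ b - T x ^ b))
       = (\<Sum>u\<in>UNIV. T (u * (x / y)) ^ (q - 1 - d) * (T (x + (u * (x / y)) * y) ^ b - T x ^ b))"
      using x y by (intro sum.reindex_bij_witness[of _ "\<lambda>u. u * (x / y)" "\<lambda>u. u / (x / y)"]) auto
    also have "\<dots> = (\<Sum>u\<in>UNIV. T u ^ (q - 1 - d) * (T (1 + u) ^ b - 1)) * (T (x / y) ^ (q - 1
        - d) * T x ^ b)"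
      unfolding sum_distrib_right
    proof (intro sum.cong refl)
      fix u
      have "x + (u * (x / y)) * y = x * (1 + u)" using y by (simp add: algebra_simps)
      thus "T (u * (x / y)) ^ (q - 1 - d) * (T (x + (u * (x / y)) * y) ^ b - T x ^ b) =
        T u ^ (q - 1 - d) * (T (1 + u) ^ b - 1) * (T (x / y) ^ (q - 1 - d) * T x ^ b)"
        by (simp only: teich_mult power_mult_distrib) (simp add: algebra_simps)
    qed
    finally show ?thesis unfolding key .
  qed
qed

end

section \<open>Changing the type of a monomial, and the resulting bounds\<close>

context incidence_snf
begin

text \<open>Summing the transvected lifts, minus the original, against the character T(u)^(q-1-d)
  isolates the part of degree d in the moved variable. By \<open>jacobi_expansion\<close> it is
  \<open>Tmon b'\<close> times a Jacobi sum p * z, and dividing by p * z costs exactly one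
  level.\<close>

lemma Mfil_raise:
  fixes b :: "'n \<Rightarrow> nat"
  assumes b: "b \<in> exponents q" "Tmon b \<in> Mfil r (Suc i)" and ac: "a \<noteq> c"
    and l: "l < t" and b0: "[b a = p ^ nx l * b0] (mod (q - 1))" "b a > 0"
      "\<not> p dvd b0" "p * b0 \<le> q" "p * b0 < q + p - 2"
    and d: "d = (p - 1) * p ^ l" and e: "e > 0" "[e + d = b a] (mod (q - 1))" "\<not> [b a = d] (mod (q - 1))"
    and b': "b' = b(a := e, c := b c + d)" "b' \<in> exponents q"
  shows "Tmon b' \<in> Mfil r i"
proof -
  have d0: "d > 0" using p_ge_2 by (simp add: d)
  have dq: "d \<le> q - 1"
  proof -
    have "b' c = b c + d" by (simp add: b')
    moreover have "b' c \<le> q - 1" using b'(2) by (simp add: exponents_def)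
    ultimately show ?thesis by simp
  qed
  obtain z where z: "(\<Sum>u\<in>UNIV. T u ^ (q - 1 - d) * (T (1 + u) ^ b a - 1)) = of_nat p * z" "res z \<noteq> 0"
    using jacobi_coefficient[OF q_gt_2 l b0 d] .
  define \<phi> where "\<phi> u Z = (if Z \<in> points then Tmon b (shear a c u ` Z) else 0)" for u Z
  have "(\<lambda>Z. \<Sum>u\<in>UNIV. T u ^ (q - 1 - d) * (\<phi> u Z - Tmon b Z)) \<in> Mfil r (Suc i)"
    unfolding \<phi>_def using b(2) ac by (intro Mfil_sum Mfil_scale Mfil_diff Mfil_shear)
  moreover have "(\<Sum>u\<in>UNIV. T u ^ (q - 1 - d) * (\<phi> u Z - Tmon b Z)) = of_nat p ^ 1 * z * Tmon b' Z" for Z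
  proof (cases "Z \<in> points")
    case False
    thus ?thesis by (simp add: \<phi>_def point_monomial_def)
  next
    case True
    then obtain v where v: "v \<noteq> 0" "Z = vec.span {v}" by (rule point_obtain)
    have rest: "(\<Prod>j\<in>UNIV. f j) = f a * (f c * (\<Prod>j\<in>UNIV - {a} - {c}. f j))" for f :: "'n \<Rightarrow> 'r"
      using ac by (simp add: prod.remove[of UNIV a] prod.remove[of "UNIV - {a}" c])
    define P where "P = T (v $ c) ^ b c * (\<Prod>j\<in>UNIV - {a} - {c}. T (v $ j) ^ b j)"
    have 1: "\<phi> u Z = T (v $ a + u * v $ c) ^ b a * P" for u
    proof -
      have "\<phi> u Z = Tmon b (vec.span {shear a c u v})" using True by (simp add: \<phi>_def v(2) shear_span)
      also have "\<dots> = (\<Prod>j\<in>UNIV. T (shear a c u v $ j) ^ b j)"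
          by (rule Tmon_span[OF shear_nz[OF ac v(1)] b(1)])
      also have "\<dots> = T (v $ a + u * v $ c) ^ b a * P"
        unfolding rest P_def using ac by (simp add: shear_nth)
      finally show ?thesis .
    qed
    have 2: "Tmon b Z = T (v $ a) ^ b a * P"
      unfolding v(2) Tmon_span[OF v(1) b(1)] rest P_def ..
    have 3: "Tmon b' Z = T (v $ a) ^ e * T (v $ c) ^ d * P"
      unfolding v(2) Tmon_span[OF v(1) b'(2)] unfolding rest P_def using ac
          by (simp add: b'(1) power_add)
    have "(\<Sum>u\<in>UNIV. T u ^ (q - 1 - d) * (\<phi> u Z - Tmon b Z)) =
      (\<Sum>u\<in>UNIV. T u ^ (q - 1 - d) * (T (v $ a + u * v $ c) ^ b a - T (v $ a) ^ b a)) * P"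
      unfolding 1 2 sum_distrib_right by (intro sum.cong refl) (simp add: algebra_simps)
    also have "\<dots> = of_nat p * z * (T (v $ a) ^ e * T (v $ c) ^ d) * P"
      unfolding jacobi_expansion[OF q_gt_2 d0 dq e(1,2) b0(2) e(3)] z(1) ..
    also have "\<dots> = of_nat p ^ 1 * z * Tmon b' Z" unfolding 3 by (simp add: mult.assoc)
    finally show ?thesis .
  qed
  ultimately have "(\<lambda>Z. of_nat p ^ 1 * z * Tmon b' Z) \<in> Mfil r (Suc i)" by simp
  hence "(\<lambda>Z. of_nat p ^ 1 * z * Tmon b' Z) \<in> Mfil r (1 + i)" by (simp only: plus_1_eq_Suc)
  thus ?thesis by (rule Mfil_cancel[OF z(2)])
qed

lemma sum_two:
  fixes f :: "'n \<Rightarrow> nat"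
  assumes "a \<noteq> c" shows "(\<Sum>k\<in>UNIV. f k) = f a + (f c + (\<Sum>k\<in>UNIV - {a} - {c}. f k))"
  using assms by (simp add: sum.remove[of UNIV a] sum.remove[of "UNIV - {a}" c])

lemma dtype_replace_column:
  assumes "dtype s D" "l < t" "\<And>k. f k \<le> p - 1" "(\<Sum>k\<in>UNIV. f k) = (\<Sum>k\<in>UNIV. D k l)"
  shows "dtype s (\<lambda>k. (D k)(l := f k))"
  unfolding dtype_def
proof (intro conjI allI impI)
  fix m assume m: "m < t"
  have "(\<Sum>k\<in>UNIV. ((D k)(l := f k)) m) = (\<Sum>k\<in>UNIV. D k m)"
    using assms(4) by (cases "m = l") auto
  thus "(\<Sum>k\<in>UNIV. ((D k)(l := f k)) m) + s m = p * s (nx m)" using assms(1) m by (simp add: dtype_def)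
qed (use assms in \<open>auto simp: dtype_def\<close>)

lemma digit_of_q_minus_1:
  assumes "\<And>l. l < t \<Longrightarrow> D k l \<le> p - 1" "val D k = q - 1" "m < t"
  shows "D k m = p - 1"
proof -
  have "val (\<lambda>_ _. p - 1) k = q - 1" using sum_wt[OF t_pos] by (simp add: val_def wt_0)
  hence "val D k = val (\<lambda>_ _. p - 1) k" using assms(2) by simp
  moreover have "val D k div p ^ m mod p = D k m" using assms by (intro val_div_mod) auto
  moreover have "val (\<lambda>_ _. p - 1) k div p ^ m mod p = p - 1" using assms(3) by (intro val_div_mod) auto
  ultimately show ?thesis by simp
qed

text \<open>\<open>b0\<close> has the digits of \<open>f\<close>, rotated so that digit j comes last
  in significance. It is prime to p because this digit is nonzero. The digit \<open>pv j\<close>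
  becomes the top one; its vanishing gives the upper bounds. For t = 1 one has b0 = 1, and the
  strict bound uses q > 2.\<close>

lemma rotated_value:
  assumes j: "j < t" and f: "\<And>l. l < t \<Longrightarrow> f l \<le> p - 1" and fj: "f j > 0"
    and top: "j \<noteq> pv j \<Longrightarrow> f (pv j) = 0" "j = pv j \<Longrightarrow> f j = 1"
  obtains b0 where "[(\<Sum>l<t. f l * p ^ l) = p ^ j * b0] (mod (q - 1))" "\<not> p dvd b0"
    "p * b0 \<le> q" "p * b0 < q + p - 2"
proof -
  define g where "g m = f ((j + m) mod t)" for m
  define b0 where "b0 = (\<Sum>m<t. g m * p ^ m)"
  have g: "g m \<le> p - 1" for m using f t_pos by (simp add: g_def)
  have "(\<Sum>l<t. f l * p ^ l) = (\<Sum>m<t. g m * p ^ ((j + m) mod t))"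
  proof (rule sum.reindex_bij_witness[of _ "\<lambda>m. (j + m) mod t" "\<lambda>l. (l + (t - j)) mod t"])
    fix l assume l: "l \<in> {..<t}"
    have "(j + (l + (t - j)) mod t) mod t = (j + (l + (t - j))) mod t" by (rule mod_add_right_eq)
    also have "j + (l + (t - j)) = l + t" using j by simp
    finally show *: "(j + (l + (t - j)) mod t) mod t = l" using l by simp
    show "g ((l + (t - j)) mod t) * p ^ ((j + (l + (t - j)) mod t) mod t) = f l * p ^ l"
      unfolding g_def * ..
  next
    fix m assume m: "m \<in> {..<t}"
    have "((j + m) mod t + (t - j)) mod t = (j + m + (t - j)) mod t" by (rule mod_add_left_eq)
    also have "j + m + (t - j) = m + t" using j by simp
    finally show "((j + m) mod t + (t - j)) mod t = m" using m by simp
  qed (use t_pos in auto)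
  also have "[\<dots> = (\<Sum>m<t. g m * p ^ (j + m))] (mod (q - 1))"
    by (intro cong_sum cong_mult cong_refl cong_sym[OF p_power_cong])
  also have "(\<Sum>m<t. g m * p ^ (j + m)) = p ^ j * b0"
    by (simp add: b0_def sum_distrib_left power_add ac_simps)
  finally have "[(\<Sum>l<t. f l * p ^ l) = p ^ j * b0] (mod (q - 1))" .
  moreover have "b0 mod p = f j"
    using sum_digits_div_mod[of t g p 0] g p_ge_2 t_pos j by (simp add: b0_def g_def)
  hence "\<not> p dvd b0" using fj by (auto simp: dvd_eq_mod_eq_0)
  moreover have "p * b0 \<le> q \<and> p * b0 < q + p - 2"
  proof (cases "t = 1")
    case True
    hence "j = 0" "pv j = 0" using j pv_less[of j] by linarith+
    hence "b0 = 1" using True top(2) by (simp add: b0_def g_def One_nat_def)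
    thus ?thesis using True q_eq q_gt_2 by simp
  next
    case False
    obtain t' where t': "t = Suc t'" using t_pos by (cases t) auto
    have "pv j \<noteq> j" using nx_pv[OF j] False j by (auto simp: nx_def mod_if split: if_splits)
    moreover have "j + t - 1 = j + t'" using t' by simp
    hence "g t' = f (pv j)" by (simp add: g_def pv_def)
    ultimately have "g t' = 0" using top(1) by simp
    hence "b0 = (\<Sum>m<t'. g m * p ^ m)" by (simp add: b0_def t')
    also have "\<dots> < p ^ t'" using g p_ge_2 by (intro sum_digits_upper) auto
    finally have "p * (b0 + 1) \<le> p * p ^ t'" by (intro mult_left_mono) auto
    hence "p * b0 + p \<le> q" unfolding q_eq t' by (simp add: distrib_left)
    thus ?thesis using p_ge_2 by linarith
  qed
  ultimately show ?thesis using that by blast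
qed

text \<open>By minimality of \<open>s j\<close>, the column \<open>pv j\<close> has sum at most (p -
  1) * s j, hence at most (p - 1) * (n - 1), so it fits into n - 1 of the n + 1 variables, leaving
  \<open>a\<close> and \<open>c\<close> empty. The column j is not zero, since otherwise
  \<open>s j\<close> would be p times the next entry, against minimality. For t = 1 the two columns
  coincide and \<open>a\<close> receives the digit 1.\<close>

lemma H_raise_arrangement:
  fixes D :: "'n \<Rightarrow> nat \<Rightarrow> nat"
  assumes D: "dtype s D" and bounds: "\<And>j. j < t \<Longrightarrow> 1 \<le> s j"
    and j: "j < t" "\<And>j'. j' < t \<Longrightarrow> s j \<le> s j'" "s j < r"
  obtains D1 :: "'n \<Rightarrow> nat \<Rightarrow> nat" and a c where "dtype s D1" "a \<noteq> c" "D1 a j > 0" "D1 c (pv j) = 0"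
    "j \<noteq> pv j \<Longrightarrow> D1 a (pv j) = 0" "j = pv j \<Longrightarrow> D1 a j = 1"
proof -
  define l where "l = pv j"
  have l: "l < t" "nx l = j" using j by (auto simp: l_def nx_pv)
  define S where "S = (\<Sum>k\<in>UNIV. D k l)"
  have S: "S + s l = p * s j" using D l by (auto simp: dtype_def S_def)
  have "p * s j = (p - 1) * s j + s j" using p_ge_2 by (cases p) auto
  hence "S \<le> (p - 1) * s j" using S j(2)[OF l(1)] by linarith
  also have "\<dots> \<le> (p - 1) * (n - 1)" using j(3) r_le by (intro mult_left_mono) auto
  finally have S_le: "S \<le> (p - 1) * (n - 1)" .
  have n2: "n \<ge> 2" using j bounds[OF j(1)] r_le by linarith
  have cardac: "card (UNIV - {a, c}) = n - 1" if "a \<noteq> c" for a c :: 'n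
    using that card_n by (simp add: card_Diff_subset)
  have ex_other: "\<exists>c. c \<noteq> a" for a :: 'n
  proof (rule ccontr)
    assume "\<not> ?thesis"
    hence "(UNIV :: 'n set) \<subseteq> {a}" by auto
    from card_mono[OF _ this] show False using card_n n2 by simp
  qed
  show ?thesis
  proof (cases "l = j")
    case True
    obtain a c :: 'n where ac: "a \<noteq> c" using ex_other by metis
    have "S + s j = p * s j" using S True by simp
    moreover have "2 * s j \<le> p * s j" using p_ge_2 by (intro mult_right_mono) auto
    ultimately have "S \<ge> 1" using bounds[OF j(1)] by linarith
    have "S - 1 \<le> (p - 1) * card (UNIV - {a, c})" using S_le cardac[OF ac] by simp
    from bounded_sum_exists[OF finite this] obtain f where f: "\<forall>k. f k \<le> p - 1" "\<forall>k. k \<notin> UNIV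
        - {a, c} \<longrightarrow> f k = 0"
      "sum f (UNIV - {a, c}) = S - 1" by blast
    define f' where "f' = f(a := 1)"
    have "UNIV - {a} - {c} = UNIV - {a, c}" by auto
    hence "sum f' UNIV = 1 + (\<Sum>k\<in>UNIV - {a, c}. f' k)"
      using ac f(2) by (subst sum_two[OF ac]) (simp add: f'_def)
    also have "(\<Sum>k\<in>UNIV - {a, c}. f' k) = (\<Sum>k\<in>UNIV - {a, c}. f k)"
        by (intro sum.cong) (auto simp: f'_def)
    finally have "sum f' UNIV = S" using f(3) \<open>S \<ge> 1\<close> by simp
    moreover have "f' k \<le> p - 1" for k using f(1) p_ge_2 by (auto simp: f'_def)
    ultimately have "dtype s (\<lambda>k. (D k)(l := f' k))"
      using dtype_replace_column[OF D l(1)] S_def by blast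
    thus ?thesis using that[of "\<lambda>k. (D k)(l := f' k)" a c] ac f(2) True by (simp add: l_def f'_def)
  next
    case False
    have "\<exists>a. D a j > 0"
    proof (rule ccontr)
      assume "\<not> ?thesis"
      hence "(\<Sum>k\<in>UNIV. D k j) = 0" by simp
      moreover have "(\<Sum>k\<in>UNIV. D k j) + s j = p * s (nx j)" using D j(1) by (simp add: dtype_def)
      ultimately have "s j = p * s (nx j)" by simp
      moreover have "2 * s j \<le> p * s (nx j)" using p_ge_2 j(2)[of "nx j"] by (intro mult_mono) auto
      ultimately show False using bounds[OF j(1)] by linarith
    qed
    then obtain a where a: "D a j > 0" ..
    obtain c where ac: "a \<noteq> c" using ex_other by metis
    have "S \<le> (p - 1) * card (UNIV - {a, c})" using S_le cardac[OF ac] by simp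
    from bounded_sum_exists[OF finite this] obtain f where f: "\<forall>k. f k \<le> p - 1" "\<forall>k. k \<notin> UNIV
        - {a, c} \<longrightarrow> f k = 0"
      "sum f (UNIV - {a, c}) = S" by blast
    have "sum f UNIV = sum f (UNIV - {a, c})" using f(2) by (intro sum.mono_neutral_right) auto
    hence "sum f UNIV = S" using f(3) by simp
    hence "dtype s (\<lambda>k. (D k)(l := f k))"
      using dtype_replace_column[OF D l(1)] f(1) S_def by blast
    thus ?thesis using that[of "\<lambda>k. (D k)(l := f k)" a c] ac f(2) False a by (simp add: l_def)
  qed
qed

lemma nx_eq_iff: "l < t \<Longrightarrow> m < t \<Longrightarrow> nx l = nx m \<longleftrightarrow> l = m"
  by (metis pv_nx)

text \<open>After the arrangement, one unit p^j of \<open>a\<close> is exchanged for p * p^l with l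
  = \<open>pv j\<close>, an equality modulo q - 1: one unit p^l stays in \<open>a\<close>, and p - 1
  units go to the empty digit of \<open>c\<close>. Column j loses 1 and column l gains p, which
  raises \<open>s j\<close> by one. \<open>Mfil_raise\<close> performs the exchange at the price of
  one level.\<close>

lemma H_raise:
  fixes D :: "'n \<Rightarrow> nat \<Rightarrow> nat"
  assumes D: "dtype s D" and bounds: "\<And>j. j < t \<Longrightarrow> 1 \<le> s j" "\<And>j. j < t \<Longrightarrow> s j \<le> n"
    and j: "j < t" "\<And>j'. j' < t \<Longrightarrow> s j \<le> s j'" "s j < r" and H: "val D \<in> H (Suc i)"
  shows "\<exists>D'. dtype (s(j := s j + 1)) D' \<and> val D' \<in> H i"
proof -
  define l where "l = pv j"
  have l: "l < t" "nx l = j" using j by (auto simp: l_def nx_pv)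
  obtain D1 :: "'n \<Rightarrow> nat \<Rightarrow> nat" and a c where D1: "dtype s D1" "a \<noteq> c" "D1 a j > 0" "D1 c l = 0"
    "j \<noteq> l \<Longrightarrow> D1 a l = 0" "j = l \<Longrightarrow> D1 a j = 1"
    using H_raise_arrangement[OF D bounds(1) j] unfolding l_def by metis
  have D1_le: "D1 k m \<le> p - 1" if "m < t" for k m using D1(1) that by (simp add: dtype_def)
  have D1_col: "(\<Sum>k\<in>UNIV. D1 k m) + s m = p * s (nx m)" if "m < t" for m using D1(1) that
      by (simp add: dtype_def)
  have H1: "val D1 \<in> H (Suc i)" using H_same_type[OF D D1(1) H] .
  define Da where "Da = D1(a := (D1 a)(j := D1 a j - 1))"
  define Db where "Db = Da(a := (Da a)(l := 1))"
  define D2 where "D2 = Db(c := (Db c)(l := p - 1))"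
  have D2a: "D2 a = (D1 a)(j := D1 a j - 1, l := 1)" using D1(2) by (simp add: D2_def Db_def Da_def)
  have D2c: "D2 c = (D1 c)(l := p - 1)" using D1(2) by (simp add: D2_def Db_def Da_def)
  have D2o: "D2 k = D1 k" if "k \<noteq> a" "k \<noteq> c" for k using that by (simp add: D2_def Db_def Da_def)
  define e where "e = val D2 a"
  define d where "d = (p - 1) * p ^ l"
  have e_eq: "e + p ^ j = val D1 a + p ^ l"
  proof -
    have "val Da a + D1 a j * p ^ j = val D1 a + (D1 a j - 1) * p ^ j" unfolding Da_def
        by (rule val_upd[OF j(1)])
    moreover have "D1 a j * p ^ j = (D1 a j - 1) * p ^ j + p ^ j" using D1(3) by (cases "D1 a j") auto
    moreover have "val Db a + Da a l * p ^ l = val Da a + 1 * p ^ l" unfolding Db_def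
        by (rule val_upd[OF l(1)])
    moreover have "Da a l = 0" using D1(5,6) by (auto simp: Da_def)
    moreover have "val D2 a = val Db a" using D1(2) by (simp add: D2_def val_upd_other)
    ultimately show ?thesis by (simp add: e_def)
  qed
  have c_eq: "val D2 c = val D1 c + d"
  proof -
    have "val D2 c + Db c l * p ^ l = val Db c + (p - 1) * p ^ l" unfolding D2_def
        by (rule val_upd[OF l(1)])
    moreover have "Db c = D1 c" using D1(2) by (simp add: Db_def Da_def)
    moreover have "val Db c = val D1 c" using D1(2) by (simp add: Db_def Da_def val_upd_other)
    ultimately show ?thesis using D1(4) by (simp add: d_def)
  qed
  have D2_le: "D2 k m \<le> p - 1" if "m < t" for k m
    using D1_le[OF that, of k] p_ge_2 D2o[of k] by (cases "k = a"; cases "k = c") (auto simp: D2a D2c)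
  have ty: "dtype (s(j := s j + 1)) D2"
    unfolding dtype_def
  proof (intro conjI allI impI)
    fix m assume m: "m < t"
    have rest: "(\<Sum>k\<in>UNIV - {a} - {c}. D2 k m) = (\<Sum>k\<in>UNIV - {a} - {c}. D1 k m)"
        by (intro sum.cong) (auto simp: D2o)
    note sums = sum_two[OF D1(2), of "\<lambda>k. D2 k m"] sum_two[OF D1(2), of "\<lambda>k. D1 k m"]
    have pm: "p * (s j + 1) = p * s j + p" by (simp only: distrib_left mult_1_right)
    show "(\<Sum>k\<in>UNIV. D2 k m) + (s(j := s j + 1)) m = p * (s(j := s j + 1)) (nx m)"
    proof (cases "m = l")
      case ml: True
      show ?thesis
      proof (cases "l = j")
        case True
        thus ?thesis using ml sums rest D1_col[OF m] D1(4,6) l p_ge_2 pm by (simp add: D2a D2c)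
      next
        case False
        thus ?thesis using ml sums rest D1_col[OF m] D1(4,5) l p_ge_2 pm by (simp add: D2a D2c)
      qed
    next
      case ml: False
      hence nxm: "nx m \<noteq> j" using nx_eq_iff[OF m l(1)] l by auto
      thus ?thesis using ml sums rest D1_col[OF m] D1(3) by (cases "m = j") (simp_all add: D2a D2c)
    qed
  qed (use D2_le in auto)
  have ed: "[e + d = val D1 a] (mod (q - 1))"
  proof -
    have "e + d + p ^ j = val D1 a + (p ^ l + d)" using e_eq by simp
    also have "p ^ l + d = p ^ Suc l" using p_ge_2 by (cases p) (auto simp: d_def)
    finally have "e + d + p ^ j = val D1 a + p ^ Suc l" .
    moreover have "[p ^ Suc l = p ^ j] (mod (q - 1))" using p_power_cong[of "Suc l"] l
        by (simp add: nx_def)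
    hence "[val D1 a + p ^ Suc l = val D1 a + p ^ j] (mod (q - 1))" by (intro cong_add cong_refl)
    ultimately have "[e + d + p ^ j = val D1 a + p ^ j] (mod (q - 1))" by simp
    thus ?thesis by (simp add: cong_add_rcancel_nat)
  qed
  have pj: "p ^ j \<le> val D1 a"
  proof -
    have "1 * p ^ j \<le> D1 a j * p ^ j" using D1(3) by (intro mult_right_mono) auto
    also have "\<dots> \<le> val D1 a" unfolding val_def using j(1) by (intro member_le_sum) auto
    finally show ?thesis by simp
  qed
  have "p ^ l > 0" using p_ge_2 by simp
  hence e0: "e > 0" using e_eq pj by linarith
  \<comment> \<open>For t = 1 the new digit of \<open>a\<close> is 1; it differs from p - 1 because
    q > 2.\<close>
  have p3: "l = j \<Longrightarrow> p > 2"
  proof -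
    assume "l = j"
    hence "t = 1" using l by (auto simp: nx_def mod_if split: if_splits)
    thus "p > 2" using q_gt_2 q_eq by simp
  qed
  have ne: "e \<noteq> q - 1"
  proof
    assume "e = q - 1"
    hence "D2 a j = p - 1" using digit_of_q_minus_1[of D2 a j] D2_le j(1) by (simp add: e_def)
    thus False using D1_le[OF j(1), of a] D1(3) p3 by (auto simp: D2a split: if_splits)
  qed
  have nd: "\<not> [val D1 a = d] (mod (q - 1))"
  proof
    assume "[val D1 a = d] (mod (q - 1))"
    with ed have "[e + d = 0 + d] (mod (q - 1))" by (metis cong_trans add_0)
    hence "(q - 1) dvd e" unfolding cong_add_rcancel_nat by (simp add: cong_0_iff)
    hence "q - 1 \<le> e" using e0 by (rule dvd_imp_le)
    moreover have "e \<le> q - 1" unfolding e_def using D2_le by (intro val_le) auto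
    ultimately show False using ne by simp
  qed
  obtain b0 where b0: "[val D1 a = p ^ j * b0] (mod (q - 1))" "\<not> p dvd b0" "p * b0 \<le> q"
      "p * b0 < q + p - 2"
    using rotated_value[of j "D1 a", OF j(1) D1_le D1(3) D1(5,6)[unfolded l_def], folded val_def]
        by blast
  have "p ^ j > 0" using p_ge_2 by simp
  hence ba: "val D1 a > 0" using pj by linarith
  \<comment> \<open>\<open>H_lift\<close> asks for an exponent strictly between 0 and q - 1. That of
    \<open>a\<close> qualifies: its digit \<open>l\<close> is 0, or 1 if t = 1, and so is not p -
    1.\<close>
  have bn: "val D1 a < q - 1"
  proof -
    have "val D1 a \<noteq> q - 1"
    proof
      assume "val D1 a = q - 1"
      hence "D1 a l = p - 1" using digit_of_q_minus_1[of D1 a l] D1_le l(1) by simp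
      thus False using D1(5,6) p3 p_ge_2 by (cases "l = j") auto
    qed
    moreover have "val D1 a \<le> q - 1" using D1_le by (intro val_le) auto
    ultimately show ?thesis by simp
  qed
  have "Tmon (val D1) \<in> Mfil r (Suc i)" using H1 ba bn by (intro H_lift) auto
  moreover have "val D1 \<in> exponents q" using H1 by (simp add: H_def)
  moreover have b': "val D2 \<in> exponents q"
    by (rule dtype_exponents[OF ty]) (use bounds(2)[OF t_pos] j(3) r_le in \<open>auto simp: card_n\<close>)
  moreover have "val D2 = (val D1)(a := e, c := val D1 c + d)"
    using c_eq D2o D1(2) by (auto simp: e_def val_def)
  ultimately have "Tmon (val D2) \<in> Mfil r i"
    using D1(2) l b0 ba d_def e0 ed nd by (intro Mfil_raise[of "val D1" i a c l b0 d e "val D2"]) auto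
  hence "mon (val D2) \<in> Mbar r i" unfolding Mbar_def res_Tmon[symmetric] by (rule imageI)
  thus ?thesis using ty b' by (auto simp: H_def)
qed

text \<open>Column l = \<open>pv j\<close> is rearranged so that \<open>c\<close> has the digit p -
  1 and another variable \<open>a\<close> a positive one. Moving p^l from \<open>a\<close> to
  \<open>c\<close> then causes a carry into digit j of \<open>c\<close>. For t > 1 column l loses p
  and column j gains 1; for t = 1 the single column loses p - 1. Either way \<open>s j\<close> drops
  by one and no level is lost. Maximality of \<open>s j\<close> keeps column j from being full, so
  \<open>c\<close> can be chosen such that the carry stops there.\<close>

lemma H_lower:
  fixes D :: "'n \<Rightarrow> nat \<Rightarrow> nat"
  assumes D: "dtype s D" and bounds: "\<And>j. j < t \<Longrightarrow> s j \<le> n"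
    and j: "j < t" "\<And>j'. j' < t \<Longrightarrow> s j' \<le> s j" "r < s j" and H: "val D \<in> H i"
  shows "\<exists>D'. dtype (s(j := s j - 1)) D' \<and> val D' \<in> H i"
proof -
  define l where "l = pv j"
  have l: "l < t" "nx l = j" using j by (auto simp: l_def nx_pv)
  have D_le: "D k m \<le> p - 1" if "m < t" for k m using D that by (simp add: dtype_def)
  have D_col: "(\<Sum>k\<in>UNIV. D k m) + s m = p * s (nx m)" if "m < t" for m using D that
      by (simp add: dtype_def)
  have sj: "s j \<ge> 2" using j(3) r_ge by simp
  have psj: "p * s j = (p - 1) * s j + s j" using p_ge_2 by (cases p) auto
  have "\<exists>c. l \<noteq> j \<longrightarrow> D c j < p - 1"
  proof (rule ccontr)
    assume "\<not> ?thesis"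
    hence "\<And>c. p - 1 \<le> D c j" by (auto simp: not_less)
    hence "(\<Sum>c\<in>(UNIV :: 'n set). p - 1) \<le> (\<Sum>c\<in>UNIV. D c j)" by (intro sum_mono) auto
    hence "(p - 1) * n + (p - 1) \<le> (\<Sum>c\<in>UNIV. D c j)" by (simp add: card_n algebra_simps)
    moreover have "(\<Sum>c\<in>UNIV. D c j) \<le> (p - 1) * s j"
    proof -
      have "p * s (nx j) \<le> p * s j" using j(2)[of "nx j"] by simp
      thus ?thesis using D_col[OF j(1)] psj by linarith
    qed
    moreover have "(p - 1) * s j \<le> (p - 1) * n" using bounds[OF j(1)] by simp
    ultimately show False using p_ge_2 by linarith
  qed
  then obtain c where c: "l \<noteq> j \<Longrightarrow> D c j < p - 1" by blast
  define S where "S = (\<Sum>k\<in>UNIV. D k l)"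
  have S: "S + s l = p * s j" using D_col[OF l(1)] by (simp add: S_def l(2))
  have "(p - 1) * 2 \<le> (p - 1) * s j" using sj by simp
  hence "(p - 1) * 2 \<le> S" using S psj j(2)[OF l(1)] by linarith
  hence S_ge: "S \<ge> p - 1 + 1" using p_ge_2 by linarith
  have "S \<le> (\<Sum>k\<in>(UNIV :: 'n set). p - 1)" unfolding S_def using D_le[OF l(1)] by (intro sum_mono) auto
  hence "S \<le> (p - 1) * n + (p - 1)" by (simp add: card_n algebra_simps)
  hence "S - (p - 1) \<le> (p - 1) * card (UNIV - {c})" by (simp add: card_n card_Diff_singleton)
  from bounded_sum_exists[OF finite this] obtain f where f: "\<forall>k. f k \<le> p - 1" "\<forall>k. k \<notin> UNIV
      - {c} \<longrightarrow> f k = 0"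
    "sum f (UNIV - {c}) = S - (p - 1)" by blast
  have "\<exists>a\<in>UNIV - {c}. f a > 0"
  proof (rule ccontr)
    assume "\<not> ?thesis"
    hence "sum f (UNIV - {c}) = 0" by (intro sum.neutral) auto
    thus False using f(3) S_ge by simp
  qed
  then obtain a where a: "a \<noteq> c" "f a > 0" by auto
  define f' where "f' = f(c := p - 1)"
  define D1 where "D1 = (\<lambda>k. (D k)(l := f' k))"
  have "sum f' UNIV = f' c + sum f' (UNIV - {c})" by (simp add: sum.remove[of UNIV c])
  also have "sum f' (UNIV - {c}) = sum f (UNIV - {c})" by (intro sum.cong) (auto simp: f'_def)
  finally have "sum f' UNIV = S" using f(3) S_ge by (simp add: f'_def)
  moreover have "f' k \<le> p - 1" for k using f(1) by (auto simp: f'_def)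
  ultimately have D1: "dtype s D1" unfolding D1_def using dtype_replace_column[OF D l(1)] S_def by blast
  have D1_le: "D1 k m \<le> p - 1" if "m < t" for k m using D1 that by (simp add: dtype_def)
  have D1_col: "(\<Sum>k\<in>UNIV. D1 k m) + s m = p * s (nx m)" if "m < t" for m using D1 that
      by (simp add: dtype_def)
  have D1al: "D1 a l > 0" and D1cl: "D1 c l = p - 1" using a by (auto simp: D1_def f'_def)
  have D1cj: "D1 c j < p - 1" if "l \<noteq> j" using c[OF that] that by (simp add: D1_def)
  have H1: "val D1 \<in> H i" using H_same_type[OF D D1 H] .
  define Da where "Da = D1(a := (D1 a)(l := D1 a l - 1))"
  define Db where "Db = Da(c := (Da c)(l := 0))"
  define D2 where "D2 = Db(c := (Db c)(j := Db c j + 1))"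
  have D2a: "D2 a = (D1 a)(l := D1 a l - 1)" using a(1) by (simp add: D2_def Db_def Da_def)
  have D2c: "D2 c = (D1 c)(l := 0, j := (if l = j then 0 else D1 c j) + 1)" using a(1)
      by (auto simp: D2_def Db_def Da_def)
  have D2o: "D2 k = D1 k" if "k \<noteq> a" "k \<noteq> c" for k using that by (simp add: D2_def Db_def Da_def)
  have va: "val D2 a = val D1 a - p ^ l"
  proof -
    have "val Da a + D1 a l * p ^ l = val D1 a + (D1 a l - 1) * p ^ l" unfolding Da_def
        by (rule val_upd[OF l(1)])
    moreover have "D1 a l * p ^ l = (D1 a l - 1) * p ^ l + p ^ l" using D1al by (cases "D1 a l") auto
    moreover have "val D2 a = val Da a" using a(1) by (simp add: D2_def Db_def val_upd_other)
    ultimately show ?thesis by simp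
  qed
  have D2_le: "D2 k m \<le> p - 1" if "m < t" for k m
  proof -
    have "D1 a l - 1 \<le> p - 1" using D1_le[OF l(1), of a] by simp
    thus ?thesis using D1_le[OF that, of k] p_ge_2 D2o[of k] D1cj
      by (cases "k = a"; cases "k = c") (auto simp: D2a D2c)
  qed
  have vc: "redq (val D1 c + p ^ l) = val D2 c"
  proof -
    have 1: "val Db c + Da c l * p ^ l = val Da c + 0 * p ^ l" unfolding Db_def
        by (rule val_upd[OF l(1)])
    have 2: "Da c l = p - 1" "val Da c = val D1 c" using a(1) D1cl
        by (simp_all add: Da_def val_upd_other)
    have "val D2 c + Db c j * p ^ j = val Db c + (Db c j + 1) * p ^ j" unfolding D2_def
        by (rule val_upd[OF j(1)])
    moreover have "(Db c j + 1) * p ^ j = Db c j * p ^ j + p ^ j"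
        by (simp only: distrib_right mult_1_left)
    ultimately have 3: "val D2 c = val Db c + p ^ j" by linarith
    have "(p - 1) * p ^ l + p ^ l = p ^ Suc l" using p_ge_2 by (cases p) auto
    hence 4: "val D1 c + p ^ l = val Db c + p ^ Suc l" using 1 2 by simp
    \<comment> \<open>A carry out of the top digit returns at digit 0, since x^q = x; this is the
      case in which \<open>redq\<close> subtracts q - 1.\<close>
    show ?thesis
    proof (cases "Suc l = t")
      case True
      hence "j = 0" using l(2) by (simp add: nx_def)
      moreover have "p ^ Suc l = q" using True q_eq by simp
      ultimately show ?thesis using 3 4 q_ge_2 by (simp add: redq_def)
    next
      case False
      hence "j = Suc l" using l by (auto simp: nx_def mod_if split: if_splits)
      hence "val D1 c + p ^ l = val D2 c" using 3 4 by simp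
      moreover have "val D2 c \<le> q - 1" using D2_le by (intro val_le) auto
      ultimately show ?thesis using q_ge_2 by (simp add: redq_def)
    qed
  qed
  have "(val D1)(a := val D1 a - p ^ l, c := redq (val D1 c + p ^ l)) \<in> H i"
    using H1 a(1) l(1) D1_le D1al by (intro H_digit_move) auto
  also have "(val D1)(a := val D1 a - p ^ l, c := redq (val D1 c + p ^ l)) = val D2"
    using vc va D2o a(1) by (auto simp: val_def)
  finally have "val D2 \<in> H i" .
  moreover have "dtype (s(j := s j - 1)) D2"
    unfolding dtype_def
  proof (intro conjI allI impI)
    fix m assume m: "m < t"
    have rest: "(\<Sum>k\<in>UNIV - {a} - {c}. D2 k m) = (\<Sum>k\<in>UNIV - {a} - {c}. D1 k m)"
        by (intro sum.cong) (auto simp: D2o)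
    note sums = sum_two[OF a(1), of "\<lambda>k. D2 k m"] sum_two[OF a(1), of "\<lambda>k. D1 k m"]
    have pm: "p * (s j - 1) + p = p * s j" using sj by (simp add: algebra_simps)
    show "(\<Sum>k\<in>UNIV. D2 k m) + (s(j := s j - 1)) m = p * (s(j := s j - 1)) (nx m)"
    proof (cases "m = l")
      case ml: True
      show ?thesis
      proof (cases "l = j")
        case True
        have "(\<Sum>k\<in>UNIV. D2 k m) + p = (\<Sum>k\<in>UNIV. D1 k m) + 1"
          using sums rest ml True a(1) D1al D1cl p_ge_2 by (simp add: D2a D2c)
        thus ?thesis using ml True D1_col[OF m] l pm sj by simp
      next
        case False
        have "(\<Sum>k\<in>UNIV. D2 k m) + p = (\<Sum>k\<in>UNIV. D1 k m)"
          using sums rest ml False a(1) D1al D1cl p_ge_2 by (simp add: D2a D2c)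
        thus ?thesis using ml False D1_col[OF m] l pm by simp
      qed
    next
      case ml: False
      hence nxm: "nx m \<noteq> j" using nx_eq_iff[OF m l(1)] l by auto
      show ?thesis
      proof (cases "m = j")
        case True
        have "(\<Sum>k\<in>UNIV. D2 k m) = (\<Sum>k\<in>UNIV. D1 k m) + 1"
          using sums rest ml True by (simp add: D2a D2c)
        thus ?thesis using D1_col[OF m] nxm True sj by simp
      next
        case False
        have "(\<Sum>k\<in>UNIV. D2 k m) = (\<Sum>k\<in>UNIV. D1 k m)"
          using sums rest ml False by (simp add: D2a D2c)
        thus ?thesis using D1_col[OF m] nxm False by simp
      qed
    qed
  qed (use D2_le in auto)
  ultimately show ?thesis by blast
qed

text \<open>Lowering a maximal entry above r repeatedly ends at the type (r, ..., r), where
  \<open>H_type_base\<close> applies.\<close>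

lemma H_high_type:
  fixes D :: "'n \<Rightarrow> nat \<Rightarrow> nat"
  assumes "dtype s D" "\<And>j. j < t \<Longrightarrow> r \<le> s j" "\<And>j. j < t \<Longrightarrow> s j \<le> n" "val D \<in> H i"
  shows "i = 0"
  using assms
proof (induction "\<Sum>j<t. s j" arbitrary: s D rule: less_induct)
  case less
  show ?case
  proof (cases "\<exists>j<t. s j \<noteq> r")
    case False
    thus ?thesis using H_type_base[OF less.prems(1) _ less.prems(4)] by blast
  next
    case True
    have "Max (s ` {..<t}) \<in> s ` {..<t}" using t_pos by (intro Max_in) auto
    then obtain j where j: "j < t" "s j = Max (s ` {..<t})" by auto
    have max: "s j' \<le> s j" if "j' < t" for j' unfolding j(2) using that by (intro Max_ge) auto
    obtain j' where j': "j' < t" "s j' \<noteq> r" using True by blast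
    have "r < s j" using max[OF j'(1)] less.prems(2)[OF j'(1)] j'(2) by linarith
    from H_lower[OF less.prems(1,3) j(1) max this less.prems(4)]
    obtain D' where D': "dtype (s(j := s j - 1)) D'" "val D' \<in> H i" by auto
    have "(\<Sum>m<t. (s(j := s j - 1)) m) < (\<Sum>m<t. s m)"
      using j(1) \<open>r < s j\<close> by (intro sum_strict_mono_ex1) auto
    moreover have "r \<le> (s(j := s j - 1)) m" "(s(j := s j - 1)) m \<le> n" if "m < t" for m
      using less.prems(2,3)[OF that] \<open>r < s j\<close> by auto
    ultimately show ?thesis using less.hyps[OF _ D'(1) _ _ D'(2)] by blast
  qed
qed

text \<open>Raising a minimal entry below r lowers both the level and the bound by one. Once no
  entry is below r, \<open>H_high_type\<close> forces level 0.\<close>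

theorem H_upper:
  fixes D :: "'n \<Rightarrow> nat \<Rightarrow> nat"
  assumes "dtype s D" "\<And>j. j < t \<Longrightarrow> 1 \<le> s j" "\<And>j. j < t \<Longrightarrow> s j \<le> n" "val D \<in> H i"
  shows "i \<le> (\<Sum>j<t. r - s j)"
  using assms
proof (induction i arbitrary: s D)
  case (Suc i)
  show ?case
  proof (cases "\<exists>j<t. s j < r")
    case False
    hence "r \<le> s j" if "j < t" for j using that by (meson not_le_imp_less)
    thus ?thesis using H_high_type[OF Suc.prems(1) _ Suc.prems(3,4)] by blast
  next
    case True
    have "Min (s ` {..<t}) \<in> s ` {..<t}" using t_pos by (intro Min_in) auto
    then obtain j where j: "j < t" "s j = Min (s ` {..<t})" by auto
    have min: "s j \<le> s j'" if "j' < t" for j' unfolding j(2) using that by (intro Min_le) auto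
    have sr: "s j < r" using True min by (meson le_less_trans)
    from H_raise[OF Suc.prems(1-3) j(1) min sr Suc.prems(4)]
    obtain D' where D': "dtype (s(j := s j + 1)) D'" "val D' \<in> H i" by auto
    have "1 \<le> (s(j := s j + 1)) m" "(s(j := s j + 1)) m \<le> n" if "m < t" for m
      using Suc.prems(2,3)[OF that] sr r_le by auto
    hence "i \<le> (\<Sum>m<t. r - (s(j := s j + 1)) m)" using Suc.IH[OF D'(1) _ _ D'(2)] by blast
    also have "\<dots> < (\<Sum>m<t. r - s m)"
      using j(1) sr by (intro sum_strict_mono_ex1) auto
    finally show ?thesis by simp
  qed
qed simp

text \<open>The element \<open>f\<close> need not be the Teichmueller lift, but it has the same
  reduction, so \<open>Bs_level\<close> transfers the lower bound from \<open>Tmon_lower\<close> to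
  it. The upper bound is \<open>H_upper\<close>. Truncated subtraction on naturals becomes the
  maximum with 0.\<close>

theorem invariant_exponent:
  fixes b :: "'n \<Rightarrow> nat"
  assumes f: "f \<in> Bs k" "k < L" "res \<circ> f = mon b" and b: "b \<in> exponents q" "b \<noteq> (\<lambda>i. 0)"
  shows "(of_nat k :: rat) = (\<Sum>j<t. max 0 (of_nat r - monomial_type p t b j))"
proof -
  define D where "D = (\<lambda>i. p_digit p (b i))"
  obtain s where s: "dtype s D" "val D = b" "\<And>j. j < t \<Longrightarrow> 1 \<le> s j" "\<And>j. j < t \<Longrightarrow> s j < CARD('n)"
    "\<And>j. j < t \<Longrightarrow> of_nat (s j) = monomial_type p t b j"
    using exponents_dtype[OF b D_def] by blast
  have sn: "s j \<le> n" if "j < t" for j using s(4)[OF that] card_n by simp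
  have "b \<in> H k" using Bs_Mbar[OF f(2,1)] f(3) b by (simp add: H_def)
  hence "k \<le> (\<Sum>j<t. r - s j)" using H_upper[OF s(1,3) sn] s(2) by simp
  moreover have "(\<Sum>j<t. r - s j) \<le> k"
  proof (rule Bs_level[OF f(1,2)])
    have "b = (\<lambda>i. \<Sum>l<t. D i l * p ^ l)" using s(2) by (auto simp: val_def)
    hence "Tmon b \<in> Mfil r (\<Sum>j<t. r - s j)"
      using dtype_weight[OF s(1)] b by (intro Tmon_lower)
    thus "res \<circ> f \<in> Mbar r (\<Sum>j<t. r - s j)" unfolding f(3) Mbar_def res_Tmon[symmetric] by (rule imageI)
  qed
  ultimately have "k = (\<Sum>j<t. r - s j)" by simp
  hence "(of_nat k :: rat) = (\<Sum>j<t. of_nat (r - s j))" by simp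
  also have "\<dots> = (\<Sum>j<t. max 0 (of_nat r - monomial_type p t b j))"
  proof (intro sum.cong refl)
    fix j assume "j \<in> {..<t}"
    hence "monomial_type p t b j = of_nat (s j)" using s(5) by simp
    thus "of_nat (r - s j) = max 0 (of_nat r - monomial_type p t b j)"
      by (cases "s j \<le> r") (simp_all add: of_nat_diff max_def)
  qed
  finally show ?thesis .
qed

end

theorem theorem7p2:
  fixes p t q n r v :: nat
    and emb :: "(nat \<Rightarrow> int) \<Rightarrow> 'r::idom"
    and \<xi> :: 'r
    and res :: "'r \<Rightarrow> 'k::finite_field"
    and Bs :: "nat \<Rightarrow> (('k ^ 'n::finite) set \<Rightarrow> 'r) set"
    and B :: "(('k ^ 'n) set \<Rightarrow> 'r) set"
    and f' :: "nat \<Rightarrow> ('k ^ 'n) set \<Rightarrow> 'r"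
    and s :: "nat \<Rightarrow> nat \<Rightarrow> rat"
    and \<beta> :: "nat \<Rightarrow> nat"
  assumes q_def: "q = p ^ t"
    and v_def: "v = card (subspaces_dim 1 :: ('k ^ 'n) set set)"
    and R: "unramified_ring p t emb \<xi> res"
    and dim: "CARD('n) = n + 1"
    and q: "q > 2"
    and r: "1 \<le> r" "r \<le> n"
    and B: "snf_basis res p (subspaces_dim 1) (subspaces_dim r) (incidence r) Bs B"
    and reduction: "(\<lambda>f. res \<circ> f) ` B = monomials"
    and lifts: "\<And>b. b \<in> exponents q \<Longrightarrow> (\<exists>i. 0 < b i \<and> b i < q - 1) \<Longrightarrow>
                  point_monomial (teichmueller res) b \<in> B"
    and indexing: "bij_betw f' {1..v} B"
    and first: "\<forall>Z\<in>subspaces_dim 1. res (f' 1 Z) = 1"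
    and type: "\<And>i. i \<in> {2..v} \<Longrightarrow> has_type res p t (f' i) (s i)"
    and invariant: "\<And>i. i \<in> {2..v} \<Longrightarrow>
          snf_invariant res p (subspaces_dim 1) (subspaces_dim r) (incidence r) Bs
            (f' i) (of_nat p ^ \<beta> i)"
  shows "\<forall>i\<in>{2..v}. of_nat (\<beta> i) = (\<Sum>j<t. max 0 (of_nat r - s i j))"
proof
  fix i assume i: "i \<in> {2..v}"
  have qk: "q = CARD('k)" using R q_def by (simp add: unramified_ring_def)
  interpret incidence_snf p t q emb \<xi> res r n Bs B
    using R qk dim q r B reduction lifts by unfold_locales
  obtain k where k: "k < L" "f' i \<in> Bs k" "(of_nat p ^ \<beta> i :: 'r) = of_nat p ^ k"
    using invariant[OF i] by (auto simp: snf_invariant_def L_def)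
  have "\<beta> i = k"
  proof (rule ccontr)
    \<comment> \<open>Equal powers of p in R have equal exponents: otherwise a positive power of p
      would be 1, although its residue is 0.\<close>
    have pow: "False" if "x < y" "(of_nat p ^ x :: 'r) = of_nat p ^ y" for x y :: nat
    proof -
      have "(of_nat p ^ y :: 'r) = of_nat p ^ x * of_nat p ^ (y - x)"
        using that(1) by (simp flip: power_add)
      hence "of_nat p ^ (y - x) = (1 :: 'r)" using that(2) p_nz by simp
      hence "res (of_nat p ^ (y - x)) = 1" by simp
      thus False using that(1) by (simp add: of_nat_p_eq_0 power_0_left)
    qed
    assume "\<beta> i \<noteq> k"
    thus False using pow[of "\<beta> i" k] pow[of k "\<beta> i"] k(3) by (metis linorder_neqE_nat)
  qed
  obtain b where b: "b \<in> exponents CARD('k)" "b \<noteq> (\<lambda>i. 0)" "res \<circ> f' i = point_monomial (\<lambda>x. x) b"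
      "\<And>j. j < t \<Longrightarrow> s i j = monomial_type p t b j"
    using type[OF i] by (auto simp: has_type_def)
  have "of_nat k = (\<Sum>j<t. max 0 (of_nat r - monomial_type p t b j))"
    using k(2,1) b(3) b(1)[folded qk] b(2) by (rule invariant_exponent)
  thus "of_nat (\<beta> i) = (\<Sum>j<t. max 0 (of_nat r - s i j))" using b(4) \<open>\<beta> i = k\<close> by simp
qed

end
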